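(* Every connected graph $G$ satisfying $q(G)\ge |G|-1$ belongs to $\mathcal{G}^{\rm SSP}$.
   Context: All graphs are finite, simple, undirected; $|G|$ is the number of vertices of $G$. For a graph $G$ on $\{1,\ldots,n\}$, $\mathcal{S}(G)$ is the set of real symmetric $n\times n$ matrices $A=(a_{ij})$ with $a_{ij}\neq0$ iff $\{i,j\}\in E(G)$ for $i\neq j$ (diagonal arbitrary). For a real symmetric matrix $A$, $q(A)$ is the number of distinct eigenvalues of $A$, and $q(G)=\min\{q(A): A\in\mathcal{S}(G)\}$. A real symmetric $A$ has the strong spectral property (SSP) if the only real symmetric $X$ with $A\circ X=0$, $I\circ X=0$, $AX-XA=0$ is $X=0$ ($\circ$ = entrywise product). $\mathcal{G}^{\rm SSP}$ is the set of graphs $G$ such that every matrix in $\mathcal{S}(G)$ has the SSP. *)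

theory Defs
  imports "Jordan_Normal_Form.Char_Poly"
begin

text \<open>A simple graph G on the vertex set {0..<n} is given by the number of
vertices n and an edge predicate E, required to be symmetric and irreflexive
on {0..<n}; only its restriction to {0..<n} matters.\<close>

definition simple_graph :: "nat \<Rightarrow> (nat \<Rightarrow> nat \<Rightarrow> bool) \<Rightarrow> bool" where
  "simple_graph n E \<longleftrightarrow> (\<forall>i<n. \<forall>j<n. E i j \<longleftrightarrow> E j i) \<and> (\<forall>i<n. \<not> E i i)"

definition connected_graph :: "nat \<Rightarrow> (nat \<Rightarrow> nat \<Rightarrow> bool) \<Rightarrow> bool" where
  "connected_graph n E \<longleftrightarrow>
     (\<forall>u<n. \<forall>v<n. (\<lambda>x y. x < n \<and> y < n \<and> E x y)\<^sup>*\<^sup>* u v)"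

definition S_graph :: "nat \<Rightarrow> (nat \<Rightarrow> nat \<Rightarrow> bool) \<Rightarrow> real mat set" where
  "S_graph n E = {A. A \<in> carrier_mat n n \<and> transpose_mat A = A \<and>
      (\<forall>i<n. \<forall>j<n. i \<noteq> j \<longrightarrow> (A $$ (i,j) \<noteq> 0 \<longleftrightarrow> E i j))}"

definition q_mat :: "real mat \<Rightarrow> nat" where
  "q_mat A = card {x. eigenvalue A x}"

definition q_graph :: "nat \<Rightarrow> (nat \<Rightarrow> nat \<Rightarrow> bool) \<Rightarrow> nat" where
  "q_graph n E = (LEAST k. \<exists>A\<in>S_graph n E. q_mat A = k)"

definition SSP :: "real mat \<Rightarrow> bool" where
  "SSP A \<longleftrightarrow> (\<forall>X \<in> carrier_mat (dim_row A) (dim_row A).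
      transpose_mat X = X \<longrightarrow>
      (\<forall>i<dim_row A. \<forall>j<dim_row A. A $$ (i,j) * X $$ (i,j) = 0) \<longrightarrow>
      (\<forall>i<dim_row A. X $$ (i,i) = 0) \<longrightarrow>
      A * X - X * A = 0\<^sub>m (dim_row A) (dim_row A) \<longrightarrow>
      X = 0\<^sub>m (dim_row A) (dim_row A))"

definition G_SSP :: "nat \<Rightarrow> (nat \<Rightarrow> nat \<Rightarrow> bool) \<Rightarrow> bool" where
  "G_SSP n E \<longleftrightarrow> (\<forall>A\<in>S_graph n E. SSP A)"

end

(* A graph G on n vertices has a matrix with at most n - 2 distinct
   eigenvalues as soon as it has a subgraph H carrying a pencil (N, J), J >= 0
   diagonal, with two double eigenvalues 0 and 1 in general position: perturbing N within its own
   pattern absorbs the remaining edges of G and a positive definite mass matrix M, and then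
   M^(-1/2) N M^(-1/2) is a matrix of G with two double eigenvalues.  Such pencils exist for cycles of
   length at least 4, for paths with two leaves at both ends, and for the spider, net and campstool;
   a vertex with four separated neighbours is handled by a Laplacian.  Inspecting a longest path shows that
   a connected graph without these configurations is a path, a path with one chord between vertices
   at distance 2, or a path with one extra leaf.  For these, the matrices X of the strong spectral
   property vanish by induction on the distance from the diagonal. *)

theory Submission
  imports Defs "HOL-Analysis.Brouwer_Fixpoint" "Jordan_Normal_Form.Determinant"
begin

text \<open>Two double eigenvalues, or one triple one, account for the two values by which
  \<open>q\<close> falls below \<open>n\<close>. The obstacle is that a matrix of G must be nonzero
  on every edge, while closed forms are at hand only for special subgraphs, so multiplicities have
  to survive a perturbation. A generalized problem with mass \<open>J\<close> replaces the ordinary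
  eigenvalue problem because zero mass on a long stretch of path makes both kernels linear there:
  pencils of every length then have rational entries, and general position can be tested on a
  bounded number of entries. The star with four leaves carries no such pencil. A double eigenvalue
  of a star needs three leaves with equal diagonal entries, so two double eigenvalues need six
  leaves. This is why a vertex with four separated branches is treated by a triple eigenvalue and
  without perturbation.\<close>

definition low :: "nat \<Rightarrow> (nat \<Rightarrow> nat \<Rightarrow> bool) \<Rightarrow> bool" where
  "low n E \<longleftrightarrow> (\<exists>A\<in>S_graph n E. q_mat A + 2 \<le> n)"

lemma not_low:
  assumes "int (q_graph n E) \<ge> int n - 1"
  shows "\<not> low n E"
proof
  assume "low n E"
  then obtain A where A: "A \<in> S_graph n E" "q_mat A + 2 \<le> n"
    unfolding low_def by auto
  have "q_graph n E \<le> q_mat A"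
    unfolding q_graph_def by (rule Least_le) (use A in auto)
  with A assms show False by linarith
qed

section \<open>Orthogonal eigenvectors and the number of distinct eigenvalues\<close>

text \<open>Bessel's inequality for each standard basis vector bounds the normalized squares of the
  \<open>i\<close>-th coordinates by 1. Summed over all \<open>i\<close>, the left side counts the
  family and the right side is \<open>n\<close>.\<close>

lemma orthogonal_card_le:
  fixes w :: "'k \<Rightarrow> nat \<Rightarrow> real"
  assumes fin: "finite K"
    and nz: "\<And>k. k \<in> K \<Longrightarrow> \<exists>i<n. w k i \<noteq> 0"
    and orth: "\<And>k l. k \<in> K \<Longrightarrow> l \<in> K \<Longrightarrow> k \<noteq> l \<Longrightarrow> (\<Sum>i<n. w k i * w l i) = 0"
  shows "card K \<le> n"
proof -
  define d where "d k = (\<Sum>i<n. w k i * w k i)" for k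
  have d: "d k > 0" if k: "k \<in> K" for k
  proof -
    obtain i where "i < n" "w k i \<noteq> 0" using nz[OF k] by blast
    then show ?thesis
      unfolding d_def by (intro sum_pos2[of _ i]) (auto simp: zero_less_mult_iff linorder_neq_iff)
  qed
  have bessel: "(\<Sum>k\<in>K. w k i * w k i / d k) \<le> 1" if i: "i < n" for i
  proof -
    \<comment> \<open>\<open>e\<close> is the standard basis vector at \<open>i\<close> and
      \<open>p\<close> its projection onto the span of the family. Both the inner product of
      \<open>e\<close> and \<open>p\<close> and the squared length of \<open>p\<close> equal
      \<open>S\<close>, so the squared length of \<open>e - p\<close> is
      \<open>1 - S\<close>.\<close>
    define e where "e j = (if j = i then 1 else 0 :: real)" for j
    define p where "p j = (\<Sum>k\<in>K. w k i / d k * w k j)" for j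
    define S where "S = (\<Sum>k\<in>K. w k i * w k i / d k)"
    have e: "(\<Sum>j<n. e j * f j) = f i" for f :: "nat \<Rightarrow> real"
    proof -
      have "(\<Sum>j<n. e j * f j) = (\<Sum>j<n. if j = i then f j else 0)"
        by (intro sum.cong) (auto simp: e_def)
      then show ?thesis using i by simp
    qed
    have 1: "(\<Sum>j<n. e j * e j) = 1" using e[of e] by (simp add: e_def)
    have 2: "(\<Sum>j<n. e j * p j) = S" using e[of p] by (simp add: p_def S_def)
    have "(\<Sum>j<n. p j * p j) = (\<Sum>j<n. \<Sum>k\<in>K. \<Sum>l\<in>K. w k i / d k * (w l i / d l) * (w k j * w l j))"
      unfolding p_def sum_product by (intro sum.cong refl) simp
    also have "\<dots> = (\<Sum>k\<in>K. \<Sum>j<n. \<Sum>l\<in>K. w k i / d k * (w l i / d l) * (w k j * w l j))"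
      by (rule sum.swap)
    also have "\<dots> = (\<Sum>k\<in>K. \<Sum>l\<in>K. w k i / d k * (w l i / d l) * (\<Sum>j<n. w k j * w l j))"
      unfolding sum_distrib_left by (intro sum.cong refl sum.swap)
    also have "\<dots> = (\<Sum>k\<in>K. \<Sum>l\<in>K. if k = l then w k i * w k i / d k else 0)"
      using orth d by (intro sum.cong refl) (auto simp: d_def[symmetric] less_imp_neq[symmetric])
    also have "\<dots> = S" using fin by (simp add: S_def)
    finally have 3: "(\<Sum>j<n. p j * p j) = S" .
    have "0 \<le> (\<Sum>j<n. (e j - p j) * (e j - p j))" by (intro sum_nonneg) auto
    also have "\<dots> = (\<Sum>j<n. e j * e j) - 2 * (\<Sum>j<n. e j * p j) + (\<Sum>j<n. p j * p j)"
      by (simp add: algebra_simps sum.distrib sum_subtractf sum_distrib_left)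
    finally show ?thesis using 1 2 3 by (simp add: S_def)
  qed
  have "real (card K) = (\<Sum>k\<in>K. \<Sum>i<n. w k i * w k i / d k)"
    using d by (simp add: sum_divide_distrib[symmetric] d_def[symmetric] less_imp_neq[symmetric])
  also have "\<dots> = (\<Sum>i<n. \<Sum>k\<in>K. w k i * w k i / d k)" by (rule sum.swap)
  also have "\<dots> \<le> (\<Sum>i<n. 1)" by (intro sum_mono bessel) auto
  finally show ?thesis by simp
qed

lemma eigenvalue_iff:
  fixes A :: "real mat"
  assumes "A \<in> carrier_mat n n"
  shows "eigenvalue A x \<longleftrightarrow>
    (\<exists>v. (\<exists>i<n. v i \<noteq> 0) \<and> (\<forall>i<n. (\<Sum>j<n. A $$ (i,j) * v j) = x * v i))"
proof
  assume "eigenvalue A x"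
  then obtain u where u: "u \<in> carrier_vec n" "u \<noteq> 0\<^sub>v n" "A *\<^sub>v u = x \<cdot>\<^sub>v u"
    using assms by (auto simp: eigenvalue_def eigenvector_def)
  define v where "v i = vec_index u i" for i
  have "\<exists>i<n. v i \<noteq> 0"
  proof (rule ccontr)
    assume "\<not> ?thesis"
    then have "u = 0\<^sub>v n" using u(1) by (intro eq_vecI) (auto simp: v_def)
    with u show False by simp
  qed
  moreover have "(\<Sum>j<n. A $$ (i,j) * v j) = x * v i" if i: "i < n" for i
  proof -
    have "vec_index (A *\<^sub>v u) i = (\<Sum>j<n. A $$ (i,j) * v j)"
      using assms u(1) i by (auto simp: scalar_prod_def v_def lessThan_atLeast0 intro!: sum.cong)
    then show ?thesis using u i by (simp add: v_def)
  qed
  ultimately show "\<exists>v. (\<exists>i<n. v i \<noteq> 0) \<and> (\<forall>i<n. (\<Sum>j<n. A $$ (i,j) * v j) = x * v i)" by blast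
next
  assume "\<exists>v. (\<exists>i<n. v i \<noteq> 0) \<and> (\<forall>i<n. (\<Sum>j<n. A $$ (i,j) * v j) = x * v i)"
  then obtain v k where v: "k < n" "v k \<noteq> 0" "\<And>i. i < n \<Longrightarrow> (\<Sum>j<n. A $$ (i,j) * v j) = x * v i"
    by blast
  define u where "u = Matrix.vec n v"
  have "u \<in> carrier_vec n" by (simp add: u_def)
  moreover have "u \<noteq> 0\<^sub>v n"
  proof
    assume "u = 0\<^sub>v n"
    then have "vec_index u k = vec_index (0\<^sub>v n) k" by simp
    then show False using v by (simp add: u_def)
  qed
  moreover have "A *\<^sub>v u = x \<cdot>\<^sub>v u"
  proof (rule eq_vecI)
    fix i assume "i < dim_vec (x \<cdot>\<^sub>v u)"
    then have i: "i < n" by (simp add: u_def)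
    have "vec_index (A *\<^sub>v u) i = (\<Sum>j<n. A $$ (i,j) * v j)"
      using assms i by (auto simp: scalar_prod_def u_def lessThan_atLeast0 intro!: sum.cong)
    then show "vec_index (A *\<^sub>v u) i = vec_index (x \<cdot>\<^sub>v u) i" using i v(3) by (simp add: u_def)
  qed (use assms in \<open>auto simp: u_def\<close>)
  ultimately show "eigenvalue A x" using assms by (auto simp: eigenvalue_def eigenvector_def)
qed

lemma finite_eigenvalues:
  fixes A :: "real mat"
  assumes A: "A \<in> carrier_mat n n"
  shows "finite {x. eigenvalue A x}"
proof -
  have "char_poly A \<noteq> 0" using degree_monic_char_poly[OF A] by auto
  then show ?thesis using eigenvalue_root_char_poly[OF A] poly_roots_finite by auto
qed

lemma eigenvectors_orthogonal:
  fixes a :: "nat \<Rightarrow> nat \<Rightarrow> real"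
  assumes sym: "\<And>i j. i < n \<Longrightarrow> j < n \<Longrightarrow> a i j = a j i"
    and v: "\<And>i. i < n \<Longrightarrow> (\<Sum>j<n. a i j * v j) = x * v i"
    and w: "\<And>i. i < n \<Longrightarrow> (\<Sum>j<n. a i j * w j) = y * w i"
    and "x \<noteq> y"
  shows "(\<Sum>i<n. v i * w i) = 0"
proof -
  have "x * (\<Sum>i<n. v i * w i) = (\<Sum>i<n. (\<Sum>j<n. a i j * v j) * w i)"
    by (simp add: v sum_distrib_left mult.assoc)
  also have "\<dots> = (\<Sum>i<n. \<Sum>j<n. a i j * v j * w i)" by (simp add: sum_distrib_right)
  also have "\<dots> = (\<Sum>j<n. \<Sum>i<n. a i j * v j * w i)" by (rule sum.swap)
  also have "\<dots> = (\<Sum>j<n. v j * (\<Sum>i<n. a j i * w i))"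
    by (auto simp: sum_distrib_left sym mult_ac intro!: sum.cong)
  also have "\<dots> = y * (\<Sum>i<n. v i * w i)" by (simp add: w sum_distrib_left mult.left_commute)
  finally show ?thesis using \<open>x \<noteq> y\<close> by simp
qed

text \<open>One eigenvector for each eigenvalue outside the image of \<open>\<mu>\<close> can join
  the family without losing orthogonality, so there are at most \<open>n - card K\<close> such
  eigenvalues. Repeated values of \<open>\<mu>\<close> are what lowers \<open>q_mat\<close>.\<close>

lemma q_mat_le:
  fixes A :: "real mat" and w :: "'k \<Rightarrow> nat \<Rightarrow> real"
  assumes A: "A \<in> carrier_mat n n" and tr: "transpose_mat A = A"
    and fin: "finite K"
    and nz: "\<And>k. k \<in> K \<Longrightarrow> \<exists>i<n. w k i \<noteq> 0"
    and ev: "\<And>k i. k \<in> K \<Longrightarrow> i < n \<Longrightarrow> (\<Sum>j<n. A $$ (i,j) * w k j) = \<mu> k * w k i"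
    and orth: "\<And>k l. k \<in> K \<Longrightarrow> l \<in> K \<Longrightarrow> k \<noteq> l \<Longrightarrow> (\<Sum>i<n. w k i * w l i) = 0"
  shows "q_mat A + card K \<le> n + card (\<mu> ` K)"
proof -
  have sym: "A $$ (i,j) = A $$ (j,i)" if "i < n" "j < n" for i j
  proof -
    have "A $$ (i,j) = transpose_mat A $$ (i,j)" by (simp add: tr)
    then show ?thesis using that A by simp
  qed
  define L where "L = {x. eigenvalue A x} - \<mu> ` K"
  have finL: "finite L" using finite_eigenvalues[OF A] by (simp add: L_def)
  have "\<forall>x\<in>L. \<exists>v. (\<exists>i<n. v i \<noteq> 0) \<and> (\<forall>i<n. (\<Sum>j<n. A $$ (i,j) * v j) = x * v i)"
    using eigenvalue_iff[OF A] by (auto simp: L_def)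
  then obtain v where v: "\<And>x. x \<in> L \<Longrightarrow> \<exists>i<n. v x i \<noteq> 0"
    "\<And>x i. x \<in> L \<Longrightarrow> i < n \<Longrightarrow> (\<Sum>j<n. A $$ (i,j) * v x j) = x * v x i"
    by metis
  define u where "u = case_sum v w"
  note os = eigenvectors_orthogonal[where a = "\<lambda>i j. A $$ (i,j)", OF sym]
  have "card (L <+> K) \<le> n"
  proof (rule orthogonal_card_le[where w = u])
    show "finite (L <+> K)" using finL fin by simp
    show "\<exists>i<n. u k i \<noteq> 0" if "k \<in> L <+> K" for k
      using that v(1) nz by (auto simp: u_def)
    show "(\<Sum>i<n. u k i * u l i) = 0" if kl: "k \<in> L <+> K" "l \<in> L <+> K" "k \<noteq> l" for k l
    proof (cases k; cases l)
      fix x y assume "k = Inl x" "l = Inl y"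
      then show ?thesis using kl by (auto simp: u_def intro!: os[where v = "v x" and x = "x" and w = "v y" and y = "y"] v)
    next
      fix x y assume "k = Inl x" "l = Inr y"
      then show ?thesis using kl by (auto simp: u_def L_def intro!: os[where v = "v x" and x = "x" and w = "w y" and y = "\<mu> y"] v ev)
    next
      fix x y assume "k = Inr x" "l = Inl y"
      then show ?thesis using kl by (auto simp: u_def L_def intro!: os[where v = "w x" and x = "\<mu> x" and w = "v y" and y = "y"] v ev)
    next
      fix x y assume "k = Inr x" "l = Inr y"
      then show ?thesis using kl orth by (auto simp: u_def)
    qed
  qed
  then have "card L + card K \<le> n" using finL fin by (simp add: card_Plus)
  moreover have "q_mat A \<le> card L + card (\<mu> ` K)"
    unfolding q_mat_def L_def using finite_eigenvalues[OF A] fin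
    by (metis card_mono card_Un_le finite_Diff finite_UnI finite_imageI le_trans Un_Diff_cancel2 Un_upper1)
  ultimately show ?thesis by linarith
qed

text \<open>Permutation similarity preserves the spectrum. One inclusion of spectra is enough, as
  only an upper bound for \<open>q_mat B\<close> is wanted.\<close>

lemma low_relabel:
  assumes f: "bij_betw f {..<n} {..<n}"
    and low: "low n (\<lambda>i j. E (f i) (f j))"
  shows "low n E"
proof -
  obtain A where A: "A \<in> carrier_mat n n" "transpose_mat A = A"
    "\<And>i j. i < n \<Longrightarrow> j < n \<Longrightarrow> i \<noteq> j \<Longrightarrow> A $$ (i,j) \<noteq> 0 \<longleftrightarrow> E (f i) (f j)"
    and q: "q_mat A + 2 \<le> n"
    using low by (auto simp: low_def S_graph_def)
  define g where "g = inv_into {..<n} f"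
  have gb: "bij_betw g {..<n} {..<n}" unfolding g_def by (rule bij_betw_inv_into[OF f])
  have g: "g i < n" "f (g i) = i" if "i < n" for i
    using that gb f by (auto simp: g_def bij_betw_def f_inv_into_f intro: inv_into_into)
  have fl: "f i < n" "g (f i) = i" if "i < n" for i
    using that f by (auto simp: g_def bij_betw_def)
  define B where "B = Matrix.mat n n (\<lambda>(i,j). A $$ (g i, g j))"
  have B: "B \<in> carrier_mat n n" by (simp add: B_def)
  have At: "A $$ (i,j) = A $$ (j,i)" if "i < n" "j < n" for i j
  proof -
    have "A $$ (i,j) = transpose_mat A $$ (i,j)" by (simp add: A)
    then show ?thesis using that A(1) by simp
  qed
  have "transpose_mat B = B"
    by (rule eq_matI) (auto simp: B_def g At)
  moreover have "B $$ (i,j) \<noteq> 0 \<longleftrightarrow> E i j" if "i < n" "j < n" "i \<noteq> j" for i j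
    using that A(3)[of "g i" "g j"] g by (simp add: B_def) metis
  ultimately have BS: "B \<in> S_graph n E" using B by (auto simp: S_graph_def)
  have "eigenvalue A x" if x: "eigenvalue B x" for x
  proof -
    obtain v k where v: "k < n" "v k \<noteq> 0" "\<And>i. i < n \<Longrightarrow> (\<Sum>j<n. B $$ (i,j) * v j) = x * v i"
      using x unfolding eigenvalue_iff[OF B] by blast
    have "(\<Sum>j<n. A $$ (i,j) * v (f j)) = x * v (f i)" if i: "i < n" for i
    proof -
      have "(\<Sum>j<n. A $$ (i,j) * v (f j)) = (\<Sum>j<n. B $$ (f i, f j) * v (f j))"
        using i by (auto simp: B_def fl intro!: sum.cong)
      also have "\<dots> = (\<Sum>j<n. B $$ (f i, j) * v j)"
        using sum.reindex_bij_betw[OF f] .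
      finally show ?thesis using v fl i by simp
    qed
    moreover have "v (f (g k)) \<noteq> 0" "g k < n" using v g by auto
    ultimately show ?thesis unfolding eigenvalue_iff[OF A(1)]
      by (intro exI[of _ "\<lambda>i. v (f i)"]) blast
  qed
  then have "q_mat B \<le> q_mat A"
    unfolding q_mat_def by (intro card_mono finite_eigenvalues[OF A(1)]) auto
  with q BS show ?thesis unfolding low_def by (intro bexI[of _ B]) auto
qed

lemma gram_schmidt_pair:
  fixes u v :: "nat \<Rightarrow> real"
  assumes indep: "\<And>s t. (\<And>i. i < n \<Longrightarrow> s * u i + t * v i = 0) \<Longrightarrow> s = 0 \<and> t = 0"
  obtains s t where "\<exists>i<n. s * u i + t * v i \<noteq> 0" "(\<Sum>i<n. u i * (s * u i + t * v i)) = 0"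
    "\<exists>i<n. u i \<noteq> 0"
proof -
  have u: "\<exists>i<n. u i \<noteq> 0" using indep[of 1 0] by auto
  then have "(\<Sum>i<n. u i * u i) \<noteq> 0" by (subst sum_nonneg_eq_0_iff) auto
  \<comment> \<open>Gram-Schmidt without division: the coefficients are minus the inner product of
    \<open>u\<close> and \<open>v\<close>, and the squared length of \<open>u\<close>. The second is
    nonzero, so independence makes the combination nonzero.\<close>
  then have 1: "\<exists>i<n. - (\<Sum>i<n. u i * v i) * u i + (\<Sum>i<n. u i * u i) * v i \<noteq> 0"
    using indep[of "- (\<Sum>i<n. u i * v i)" "\<Sum>i<n. u i * u i"] by auto
  define a b where "a = (\<Sum>i<n. u i * u i)" and "b = (\<Sum>i<n. u i * v i)"
  have "(\<Sum>i<n. u i * (- b * u i + a * v i)) = (\<Sum>i<n. - b * (u i * u i) + a * (u i * v i))"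
    by (intro sum.cong) (auto simp: algebra_simps)
  also have "\<dots> = - b * a + a * b"
    unfolding sum.distrib sum_distrib_left[symmetric] a_def b_def ..
  finally have 2: "(\<Sum>i<n. u i * (- b * u i + a * v i)) = 0" by simp
  show ?thesis using that[of "-b" a] 1 2 u by (auto simp: a_def b_def)
qed

text \<open>Four orthogonal eigenvectors share two eigenvalues, which leaves at most
  \<open>n - 4 + 2\<close> distinct ones. Within each eigenspace only independence is asked for,
  since orthogonality is arranged here.\<close>

lemma q_mat_le_of_pairs:
  fixes a :: "nat \<Rightarrow> nat \<Rightarrow> real"
  assumes sym: "\<And>i j. i < n \<Longrightarrow> j < n \<Longrightarrow> a i j = a j i"
    and u: "\<And>i. i < n \<Longrightarrow> (\<Sum>j<n. a i j * u j) = x * u i"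
    and u': "\<And>i. i < n \<Longrightarrow> (\<Sum>j<n. a i j * u' j) = x * u' i"
    and v: "\<And>i. i < n \<Longrightarrow> (\<Sum>j<n. a i j * v j) = y * v i"
    and v': "\<And>i. i < n \<Longrightarrow> (\<Sum>j<n. a i j * v' j) = y * v' i"
    and "x \<noteq> y"
    and iu: "\<And>s t. (\<And>i. i < n \<Longrightarrow> s * u i + t * u' i = 0) \<Longrightarrow> s = 0 \<and> t = 0"
    and iv: "\<And>s t. (\<And>i. i < n \<Longrightarrow> s * v i + t * v' i = 0) \<Longrightarrow> s = 0 \<and> t = 0"
  shows "q_mat (Matrix.mat n n (\<lambda>(i,j). a i j)) + 2 \<le> n"
proof -
  obtain s t where st: "\<exists>i<n. s * u i + t * u' i \<noteq> 0" "(\<Sum>i<n. u i * (s * u i + t * u' i)) = 0"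
    "\<exists>i<n. u i \<noteq> 0" by (rule gram_schmidt_pair[of n u u', OF iu])
  obtain s' t' where st': "\<exists>i<n. s' * v i + t' * v' i \<noteq> 0"
    "(\<Sum>i<n. v i * (s' * v i + t' * v' i)) = 0"
    "\<exists>i<n. v i \<noteq> 0" by (rule gram_schmidt_pair[of n v v', OF iv])
  define w where "w k = [u, \<lambda>i. s * u i + t * u' i, v, \<lambda>i. s' * v i + t' * v' i] ! k" for k :: nat
  define \<mu> where "\<mu> k = (if k < 2 then x else y)" for k :: nat
  have w: "w 0 = u" "w (Suc 0) = (\<lambda>i. s * u i + t * u' i)" "w 2 = v" "w 3 = (\<lambda>i. s' * v i + t' * v' i)"
    by (simp_all add: w_def)
  have k4: "k = 0 \<or> k = 1 \<or> k = 2 \<or> k = 3" if "k < 4" for k :: nat using that by linarith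
  let ?A = "Matrix.mat n n (\<lambda>(i,j). a i j)"
  have ev: "(\<Sum>j<n. a i j * w k j) = \<mu> k * w k i" if "k < 4" "i < n" for k i
  proof -
    have "(\<Sum>j<n. a i j * (c * p j + d * p' j)) = z * (c * p i + d * p' i)"
      if "(\<Sum>j<n. a i j * p j) = z * p i" "(\<Sum>j<n. a i j * p' j) = z * p' i" for p p' c d z
    proof -
      have "(\<Sum>j<n. a i j * (c * p j + d * p' j)) = c * (\<Sum>j<n. a i j * p j) + d * (\<Sum>j<n. a i j * p' j)"
        by (simp add: sum_distrib_left sum.distrib[symmetric] algebra_simps)
      then show ?thesis using that by (simp add: algebra_simps)
    qed
    then show ?thesis
      using k4[OF \<open>k < 4\<close>] u[OF \<open>i < n\<close>] u'[OF \<open>i < n\<close>] v[OF \<open>i < n\<close>] v'[OF \<open>i < n\<close>]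
      by (auto simp: w \<mu>_def)
  qed
  have "q_mat ?A + card {..<4::nat} \<le> n + card (\<mu> ` {..<4})"
  proof (rule q_mat_le[where w = w])
    show "transpose_mat ?A = ?A" by (rule eq_matI) (auto simp: sym)
    show "\<exists>i<n. w k i \<noteq> 0" if "k \<in> {..<4}" for k
      using k4[of k] that st st' by (auto simp: w)
    show "(\<Sum>j<n. ?A $$ (i,j) * w k j) = \<mu> k * w k i" if "k \<in> {..<4}" "i < n" for k i
      using ev[of k i] that by simp
    show "(\<Sum>i<n. w k i * w l i) = 0" if kl: "k \<in> {..<4}" "l \<in> {..<4}" "k \<noteq> l" for k l
    proof (cases "\<mu> k = \<mu> l")
      case True
      then have "k < 2 \<and> l < 2 \<or> \<not> k < 2 \<and> \<not> l < 2" using \<open>x \<noteq> y\<close> by (auto simp: \<mu>_def split: if_splits)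
      then have "k = 0 \<and> l = 1 \<or> k = 1 \<and> l = 0 \<or> k = 2 \<and> l = 3 \<or> k = 3 \<and> l = 2"
        using kl by auto
      moreover have "(\<Sum>i<n. w 1 i * w 0 i) = 0" "(\<Sum>i<n. w 3 i * w 2 i) = 0"
        using st(2) st'(2) by (simp_all add: w mult.commute)
      ultimately show ?thesis using st(2) st'(2) by (auto simp: w)
    next
      case False
      then show ?thesis
        using eigenvectors_orthogonal[OF sym ev ev, of k l] kl by auto
    qed
  qed auto
  moreover have "card (\<mu> ` {..<4}) \<le> card {x, y}"
    by (intro card_mono) (auto simp: \<mu>_def)
  ultimately show ?thesis using \<open>x \<noteq> y\<close> by simp
qed

text \<open>The same count with a triple eigenvalue: at most \<open>n - 3 + 1\<close> distinct
  ones.\<close>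

lemma q_mat_le_of_triple:
  fixes a w :: "nat \<Rightarrow> nat \<Rightarrow> real"
  assumes sym: "\<And>i j. i < n \<Longrightarrow> j < n \<Longrightarrow> a i j = a j i"
    and ev: "\<And>k i. k < 3 \<Longrightarrow> i < n \<Longrightarrow> (\<Sum>j<n. a i j * w k j) = x * w k i"
    and nz: "\<And>k. k < 3 \<Longrightarrow> \<exists>i<n. w k i \<noteq> 0"
    and orth: "\<And>k l. k < l \<Longrightarrow> l < 3 \<Longrightarrow> (\<Sum>i<n. w k i * w l i) = 0"
  shows "q_mat (Matrix.mat n n (\<lambda>(i,j). a i j)) + 2 \<le> n"
proof -
  let ?A = "Matrix.mat n n (\<lambda>(i,j). a i j)"
  have "q_mat ?A + card {..<3::nat} \<le> n + card ((\<lambda>_. x) ` {..<3::nat})"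
  proof (rule q_mat_le[where w = w and \<mu> = "\<lambda>_. x"])
    show "transpose_mat ?A = ?A" by (rule eq_matI) (auto simp: sym)
    show "(\<Sum>j<n. ?A $$ (i,j) * w k j) = x * w k i" if "k \<in> {..<3}" "i < n" for k i
      using ev[of k i] that by simp
    show "(\<Sum>i<n. w k i * w l i) = 0" if kl: "k \<in> {..<3}" "l \<in> {..<3}" "k \<noteq> l" for k l
    proof (cases "k < l")
      case True
      then show ?thesis using orth kl by auto
    next
      case False
      then have "(\<Sum>i<n. w l i * w k i) = 0" using orth[of l k] kl by auto
      then show ?thesis by (simp add: mult.commute)
    qed
  qed (use nz in auto)
  moreover have "(\<lambda>_. x) ` {..<3::nat} = {x}" by (rule image_constant[of 0]) simp
  ultimately show ?thesis by simp
qed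

lemma mat_in_S_graph:
  assumes "\<And>i j. i < n \<Longrightarrow> j < n \<Longrightarrow> a i j = a j i"
    and "\<And>i j. i < n \<Longrightarrow> j < n \<Longrightarrow> i \<noteq> j \<Longrightarrow> a i j \<noteq> 0 \<longleftrightarrow> E i j"
  shows "Matrix.mat n n (\<lambda>(i,j). a i j) \<in> S_graph n E"
  using assms by (auto simp: S_graph_def intro!: eq_matI)

section \<open>Persistence of a two-dimensional kernel\<close>

lemma continuous_on_det:
  fixes K :: "'x::topological_space \<Rightarrow> real mat"
  assumes K: "\<And>x. K x \<in> carrier_mat m m"
    and c: "\<And>i j. i < m \<Longrightarrow> j < m \<Longrightarrow> continuous_on S (\<lambda>x. K x $$ (i,j))"
  shows "continuous_on S (\<lambda>x. Determinant.det (K x))"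
proof -
  have "continuous_on S (\<lambda>x. \<Sum>p | p permutes {0..<m}. signof p * (\<Prod>i = 0..<m. K x $$ (i, p i)))"
    by (intro continuous_intros c) (auto simp: permutes_in_image)
  then show ?thesis by (simp add: Determinant.det_def'[OF K])
qed

lemma continuous_on_adj_mat:
  fixes K :: "'x::topological_space \<Rightarrow> real mat"
  assumes K: "\<And>x. K x \<in> carrier_mat m m"
    and c: "\<And>i j. i < m \<Longrightarrow> j < m \<Longrightarrow> continuous_on S (\<lambda>x. K x $$ (i,j))"
    and ij: "i < m" "j < m"
  shows "continuous_on S (\<lambda>x. adj_mat (K x) $$ (i,j))"
proof -
  have "continuous_on S (\<lambda>x. Determinant.det (mat_delete (K x) j i))"
  proof (rule continuous_on_det)
    show "mat_delete (K x) j i \<in> carrier_mat (m - 1) (m - 1)" for x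
      by (rule mat_delete_carrier[OF K])
    show "continuous_on S (\<lambda>x. mat_delete (K x) j i $$ (k, l))" if "k < m - 1" "l < m - 1" for k l
    proof -
      have dim: "dim_row (K x) = m" "dim_col (K x) = m" for x using K[of x] by auto
      show ?thesis using that ij unfolding mat_delete_def dim by (auto intro!: c)
    qed
  qed
  then have "continuous_on S (\<lambda>x. (-1)^(j+i) * Determinant.det (mat_delete (K x) j i))"
    by (intro continuous_intros)
  moreover have "adj_mat (K x) $$ (i,j) = (-1)^(j+i) * Determinant.det (mat_delete (K x) j i)" for x
    using ij K[of x] by (auto simp: adj_mat_def cofactor_def)
  ultimately show ?thesis by simp
qed

text \<open>A kernel basis in reduced echelon form: \<open>z 0\<close>, \<open>z 1\<close> restrict
  to the identity at the pivots, and the last clause, by which a null vector is determined at the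
  pivots, makes the dimension exactly two. Perturbed null vectors will keep their values at the
  pivots.\<close>

definition pivoted_kernel :: "nat \<Rightarrow> (nat \<Rightarrow> nat \<Rightarrow> real) \<Rightarrow> (nat \<Rightarrow> nat \<Rightarrow> real) \<Rightarrow> (nat \<Rightarrow> nat) \<Rightarrow> bool" where
  "pivoted_kernel n N z p \<longleftrightarrow>
     (\<forall>k<2. \<forall>i<n. (\<Sum>j<n. N i j * z k j) = 0) \<and>
     (\<forall>k<2. p k < n \<and> (\<forall>l<2. z k (p l) = (if k = l then 1 else 0))) \<and>
     (\<forall>v. (\<forall>i<n. (\<Sum>j<n. N i j * v j) = 0) \<longrightarrow> v (p 0) = 0 \<longrightarrow> v (p 1) = 0 \<longrightarrow> (\<forall>i<n. v i = 0))"

text \<open>Replacing the pivot rows of a singular matrix by unit rows gives an invertible one. For a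
  nearby matrix, Cramer's rule applied to the modified matrix yields vectors that satisfy all
  equations of the kernel except those in the pivot rows, where the defect is a Schur complement.\<close>

lemma kernel_continuation:
  fixes M :: "'x::t2_space \<Rightarrow> nat \<Rightarrow> nat \<Rightarrow> real"
  assumes cont: "\<And>i j. i < n \<Longrightarrow> j < n \<Longrightarrow> continuous_on UNIV (\<lambda>x. M x i j)"
    and sym: "\<And>x i j. i < n \<Longrightarrow> j < n \<Longrightarrow> M x i j = M x j i"
    and ker: "pivoted_kernel n (M c) z p"
  obtains U \<zeta> where "open U" "c \<in> U"
    "\<And>k i. k < 2 \<Longrightarrow> i < n \<Longrightarrow> continuous_on U (\<lambda>x. \<zeta> k x i)"
    "\<And>k i. k < 2 \<Longrightarrow> i < n \<Longrightarrow> \<zeta> k c i = z k i"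
    "\<And>k l x. k < 2 \<Longrightarrow> l < 2 \<Longrightarrow> x \<in> U \<Longrightarrow> \<zeta> k x (p l) = (if k = l then 1 else 0)"
    "\<And>x k i. \<lbrakk>x \<in> U; k < 2; i < n; \<forall>k l. k \<le> l \<and> l < 2 \<longrightarrow>
       (\<Sum>i<n. \<Sum>j<n. z k i * (M x i j - M c i j) * \<zeta> l x j) = 0\<rbrakk> \<Longrightarrow> (\<Sum>j<n. M x i j * \<zeta> k x j) = 0"
proof -
  have kz: "(\<Sum>j<n. M c i j * z k j) = 0" if "k < 2" "i < n" for k i
    using ker that by (auto simp: pivoted_kernel_def)
  have p: "p k < n" "\<And>l. l < 2 \<Longrightarrow> z k (p l) = (if k = l then 1 else 0)" if "k < 2" for k
    using ker that by (auto simp: pivoted_kernel_def)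
  have inj: "v i = 0" if "\<And>i. i < n \<Longrightarrow> (\<Sum>j<n. M c i j * v j) = 0" "v (p 0) = 0" "v (p 1) = 0" "i < n" for v i
    using ker that by (auto simp: pivoted_kernel_def)
  have p01: "p 0 \<noteq> p 1" using p(2)[of 0 0] p(2)[of 0 1] by auto
  have k2: "k = 0 \<or> k = 1" if "k < 2" for k :: nat using that by linarith
  have p_eq: "p k = p l \<longleftrightarrow> k = l" if "k < 2" "l < 2" for k l
    using k2[OF that(1)] k2[OF that(2)] p01 by auto
  \<comment> \<open>With unit rows at the pivots, the solution for the unit vector at
    \<open>p l\<close> as right-hand side has the prescribed pivot values; it is the candidate
    \<open>\<zeta> l x\<close> for the perturbed null vector.\<close>
  define k where "k x i j = (if i \<in> {p 0, p 1} then (if i = j then 1 else 0) else M x i j)" for x i j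
  define K where "K x = Matrix.mat n n (\<lambda>(i,j). k x i j)" for x
  have K: "K x \<in> carrier_mat n n" for x by (simp add: K_def)
  have kc: "continuous_on UNIV (\<lambda>x. K x $$ (i,j))" if "i < n" "j < n" for i j
    using that cont by (cases "i \<in> {p 0, p 1}") (auto simp: K_def k_def)
  define U where "U = {x. Determinant.det (K x) \<noteq> 0}"
  define \<zeta> where "\<zeta> l x j = adj_mat (K x) $$ (j, p l) / Determinant.det (K x)" for l x j
  have oU: "open U" unfolding U_def
    by (intro open_Collect_neq continuous_on_const continuous_on_det[OF K kc])
  have piv_row: "(\<Sum>j<n. k x (p l) j * v j) = v (p l)" if "l < 2" for x l v
  proof -
    have "(\<Sum>j<n. k x (p l) j * v j) = (\<Sum>j<n. if p l = j then v j else 0)"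
      using k2[OF that] by (intro sum.cong) (auto simp: k_def)
    then show ?thesis using p(1)[OF that] by simp
  qed
  have kinj: "v i = 0" if v: "\<And>i. i < n \<Longrightarrow> (\<Sum>j<n. k c i j * v j) = 0" and i: "i < n" for v i
  proof -
    have vp: "v (p l) = 0" if "l < 2" for l using v[OF p(1)[OF that]] piv_row[OF that] by simp
    have np: "(\<Sum>j<n. M c i j * v j) = 0" if "i < n" "i \<notin> {p 0, p 1}" for i
      using v[of i] that by (simp add: k_def)
    \<comment> \<open>The replaced rows are recovered from symmetry. \<open>z l\<close> is also a
      left null vector of \<open>M c\<close>; it vanishes at the other pivot, and the non-pivot rows
      of \<open>M c\<close> annihilate \<open>v\<close>, so only row \<open>p l\<close> is left and
      must annihilate \<open>v\<close> too.\<close>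
    have pp: "(\<Sum>j<n. M c (p l) j * v j) = 0" if l: "l < 2" for l
    proof -
      have "0 = (\<Sum>j<n. (\<Sum>i<n. M c j i * z l i) * v j)" using kz[OF l] by simp
      also have "\<dots> = (\<Sum>j<n. \<Sum>i<n. z l i * (M c i j * v j))"
        by (auto simp: sum_distrib_right sum_distrib_left sym mult_ac intro!: sum.cong)
      also have "\<dots> = (\<Sum>i<n. z l i * (\<Sum>j<n. M c i j * v j))"
        by (subst sum.swap) (simp add: sum_distrib_left)
      also have "\<dots> = (\<Sum>i<n. if i = p l then (\<Sum>j<n. M c i j * v j) else 0)"
      proof (intro sum.cong refl)
        fix i assume "i \<in> {..<n}"
        then show "z l i * (\<Sum>j<n. M c i j * v j) = (if i = p l then (\<Sum>j<n. M c i j * v j) else 0)"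
          using np[of i] p(2)[OF l, of 0] p(2)[OF l, of 1] k2[OF l]
          by (cases "i = p 0"; cases "i = p 1") auto
      qed
      also have "\<dots> = (\<Sum>j<n. M c (p l) j * v j)" using p(1)[OF l] by simp
      finally show ?thesis by simp
    qed
    show ?thesis using inj[of v i] np pp[of 0] pp[of 1] vp[of 0] vp[of 1] i by auto
  qed
  have cU: "c \<in> U"
  proof (rule ccontr)
    assume "c \<notin> U"
    then have "Determinant.det (K c) = 0" by (simp add: U_def)
    then obtain v where v: "v \<in> carrier_vec n" "v \<noteq> 0\<^sub>v n" "K c *\<^sub>v v = 0\<^sub>v n"
      using det_0_iff_vec_prod_zero_field[OF K] by blast
    have "(\<Sum>j<n. k c i j * vec_index v j) = 0" if "i < n" for i
    proof -
      have "vec_index (K c *\<^sub>v v) i = (\<Sum>j<n. k c i j * vec_index v j)"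
        using that v(1) by (auto simp: K_def scalar_prod_def lessThan_atLeast0 intro!: sum.cong)
      then show ?thesis using v that by simp
    qed
    then have "vec_index v i = 0" if "i < n" for i using kinj[of "vec_index v"] that by blast
    then have "v = 0\<^sub>v n" using v(1) by (intro eq_vecI) auto
    with v show False by simp
  qed
  have \<zeta>: "(\<Sum>j<n. k x i j * \<zeta> l x j) = (if i = p l then 1 else 0)" if "x \<in> U" "l < 2" "i < n" for x l i
  proof -
    have "(\<Sum>j<n. k x i j * adj_mat (K x) $$ (j, p l)) = (K x * adj_mat (K x)) $$ (i, p l)"
      using that p(1)[OF that(2)] adj_mat(1)[OF K[of x]]
      by (auto simp: K_def scalar_prod_def lessThan_atLeast0 intro!: sum.cong)
    also have "\<dots> = (if i = p l then Determinant.det (K x) else 0)"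
      using that p(1)[OF that(2)] by (simp add: adj_mat(2)[OF K])
    finally show ?thesis using that(1) by (simp add: \<zeta>_def sum_divide_distrib[symmetric] U_def)
  qed
  have \<zeta>p: "\<zeta> l x (p m) = (if l = m then 1 else 0)" if "x \<in> U" "l < 2" "m < 2" for x l m
    using \<zeta>[OF that(1,2) p(1)[OF that(3)]] piv_row[OF that(3)] p_eq that by auto
  have \<zeta>n: "(\<Sum>j<n. M x i j * \<zeta> l x j) = 0" if "x \<in> U" "l < 2" "i < n" "i \<notin> {p 0, p 1}" for x l i
    using \<zeta>[OF that(1-3)] k2[OF that(2)] that(4) by (auto simp: k_def)
  have \<zeta>0: "\<zeta> l c i = z l i" if "l < 2" "i < n" for l i
  proof -
    have "(\<Sum>j<n. k c i j * (\<zeta> l c j - z l j)) = 0" if i: "i < n" for i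
    proof -
      have "(\<Sum>j<n. k c i j * z l j) = (if i = p l then 1 else 0)"
      proof (cases "i \<in> {p 0, p 1}")
        case True
        then obtain m where "m < 2" "i = p m" by (metis insertE empty_iff one_less_numeral_iff pos2 semiring_norm(76))
        then show ?thesis using piv_row[of m c "z l"] p(2)[OF \<open>l < 2\<close>, of m] p_eq[of m l] \<open>l < 2\<close> by auto
      next
        case False
        then show ?thesis using kz[OF \<open>l < 2\<close> i] k2[OF \<open>l < 2\<close>] by (auto simp: k_def)
      qed
      then show ?thesis using \<zeta>[OF cU \<open>l < 2\<close> i] by (simp add: algebra_simps sum_subtractf)
    qed
    then have "\<zeta> l c i - z l i = 0" using kinj[of "\<lambda>j. \<zeta> l c j - z l j"] that by blast
    then show ?thesis by simp
  qed
  have \<zeta>c: "continuous_on U (\<lambda>x. \<zeta> l x i)" if "l < 2" "i < n" for l i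
    unfolding \<zeta>_def
    by (intro continuous_on_divide continuous_on_adj_mat[where m = n] continuous_on_det[where m = n]
        continuous_on_subset[OF kc] K) (use that p in \<open>auto simp: U_def\<close>)
  have expand: "(\<Sum>i<n. v i * (\<Sum>j<n. M x i j * \<zeta> l x j)) = v (p 0) * (\<Sum>j<n. M x (p 0) j * \<zeta> l x j)
      + v (p 1) * (\<Sum>j<n. M x (p 1) j * \<zeta> l x j)" if "x \<in> U" "l < 2" for v x l
  proof -
    have "(\<Sum>i<n. v i * (\<Sum>j<n. M x i j * \<zeta> l x j)) = (\<Sum>i\<in>{p 0, p 1}. v i * (\<Sum>j<n. M x i j * \<zeta> l x j))"
      using \<zeta>n[OF that] p(1)[of 0] p(1)[of 1] by (intro sum.mono_neutral_right) auto
    then show ?thesis using p01 by simp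
  qed
  \<comment> \<open>Subtracting \<open>M c\<close> changes nothing because \<open>z k\<close> is a
    left null vector of it. Applying \<open>M x\<close> to \<open>\<zeta> l x\<close> leaves only
    the two pivot rows, from which \<open>z k\<close> selects row \<open>p k\<close>.\<close>
  have schur: "(\<Sum>i<n. \<Sum>j<n. z k i * (M x i j - M c i j) * \<zeta> l x j) = (\<Sum>j<n. M x (p k) j * \<zeta> l x j)"
    if "x \<in> U" "k < 2" "l < 2" for x k l
  proof -
    have "(\<Sum>i<n. \<Sum>j<n. z k i * (M x i j - M c i j) * \<zeta> l x j) =
      (\<Sum>i<n. z k i * (\<Sum>j<n. M x i j * \<zeta> l x j)) - (\<Sum>i<n. \<Sum>j<n. z k i * M c i j * \<zeta> l x j)"
      by (simp add: sum_distrib_left algebra_simps sum_subtractf)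
    also have "(\<Sum>i<n. \<Sum>j<n. z k i * M c i j * \<zeta> l x j) = (\<Sum>j<n. (\<Sum>i<n. M c j i * z k i) * \<zeta> l x j)"
      by (subst sum.swap) (auto simp: sum_distrib_right sum_distrib_left sym mult_ac intro!: sum.cong)
    also have "\<dots> = 0" using kz[OF that(2)] by simp
    also have "(\<Sum>i<n. z k i * (\<Sum>j<n. M x i j * \<zeta> l x j)) = (\<Sum>j<n. M x (p k) j * \<zeta> l x j)"
      using expand[OF that(1,3), of "z k"] p(2)[OF that(2)] k2[OF that(2)] by auto
    finally show ?thesis by simp
  qed
  \<comment> \<open>The 2 by 2 matrix of defects is symmetric, so three equations, those with
    \<open>k \<le> l\<close>, suffice. This is what makes the later count of equations and
    parameters agree.\<close>
  have symm: "(\<Sum>j<n. M x (p k) j * \<zeta> l x j) = (\<Sum>j<n. M x (p l) j * \<zeta> k x j)"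
    if "x \<in> U" "k < 2" "l < 2" for x k l
  proof -
    have "(\<Sum>j<n. M x (p k) j * \<zeta> l x j) = (\<Sum>i<n. \<zeta> k x i * (\<Sum>j<n. M x i j * \<zeta> l x j))"
      using expand[OF that(1,3), of "\<zeta> k x"] \<zeta>p[OF that(1,2)] k2[OF that(2)] by auto
    also have "\<dots> = (\<Sum>i<n. \<Sum>j<n. \<zeta> k x i * M x i j * \<zeta> l x j)"
      by (simp add: sum_distrib_left mult.assoc)
    also have "\<dots> = (\<Sum>j<n. \<zeta> l x j * (\<Sum>i<n. M x j i * \<zeta> k x i))"
      by (subst sum.swap) (auto simp: sum_distrib_left sym mult_ac intro!: sum.cong)
    also have "\<dots> = (\<Sum>j<n. M x (p l) j * \<zeta> k x j)"
      using expand[OF that(1,2), of "\<zeta> l x"] \<zeta>p[OF that(1,3)] k2[OF that(3)] by auto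
    finally show ?thesis .
  qed
  show ?thesis
  proof (rule that[OF oU cU \<zeta>c \<zeta>0 \<zeta>p])
    fix x and k i :: nat
    assume x: "x \<in> U" "k < 2" "i < n" and s: "\<forall>k l. k \<le> l \<and> l < 2 \<longrightarrow>
       (\<Sum>i<n. \<Sum>j<n. z k i * (M x i j - M c i j) * \<zeta> l x j) = 0"
    have "(\<Sum>j<n. M x (p l) j * \<zeta> k x j) = 0" if l: "l < 2" for l
    proof (cases "l \<le> k")
      case True then show ?thesis using s True x(2) schur[OF x(1) l x(2)] by simp
    next
      case False then show ?thesis using s l schur[OF x(1,2) l] symm[OF x(1) l x(2)] by simp
    qed
    then have "(\<Sum>j<n. M x i j * \<zeta> k x j) = 0" if "i \<in> {p 0, p 1}" using that by auto
    then show "(\<Sum>j<n. M x i j * \<zeta> k x j) = 0" using \<zeta>n[OF x] by auto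
  qed
qed

section \<open>Perturbation of a pencil with two double eigenvalues\<close>

text \<open>The perturbed null vectors are only known to be continuous. The linear factor makes up
  for this: \<open>L x * (g x - g 0)\<close> is of smaller order than \<open>norm x\<close>.\<close>

lemma has_derivative_mult_linear_at_0:
  fixes L :: "'x::real_normed_vector \<Rightarrow> real"
  assumes L: "bounded_linear L" and g: "isCont g (0::'x)"
  shows "((\<lambda>x. L x * g x) has_derivative (\<lambda>x. L x * g 0)) (at 0)"
proof -
  have L0: "L 0 = 0" using L by (rule linear_simps)
  obtain B where B: "\<And>x. \<bar>L x\<bar> \<le> norm x * B" using bounded_linear.bounded[OF L] by auto
  have lim: "((\<lambda>x. \<bar>B\<bar> * \<bar>g x - g 0\<bar>) \<longlongrightarrow> 0) (at 0)"
    using g unfolding isCont_def by (auto intro!: tendsto_eq_intros)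
  have "((\<lambda>y. (L y * g y - L y * g 0) /\<^sub>R norm y) \<longlongrightarrow> 0) (at 0)"
  proof (rule Lim_null_comparison[OF _ lim], rule always_eventually, rule allI)
    fix y :: 'x
    show "norm ((L y * g y - L y * g 0) /\<^sub>R norm y) \<le> \<bar>B\<bar> * \<bar>g y - g 0\<bar>"
    proof (cases "y = 0")
      case False
      have "\<bar>L y\<bar> \<le> norm y * \<bar>B\<bar>"
        using B[of y] mult_left_mono[OF abs_ge_self[of B] norm_ge_zero[of y]] by linarith
      then have "\<bar>L y\<bar> * \<bar>g y - g 0\<bar> \<le> norm y * \<bar>B\<bar> * \<bar>g y - g 0\<bar>"
        by (intro mult_right_mono) auto
      then have "\<bar>L y * (g y - g 0)\<bar> / norm y \<le> \<bar>B\<bar> * \<bar>g y - g 0\<bar>"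
        using False by (simp add: abs_mult divide_le_eq mult_ac)
      moreover have "norm ((L y * g y - L y * g 0) /\<^sub>R norm y) = \<bar>L y * (g y - g 0)\<bar> / norm y"
        unfolding right_diff_distrib[symmetric] norm_scaleR by (simp add: divide_inverse mult.commute)
      ultimately show ?thesis by simp
    qed (simp add: L0)
  qed
  then show ?thesis
    using bounded_linear_mult_const[OF L] by (simp add: has_derivative_at_within L0)
qed

text \<open>The triple s lists the entries (1,1), (1,2), (2,2) of a symmetric matrix S, and the value is the
  entry of the symmetric matrix Z S Z^T, where Z has the columns z 0 and z 1.\<close>

definition quad_form :: "(nat \<Rightarrow> nat \<Rightarrow> real) \<Rightarrow> real \<times> real \<times> real \<Rightarrow> nat \<Rightarrow> nat \<Rightarrow> real" where
  "quad_form z s i j = fst s * z 0 i * z 0 j + fst (snd s) * (z 0 i * z 1 j + z 1 i * z 0 j)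
     + snd (snd s) * z 1 i * z 1 j"

text \<open>Pairing \<open>P\<close> with Z S Z^T amounts to pairing Z^T P Z with S. Hence a
  \<open>P\<close> whose bilinear form vanishes on \<open>z 0\<close>, \<open>z 1\<close> is
  orthogonal to every \<open>quad_form z s\<close>.\<close>

lemma quad_form_sum:
  "(\<Sum>i<n. \<Sum>j<n. P i j * quad_form z s i j) =
     fst s * (\<Sum>i<n. \<Sum>j<n. z 0 i * P i j * z 0 j) + fst (snd s) * ((\<Sum>i<n. \<Sum>j<n. z 0 i * P i j * z 1 j)
     + (\<Sum>i<n. \<Sum>j<n. z 1 i * P i j * z 0 j)) + snd (snd s) * (\<Sum>i<n. \<Sum>j<n. z 1 i * P i j * z 1 j)"
proof -
  have "P i j * quad_form z s i j = fst s * (z 0 i * P i j * z 0 j) + (fst (snd s) * (z 0 i * P i j * z 1 j)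
     + fst (snd s) * (z 1 i * P i j * z 0 j)) + snd (snd s) * (z 1 i * P i j * z 1 j)" for i j
    by (simp add: quad_form_def algebra_simps)
  then show ?thesis
    by (simp only: sum.distrib sum_distrib_left[symmetric] distrib_left)
qed

lemma bilinear_sum_swap:
  fixes P :: "nat \<Rightarrow> nat \<Rightarrow> real"
  assumes "\<And>i j. i < n \<Longrightarrow> j < n \<Longrightarrow> P i j = P j i"
  shows "(\<Sum>i<n. \<Sum>j<n. v i * P i j * w j) = (\<Sum>i<n. \<Sum>j<n. w i * P i j * v j)"
  by (subst sum.swap) (auto simp: assms mult_ac intro!: sum.cong)

text \<open>A double null vector and a double generalized eigenvalue 1 of the pencil (N, J) persist
  under small changes of the pencil: the Schur complements of the perturbed N and N - J have six
  independent entries, and transversality says that these are submersive in the entries of N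
  permitted by its own pattern.  Hence extra edges and a positive definite mass matrix can be
  absorbed.\<close>

lemma low_of_pencil:
  fixes N :: "nat \<Rightarrow> nat \<Rightarrow> real" and J :: "nat \<Rightarrow> real"
  assumes simple: "\<And>i j. i < n \<Longrightarrow> j < n \<Longrightarrow> E i j \<longleftrightarrow> E j i"
    and N_sym: "\<And>i j. i < n \<Longrightarrow> j < n \<Longrightarrow> N i j = N j i"
    and N_E: "\<And>i j. i < n \<Longrightarrow> j < n \<Longrightarrow> i \<noteq> j \<Longrightarrow> N i j \<noteq> 0 \<Longrightarrow> E i j"
    and J: "\<And>i. i < n \<Longrightarrow> J i \<ge> 0"
    and z: "pivoted_kernel n N z p"
    and y: "pivoted_kernel n (\<lambda>i j. N i j - (if i = j then J i else 0)) y r"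
    and transversal: "\<And>s t. (\<And>i j. i < n \<Longrightarrow> j < n \<Longrightarrow> i = j \<or> N i j \<noteq> 0 \<Longrightarrow>
         quad_form z s i j + quad_form y t i j = 0) \<Longrightarrow> s = 0 \<and> t = 0"
  shows "low n E"
proof -
  define pat where "pat i j = (if i = j \<or> N i j \<noteq> 0 then 1 else 0 :: real)" for i j
  \<comment> \<open>Seven parameters: two symmetric 2 by 2 matrices and the scalar \<open>e\<close>.
    The entries of \<open>N\<close> are moved along the quadratic forms themselves, cut down to the
    pattern, which turns injectivity of the derivative into positivity of a sum of squares.\<close>
  define X where "X x i j = quad_form z (fst x) i j + quad_form y (fst (snd x)) i j"
    for x :: "(real \<times> real \<times> real) \<times> (real \<times> real \<times> real) \<times> real" and i j
  define e where "e x = snd (snd x)" for x :: "(real \<times> real \<times> real) \<times> (real \<times> real \<times> real) \<times> real"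
  define \<Delta>0 where "\<Delta>0 x i j = pat i j * X x i j + (if E i j \<and> pat i j = 0 then e x else 0)" for x i j
  \<comment> \<open>The mass at \<open>i\<close> becomes \<open>J i + e x\<close>, so that
    \<open>M1 x\<close> is \<open>M0 x\<close> minus the new mass matrix. The same \<open>e\<close>
    fills in the missing edges.\<close>
  define \<Delta>1 where "\<Delta>1 x i j = \<Delta>0 x i j - (if i = j then e x else 0)" for x i j
  define M0 where "M0 x i j = N i j + \<Delta>0 x i j" for x i j
  define M1 where "M1 x i j = (N i j - (if i = j then J i else 0)) + \<Delta>1 x i j" for x i j
  have X_sym: "X x i j = X x j i" for x i j by (simp add: X_def quad_form_def algebra_simps)
  have pat_sym: "pat i j = pat j i" if "i < n" "j < n" for i j using N_sym[OF that] by (simp add: pat_def)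
  have \<Delta>0_sym: "\<Delta>0 x i j = \<Delta>0 x j i" if "i < n" "j < n" for x i j
    using X_sym pat_sym[OF that] simple[OF that] by (simp add: \<Delta>0_def)
  have X_lin: "bounded_linear (\<lambda>x. X x i j)" for i j
    unfolding linear_conv_bounded_linear[symmetric]
    by (rule linearI) (simp_all add: X_def quad_form_def algebra_simps)
  have e_lin: "bounded_linear e"
    unfolding linear_conv_bounded_linear[symmetric]
    by (rule linearI) (simp_all add: e_def)
  have \<Delta>0_lin: "bounded_linear (\<lambda>x. \<Delta>0 x i j)" for i j
    unfolding \<Delta>0_def
    by (cases "E i j \<and> pat i j = 0") (auto intro!: bounded_linear_add bounded_linear_const_mult X_lin e_lin)
  have \<Delta>1_lin: "bounded_linear (\<lambda>x. \<Delta>1 x i j)" for i j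
    unfolding \<Delta>1_def
    by (cases "i = j") (auto intro!: bounded_linear_sub \<Delta>0_lin e_lin)
  have M0_0: "M0 0 = N" using linear_simps(3)[OF \<Delta>0_lin] by (simp add: M0_def fun_eq_iff)
  have M1_0: "M1 0 = (\<lambda>i j. N i j - (if i = j then J i else 0))"
    using linear_simps(3)[OF \<Delta>1_lin] by (simp add: M1_def fun_eq_iff)
  have \<Delta>0_c: "continuous_on S (\<lambda>x. \<Delta>0 x i j)" and \<Delta>1_c: "continuous_on S (\<lambda>x. \<Delta>1 x i j)" for S i j
    using \<Delta>0_lin \<Delta>1_lin by (simp_all add: linear_continuous_on)
  have M0_c: "continuous_on UNIV (\<lambda>x. M0 x i j)" and M1_c: "continuous_on UNIV (\<lambda>x. M1 x i j)" for i j
    unfolding M0_def M1_def by (intro continuous_intros \<Delta>0_c \<Delta>1_c)+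
  have M0_sym: "M0 x i j = M0 x j i" and M1_sym: "M1 x i j = M1 x j i" if "i < n" "j < n" for x i j
    using that N_sym \<Delta>0_sym by (auto simp: M0_def M1_def \<Delta>1_def)
  have z0: "pivoted_kernel n (M0 0) z p" and y0: "pivoted_kernel n (M1 0) y r"
    using z y unfolding M0_0 M1_0 .
  obtain U0 \<zeta> where U0: "open U0" "0 \<in> U0"
    "\<And>k i. k < 2 \<Longrightarrow> i < n \<Longrightarrow> continuous_on U0 (\<lambda>x. \<zeta> k x i)"
    "\<And>k i. k < 2 \<Longrightarrow> i < n \<Longrightarrow> \<zeta> k 0 i = z k i"
    "\<And>k l x. k < 2 \<Longrightarrow> l < 2 \<Longrightarrow> x \<in> U0 \<Longrightarrow> \<zeta> k x (p l) = (if k = l then 1 else 0)"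
    "\<And>x k i. \<lbrakk>x \<in> U0; k < 2; i < n; \<forall>k l. k \<le> l \<and> l < 2 \<longrightarrow>
       (\<Sum>i<n. \<Sum>j<n. z k i * (M0 x i j - M0 0 i j) * \<zeta> l x j) = 0\<rbrakk> \<Longrightarrow> (\<Sum>j<n. M0 x i j * \<zeta> k x j) = 0"
    by (rule kernel_continuation[of n M0 0 z p]) (use M0_c M0_sym z0 in blast)+
  obtain U1 \<eta> where U1: "open U1" "0 \<in> U1"
    "\<And>k i. k < 2 \<Longrightarrow> i < n \<Longrightarrow> continuous_on U1 (\<lambda>x. \<eta> k x i)"
    "\<And>k i. k < 2 \<Longrightarrow> i < n \<Longrightarrow> \<eta> k 0 i = y k i"
    "\<And>k l x. k < 2 \<Longrightarrow> l < 2 \<Longrightarrow> x \<in> U1 \<Longrightarrow> \<eta> k x (r l) = (if k = l then 1 else 0)"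
    "\<And>x k i. \<lbrakk>x \<in> U1; k < 2; i < n; \<forall>k l. k \<le> l \<and> l < 2 \<longrightarrow>
       (\<Sum>i<n. \<Sum>j<n. y k i * (M1 x i j - M1 0 i j) * \<eta> l x j) = 0\<rbrakk> \<Longrightarrow> (\<Sum>j<n. M1 x i j * \<eta> k x j) = 0"
    by (rule kernel_continuation[of n M1 0 y r]) (use M1_c M1_sym y0 in blast)+
  define s where "s k l x = (\<Sum>i<n. \<Sum>j<n. z k i * \<Delta>0 x i j * \<zeta> l x j)" for k l x
  define t where "t k l x = (\<Sum>i<n. \<Sum>j<n. y k i * \<Delta>1 x i j * \<eta> l x j)" for k l x
  define s' where "s' k l x = (\<Sum>i<n. \<Sum>j<n. z k i * \<Delta>0 x i j * z l j)" for k l x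
  define t' where "t' k l x = (\<Sum>i<n. \<Sum>j<n. y k i * \<Delta>1 x i j * y l j)" for k l x
  \<comment> \<open>Three entries of each Schur complement together with \<open>e\<close>: seven
    functions of seven parameters. In \<open>F'\<close> the moving null vectors are frozen at their
    initial values.\<close>
  define F where "F x = ((s 0 0 x, s 0 1 x, s 1 1 x), (t 0 0 x, t 0 1 x, t 1 1 x), e x)" for x
  define F' where "F' x = ((s' 0 0 x, s' 0 1 x, s' 1 1 x), (t' 0 0 x, t' 0 1 x, t' 1 1 x), e x)" for x
  define U where "U = U0 \<inter> U1"
  have U: "open U" "0 \<in> U" using U0(1,2) U1(1,2) by (auto simp: U_def)
  have cont_F: "continuous_on U F"
    unfolding F_def s_def t_def U_def
    by (intro continuous_intros \<Delta>0_c \<Delta>1_c continuous_on_subset[OF U0(3)] continuous_on_subset[OF U1(3)]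
        linear_continuous_on[OF e_lin]) auto
  have ds: "(s k l has_derivative s' k l) (at 0)" if "l < 2" for k l
    unfolding s_def[abs_def] s'_def[abs_def]
  proof (intro has_derivative_sum)
    fix i j assume "j \<in> {..<n}"
    then have "isCont (\<lambda>x. \<zeta> l x j) 0"
      using U0(1,2) U0(3)[OF that] continuous_on_eq_continuous_at by blast
    then show "((\<lambda>x. z k i * \<Delta>0 x i j * \<zeta> l x j) has_derivative (\<lambda>x. z k i * \<Delta>0 x i j * z l j)) (at 0)"
      using has_derivative_mult_linear_at_0[OF bounded_linear_const_mult[OF \<Delta>0_lin]] U0(4)[OF that] \<open>j \<in> {..<n}\<close>
      by fastforce
  qed
  have dt: "(t k l has_derivative t' k l) (at 0)" if "l < 2" for k l
    unfolding t_def[abs_def] t'_def[abs_def]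
  proof (intro has_derivative_sum)
    fix i j assume "j \<in> {..<n}"
    then have "isCont (\<lambda>x. \<eta> l x j) 0"
      using U1(1,2) U1(3)[OF that] continuous_on_eq_continuous_at by blast
    then show "((\<lambda>x. y k i * \<Delta>1 x i j * \<eta> l x j) has_derivative (\<lambda>x. y k i * \<Delta>1 x i j * y l j)) (at 0)"
      using has_derivative_mult_linear_at_0[OF bounded_linear_const_mult[OF \<Delta>1_lin]] U1(4)[OF that] \<open>j \<in> {..<n}\<close>
      by fastforce
  qed
  have dF: "(F has_derivative F') (at 0)"
    unfolding F_def[abs_def] F'_def[abs_def]
    by (intro has_derivative_Pair ds dt bounded_linear_imp_has_derivative e_lin) auto
  then have lin_F': "linear F'" using has_derivative_linear by blast
  \<comment> \<open>Once \<open>e x = 0\<close>, the six vanishing compressions say that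
    \<open>\<Delta>0 x\<close> is orthogonal to \<open>X x\<close>. But \<open>\<Delta>0 x\<close>
    is \<open>X x\<close> cut down to the pattern, so \<open>X x\<close> vanishes on the pattern and
    general position applies.\<close>
  have "x = 0" if "F' x = 0" for x
  proof -
    have e0: "e x = 0" and s0: "s' 0 0 x = 0" "s' 0 1 x = 0" "s' 1 1 x = 0"
      and t0: "t' 0 0 x = 0" "t' 0 1 x = 0" "t' 1 1 x = 0"
      using that by (auto simp: F'_def zero_prod_def)
    have \<Delta>: "\<Delta>0 x i j = pat i j * X x i j" "\<Delta>1 x i j = \<Delta>0 x i j" for i j
      using e0 by (auto simp: \<Delta>0_def \<Delta>1_def)
    have s1: "s' 1 0 x = 0" using s0(2) bilinear_sum_swap[of n "\<Delta>0 x" "z 0" "z 1", OF \<Delta>0_sym]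
      by (simp add: s'_def)
    have t1: "t' 1 0 x = 0" using t0(2) bilinear_sum_swap[of n "\<Delta>0 x" "y 0" "y 1", OF \<Delta>0_sym]
      by (simp add: t'_def \<Delta>(2))
    have "(\<Sum>i<n. \<Sum>j<n. pat i j * (X x i j)\<^sup>2) =
      (\<Sum>i<n. \<Sum>j<n. \<Delta>0 x i j * quad_form z (fst x) i j) + (\<Sum>i<n. \<Sum>j<n. \<Delta>0 x i j * quad_form y (fst (snd x)) i j)"
      by (simp add: \<Delta>(1) X_def sum.distrib[symmetric] algebra_simps power2_eq_square)
    also have "\<dots> = 0"
      using s0 s1 t0 t1 unfolding quad_form_sum s'_def t'_def \<Delta>(2) by simp
    finally have "(\<Sum>i<n. \<Sum>j<n. pat i j * (X x i j)\<^sup>2) = 0" .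
    then have h: "pat i j * (X x i j)\<^sup>2 = 0" if "i < n" "j < n" for i j
      using that by (auto simp: sum_nonneg_eq_0_iff sum_nonneg pat_def)
    have "fst x = 0 \<and> fst (snd x) = 0"
    proof (rule transversal)
      fix i j assume "i < n" "j < n" "i = j \<or> N i j \<noteq> 0"
      with h[of i j] show "quad_form z (fst x) i j + quad_form y (fst (snd x)) i j = 0"
        by (simp add: pat_def X_def)
    qed
    with e0 show "x = 0" by (cases x) (simp add: e_def zero_prod_def)
  qed
  then have "inj F'" using lin_F' linear_injective_0 by blast
  then have "surj F'" using lin_F' linear_injective_imp_surjective by blast
  then obtain G where G: "linear G" "F' \<circ> G = id"
    using linear_surjective_right_inverse[OF lin_F'] by auto
  \<comment> \<open>Parameters for which no nonzero entry of \<open>N\<close> is lost.\<close>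
  define T where "T = {x \<in> U. \<forall>i<n. \<forall>j<n. N i j \<noteq> 0 \<longrightarrow> M0 x i j \<noteq> 0}"
  have "T = U \<inter> (\<Inter>i\<in>{..<n}. \<Inter>j\<in>{..<n}. {x. N i j \<noteq> 0 \<longrightarrow> M0 x i j \<noteq> 0})"
    by (auto simp: T_def)
  moreover have "open {x. N i j \<noteq> 0 \<longrightarrow> M0 x i j \<noteq> 0}" for i j
    using open_Collect_neq[OF M0_c[of i j] continuous_on_const[of UNIV 0]] by (cases "N i j = 0") auto
  ultimately have "open T" using U(1) by (simp only:) (intro open_Int open_INT finite_lessThan ballI)
  moreover have "0 \<in> T" unfolding T_def mem_Collect_eq M0_0 using U(2) by blast
  ultimately have "0 \<in> interior T" by (simp add: interior_open)
  \<comment> \<open>Only continuity near 0 and an invertible derivative at 0 are available; this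
    form of the open mapping theorem, resting on Brouwer's fixed point theorem, asks for no
    more.\<close>
  have "F 0 \<in> interior (F ` T)"
    by (rule sussmann_open_mapping[OF U(1) cont_F U(2) dF _ G(2)])
      (use G(1) \<open>0 \<in> interior T\<close> in \<open>auto simp: T_def linear_conv_bounded_linear\<close>)
  moreover have "F 0 = 0"
    using linear_simps(3)[OF \<Delta>0_lin] linear_simps(3)[OF \<Delta>1_lin] linear_simps(3)[OF e_lin]
    by (simp add: F_def s_def t_def zero_prod_def)
  ultimately obtain \<epsilon> where \<epsilon>: "\<epsilon> > 0" "ball 0 \<epsilon> \<subseteq> F ` T" by (auto simp: mem_interior)
  \<comment> \<open>The target keeps both Schur complements at zero. A positive \<open>e\<close>
    gives every missing edge a nonzero entry and turns \<open>J \<ge> 0\<close> into a positive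
    definite mass.\<close>
  have "(0, 0, \<epsilon> / 2) \<in> ball (0 :: (real \<times> real \<times> real) \<times> (real \<times> real \<times> real) \<times> real) \<epsilon>"
    using \<epsilon>(1) by (simp add: norm_Pair dist_norm)
  then have "(0, 0, \<epsilon> / 2) \<in> F ` T" using \<epsilon>(2) by (rule subsetD[rotated])
  then obtain x where x: "x \<in> T" "F x = (0, 0, \<epsilon> / 2)" by (elim imageE) simp
  have xU: "x \<in> U0" "x \<in> U1" using x(1) by (auto simp: T_def U_def)
  have F_eq: "(s 0 0 x, s 0 1 x, s 1 1 x) = 0" "(t 0 0 x, t 0 1 x, t 1 1 x) = 0" "e x = \<epsilon> / 2"
    using x(2) unfolding F_def prod.inject by blast+
  have e: "e x > 0" using F_eq(3) \<epsilon>(1) by simp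
  have ss: "s 0 0 x = 0" "s 0 1 x = 0" "s 1 1 x = 0"
    using F_eq(1) unfolding zero_prod_def prod.inject by blast+
  have tt: "t 0 0 x = 0" "t 0 1 x = 0" "t 1 1 x = 0"
    using F_eq(2) unfolding zero_prod_def prod.inject by blast+
  have kl: "k = 0 \<and> l = 0 \<or> k = 0 \<and> l = 1 \<or> k = 1 \<and> l = 1" if "k \<le> l" "l < 2" for k l :: nat
    using that by linarith
  have \<zeta>_ker: "(\<Sum>j<n. M0 x i j * \<zeta> k x j) = 0" if "k < 2" "i < n" for k i
  proof (rule U0(6)[OF xU(1) that], intro allI impI)
    fix k l :: nat assume "k \<le> l \<and> l < 2"
    then show "(\<Sum>i<n. \<Sum>j<n. z k i * (M0 x i j - M0 0 i j) * \<zeta> l x j) = 0"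
      using kl[of k l] ss unfolding M0_0 by (auto simp: s_def M0_def)
  qed
  have \<eta>_ker: "(\<Sum>j<n. M1 x i j * \<eta> k x j) = 0" if "k < 2" "i < n" for k i
  proof (rule U1(6)[OF xU(2) that], intro allI impI)
    fix k l :: nat assume "k \<le> l \<and> l < 2"
    then show "(\<Sum>i<n. \<Sum>j<n. y k i * (M1 x i j - M1 0 i j) * \<eta> l x j) = 0"
      using kl[of k l] tt unfolding M1_0 by (auto simp: t_def M1_def)
  qed
  define d where "d i = sqrt (J i + e x)" for i
  have d: "d i > 0" "d i * d i = J i + e x" if "i < n" for i using J[OF that] e by (auto simp: d_def)
  \<comment> \<open>This is D^(-1/2) M0 D^(-1/2) for the diagonal matrix D with entries
    \<open>J i + e x\<close>. Multiplication by \<open>d\<close> carries null vectors of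
    \<open>M0 x\<close> to eigenvectors for 0, and null vectors of \<open>M1 x\<close> to
    eigenvectors for 1.\<close>
  define a where "a i j = M0 x i j / (d i * d j)" for i j
  have a_mult: "(\<Sum>j<n. a i j * (d j * v j)) = (\<Sum>j<n. M0 x i j * v j) / d i" if "i < n" for i v
    unfolding sum_divide_distrib using d(1) that
    by (intro sum.cong) (auto simp: a_def less_imp_neq[symmetric])
  have M01: "(\<Sum>j<n. M0 x i j * v j) = (\<Sum>j<n. M1 x i j * v j) + (J i + e x) * v i" if "i < n" for i v
  proof -
    have "(\<Sum>j<n. M0 x i j * v j) = (\<Sum>j<n. M1 x i j * v j + (if j = i then (J i + e x) * v i else 0))"
      by (intro sum.cong) (auto simp: M0_def M1_def \<Delta>1_def algebra_simps)
    then show ?thesis using that by (simp add: sum.distrib)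
  qed
  have indep: "c = 0 \<and> c' = 0" if "\<And>i. i < n \<Longrightarrow> c * (d i * v i) + c' * (d i * v' i) = 0"
    "q < n" "q' < n" "v q = 1" "v q' = 0" "v' q = 0" "v' q' = 1" for c c' v v' q q'
    using that(1)[OF that(2)] that(1)[OF that(3)] that(4-) d(1)[OF that(2)] d(1)[OF that(3)] by auto
  have pz: "p 0 < n" "p 1 < n" "r 0 < n" "r 1 < n"
    using z y by (auto simp: pivoted_kernel_def)
  have "q_mat (Matrix.mat n n (\<lambda>(i,j). a i j)) + 2 \<le> n"
  proof (rule q_mat_le_of_pairs)
    show "(\<Sum>j<n. a i j * (d j * \<zeta> 0 x j)) = 0 * (d i * \<zeta> 0 x i)"
      and "(\<Sum>j<n. a i j * (d j * \<zeta> 1 x j)) = 0 * (d i * \<zeta> 1 x i)" if "i < n" for i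
      using \<zeta>_ker[OF _ that] by (simp_all add: a_mult that)
    show "(\<Sum>j<n. a i j * (d j * \<eta> 0 x j)) = 1 * (d i * \<eta> 0 x i)"
      and "(\<Sum>j<n. a i j * (d j * \<eta> 1 x j)) = 1 * (d i * \<eta> 1 x i)" if "i < n" for i
      using \<eta>_ker[OF _ that] d[OF that] by (simp_all add: a_mult that M01 d(2)[symmetric])
    show "a i j = a j i" if "i < n" "j < n" for i j using M0_sym[OF that] by (simp add: a_def mult.commute)
  next
    fix c c' assume "\<And>i. i < n \<Longrightarrow> c * (d i * \<zeta> 0 x i) + c' * (d i * \<zeta> 1 x i) = 0"
    then show "c = 0 \<and> c' = 0"
      by (rule indep[OF _ pz(1,2)]) (use U0(5) xU in auto)
  next
    fix c c' assume "\<And>i. i < n \<Longrightarrow> c * (d i * \<eta> 0 x i) + c' * (d i * \<eta> 1 x i) = 0"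
    then show "c = 0 \<and> c' = 0"
      by (rule indep[OF _ pz(3,4)]) (use U1(5) xU in auto)
  qed simp
  moreover have "a i j \<noteq> 0 \<longleftrightarrow> E i j" if ij: "i < n" "j < n" "i \<noteq> j" for i j
  proof -
    have "M0 x i j \<noteq> 0 \<longleftrightarrow> E i j"
    proof (cases "N i j = 0")
      case True then show ?thesis using ij e by (simp add: M0_def \<Delta>0_def pat_def)
    next
      case False then show ?thesis using x(1) ij N_E by (auto simp: T_def)
    qed
    then show ?thesis using d(1) ij by (auto simp: a_def less_imp_neq[symmetric])
  qed
  moreover have "a i j = a j i" if "i < n" "j < n" for i j using M0_sym[OF that] by (simp add: a_def mult.commute)
  ultimately show ?thesis
    unfolding low_def by (intro bexI[of _ "Matrix.mat n n (\<lambda>(i,j). a i j)"] mat_in_S_graph)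
qed

section \<open>Embedding a pencil into a larger graph\<close>

text \<open>Outside the subgraph the matrix is -1 times the identity, an invertible block, so the
  kernel does not grow. If no mass is placed there, the same extension serves \<open>N\<close> and
  \<open>N - J\<close>.\<close>

lemma pivoted_kernel_extend:
  assumes ker: "pivoted_kernel m N z p" and "m \<le> n"
    and N': "\<And>i j. i < m \<Longrightarrow> j < m \<Longrightarrow> N' i j = N i j" "\<And>i. m \<le> i \<Longrightarrow> N' i i = -1"
      "\<And>i j. i \<noteq> j \<Longrightarrow> \<not> (i < m \<and> j < m) \<Longrightarrow> N' i j = 0"
  shows "pivoted_kernel n N' (\<lambda>k i. if i < m then z k i else 0) p"
proof -
  have *: "(\<Sum>j<n. N' i j * v j) = (if i < m then (\<Sum>j<m. N i j * v j) else - v i)" if "i < n" for i v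
  proof (cases "i < m")
    case True
    then have "(\<Sum>j<n. N' i j * v j) = (\<Sum>j<m. N' i j * v j)"
      using \<open>m \<le> n\<close> N'(3) by (intro sum.mono_neutral_right) auto
    then show ?thesis using True N'(1) by simp
  next
    case False
    then have "(\<Sum>j<n. N' i j * v j) = (\<Sum>j\<in>{i}. N' i j * v j)"
      using N'(3) \<open>i < n\<close> by (intro sum.mono_neutral_right) auto
    then show ?thesis using False N'(2) by simp
  qed
  have p: "p k < m" if "k < 2" for k using ker that by (auto simp: pivoted_kernel_def)
  show ?thesis
    unfolding pivoted_kernel_def
  proof (intro conjI allI impI)
    fix k i :: nat assume "k < 2" "i < n"
    then show "(\<Sum>j<n. N' i j * (if j < m then z k j else 0)) = 0"
      using ker by (simp add: * pivoted_kernel_def)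
  next
    fix k l :: nat assume "k < 2"
    then show "p k < n" using p[of k] \<open>m \<le> n\<close> by simp
    assume "l < 2"
    then show "(if p l < m then z k (p l) else 0) = (if k = l then 1 else 0)"
      using p[of l] ker \<open>k < 2\<close> by (simp add: pivoted_kernel_def)
  next
    fix v i assume v: "\<forall>i<n. (\<Sum>j<n. N' i j * v j) = 0" "v (p 0) = 0" "v (p 1) = 0" and i: "i < n"
    show "v i = 0"
    proof (cases "i < m")
      case True
      have "(\<Sum>j<m. N i j * v j) = 0" if "i < m" for i
        using v(1) *[of i v] that \<open>m \<le> n\<close> by auto
      then show ?thesis using ker v(2,3) True unfolding pivoted_kernel_def by blast
    next
      case False
      then show ?thesis using v(1) *[OF i, of v] i by simp
    qed
  qed
qed

lemma extend_inj_to_bij: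
  fixes f :: "nat \<Rightarrow> nat"
  assumes "inj_on f {..<m}" "f ` {..<m} \<subseteq> {..<n}"
  obtains g where "bij_betw g {..<n} {..<n}" "\<And>i. i < m \<Longrightarrow> g i = f i" "m \<le> n"
proof -
  have mn: "m \<le> n" using card_inj_on_le[OF assms] by simp
  have "card {m..<n} = card ({..<n} - f ` {..<m})"
    using assms by (simp add: card_Diff_subset card_image)
  then obtain h where h: "bij_betw h {m..<n} ({..<n} - f ` {..<m})"
    using finite_same_card_bij[of "{m..<n}" "{..<n} - f ` {..<m}"] by auto
  define g where "g i = (if i < m then f i else h i)" for i
  have "bij_betw g ({..<m} \<union> {m..<n}) (f ` {..<m} \<union> ({..<n} - f ` {..<m}))"
  proof (rule bij_betw_combine)
    show "bij_betw g {..<m} (f ` {..<m})"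
      using assms(1) by (auto simp: bij_betw_def g_def inj_on_def)
    show "bij_betw g {m..<n} ({..<n} - f ` {..<m})"
      using h by (subst bij_betw_cong[of _ _ h]) (auto simp: g_def)
  qed auto
  moreover have "{..<m} \<union> {m..<n} = {..<n}" using mn by auto
  moreover have "f ` {..<m} \<union> ({..<n} - f ` {..<m}) = {..<n}" using assms(2) by auto
  ultimately show ?thesis using that[of g] mn by (simp add: g_def)
qed

text \<open>The pencil may leave out edges of the graph, also between vertices in the image of
  \<open>f\<close>: all of them are supplied by the perturbation. So each configuration below is
  needed only as a subgraph, not as an induced one.\<close>

lemma low_of_subgraph_pencil:
  fixes N :: "nat \<Rightarrow> nat \<Rightarrow> real"
  assumes G: "simple_graph n E"
    and f: "inj_on f {..<m}" "f ` {..<m} \<subseteq> {..<n}"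
    and N_sym: "\<And>i j. i < m \<Longrightarrow> j < m \<Longrightarrow> N i j = N j i"
    and N_E: "\<And>i j. i < m \<Longrightarrow> j < m \<Longrightarrow> i < j \<Longrightarrow> N i j \<noteq> 0 \<Longrightarrow> E (f i) (f j)"
    and J: "\<And>i. i < m \<Longrightarrow> J i \<ge> 0"
    and z: "pivoted_kernel m N z p"
    and y: "pivoted_kernel m (\<lambda>i j. N i j - (if i = j then J i else 0)) y r"
    and transversal: "\<And>s t. (\<And>i j. i < m \<Longrightarrow> j < m \<Longrightarrow> i = j \<or> N i j \<noteq> 0 \<Longrightarrow>
         quad_form z s i j + quad_form y t i j = 0) \<Longrightarrow> s = 0 \<and> t = 0"
  shows "low n E"
proof -
  obtain g where g: "bij_betw g {..<n} {..<n}" "\<And>i. i < m \<Longrightarrow> g i = f i" and mn: "m \<le> n"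
    using extend_inj_to_bij[OF f] by blast
  have gn: "g i < n" if "i < n" for i using g(1) that by (auto simp: bij_betw_def)
  have E_sym: "E i j \<longleftrightarrow> E j i" if "i < n" "j < n" for i j
    using G that by (auto simp: simple_graph_def)
  define N' where "N' i j = (if i < m \<and> j < m then N i j else if i = j then -1 else 0)" for i j
  define J' where "J' i = (if i < m then J i else 0)" for i
  have "low n (\<lambda>i j. E (g i) (g j))"
  proof (rule low_of_pencil)
    show "E (g i) (g j) \<longleftrightarrow> E (g j) (g i)" if "i < n" "j < n" for i j using E_sym gn that by blast
    show "N' i j = N' j i" for i j using N_sym by (simp add: N'_def)
    show "E (g i) (g j)" if "i < n" "j < n" "i \<noteq> j" "N' i j \<noteq> 0" for i j
    proof -
      have ij: "i < m" "j < m" "N i j \<noteq> 0" using that by (auto simp: N'_def split: if_splits)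
      show ?thesis
      proof (cases "i < j")
        case True then show ?thesis using N_E[of i j] ij g(2) by simp
      next
        case False
        then have "E (g j) (g i)" using N_E[of j i] ij g(2) N_sym[of i j] \<open>i \<noteq> j\<close> by simp
        then show ?thesis using E_sym gn that by blast
      qed
    qed
    show "J' i \<ge> 0" for i using J by (simp add: J'_def)
    show "pivoted_kernel n N' (\<lambda>k i. if i < m then z k i else 0) p"
      by (rule pivoted_kernel_extend[OF z mn]) (auto simp: N'_def)
    show "pivoted_kernel n (\<lambda>i j. N' i j - (if i = j then J' i else 0)) (\<lambda>k i. if i < m then y k i else 0) r"
      by (rule pivoted_kernel_extend[OF y mn]) (auto simp: N'_def J'_def)
    fix s t
    assume *: "\<And>i j. i < n \<Longrightarrow> j < n \<Longrightarrow> i = j \<or> N' i j \<noteq> 0 \<Longrightarrow>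
      quad_form (\<lambda>k i. if i < m then z k i else 0) s i j + quad_form (\<lambda>k i. if i < m then y k i else 0) t i j = 0"
    show "s = 0 \<and> t = 0"
    proof (rule transversal)
      fix i j assume "i < m" "j < m" "i = j \<or> N i j \<noteq> 0"
      then show "quad_form z s i j + quad_form y t i j = 0"
        using *[of i j] mn by (simp add: quad_form_def N'_def)
    qed
  qed
  then show ?thesis by (rule low_relabel[OF g(1)])
qed

section \<open>Explicit pencils\<close>

lemma sum_row:
  fixes N :: "nat \<Rightarrow> real"
  assumes "S \<subseteq> {..<m}" "\<And>j. j < m \<Longrightarrow> j \<notin> S \<Longrightarrow> N j = 0"
  shows "(\<Sum>j<m. N j * v j) = (\<Sum>j\<in>S. N j * v j)"
  using assms by (intro sum.mono_neutral_right) auto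

lemma sum_pencil_row:
  fixes N :: "nat \<Rightarrow> nat \<Rightarrow> real"
  assumes "i < m"
  shows "(\<Sum>j<m. (N i j - (if i = j then J i else 0)) * v j) = (\<Sum>j<m. N i j * v j) - J i * v i"
proof -
  have "(\<Sum>j<m. (N i j - (if i = j then J i else 0)) * v j) =
    (\<Sum>j<m. N i j * v j - (if i = j then J i * v j else 0))" by (intro sum.cong) (auto simp: algebra_simps)
  then show ?thesis using assms by (simp add: sum_subtractf)
qed

lemma less_2_cases: "k < 2 \<Longrightarrow> k = 0 \<or> k = (1::nat)"
  by linarith

text \<open>In the next two pencils the diagonal is -2 along a path without mass, so that null vectors are
  linear functions there; the remaining entries are chosen to join these at the ends.\<close>

lemma low_of_cycle:
  assumes G: "simple_graph n E"
    and f: "inj_on f {..<r+4}" "f ` {..<r+4} \<subseteq> {..<n}"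
    and E: "\<And>i. i < r + 3 \<Longrightarrow> E (f i) (f (Suc i))" "E (f 0) (f (r + 3))"
  shows "low n E"
proof -
  \<comment> \<open>All mass sits on the vertices 0 to 3; beyond them null vectors are arithmetic
    progressions. The extra 1 at \<open>r + 3\<close> makes the slope equal to the value at 0, and
    \<open>2 - r\<close> at 0 balances the value reached at the far end.\<close>
  define D where "D i = (if i = 0 then 2 - real r else if i = 1 then 1 else if i = 2 then 2
     else (if i = 3 then 0 else -2) + (if i = r + 3 then 1 else 0))" for i
  \<comment> \<open>The sign comes from the 4-cycle. For \<open>r = 0\<close> the mass is 3 times
    the identity and N^2 = 3 N; the zero entry at the opposite vertices 0 and 2 forces the product
    of the four edge entries to be negative.\<close>
  define a where "a i j = (if j = Suc i then (if i = 2 then -1 else 1) else if i = 0 \<and> j = r + 3 then 1 else 0 :: real)" for i j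
  define N where "N i j = (if i = j then D i else if i < j then a i j else a j i)" for i j
  define J where "J i = (if i < 4 then 3 else 0 :: real)" for i :: nat
  define z where "z k i = (if k = 0 then (if i = 0 then 1 else if i = 1 then -1 else if i = 2 then 0 else real i - 4)
     else (if i = 0 then 0 else if i = 1 then -1 else 1))" for k i :: nat
  define y where "y k i = (if k = 0 then (if i < 3 then 1 else real i - 3)
     else (if i = 0 then 1 else if i = 1 then 0 else if i = 2 then -1 else real i - 2))" for k i :: nat
  have row: "(\<Sum>j<r+4. N i j * v j) = (
     if i = 0 then D 0 * v 0 + v 1 + v (r + 3) else if i = 1 then v 0 + v 1 + v 2
     else if i = 2 then v 1 + 2 * v 2 - v 3 else (if i = 3 then - v 2 else v (i - 1)) + D i * v i
       + (if i = r + 3 then v 0 else v (i + 1)))" if i: "i < r + 4" for i v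
  proof -
    consider "i = 0" | "i = 1" | "i = 2" | "i = r + 3" | "i \<ge> 3" "i < r + 3" using i by linarith
    then show ?thesis
    proof cases
      case 1
      have "(\<Sum>j<r+4. N i j * v j) = (\<Sum>j\<in>{0, 1, r + 3}. N i j * v j)"
        using 1 by (intro sum_row) (auto simp: N_def a_def)
      with 1 show ?thesis by (simp add: N_def a_def)
    next
      case 2
      have "(\<Sum>j<r+4. N i j * v j) = (\<Sum>j\<in>{0, 1, 2}. N i j * v j)"
        using 2 by (intro sum_row) (auto simp: N_def a_def)
      with 2 show ?thesis by (simp add: N_def a_def D_def)
    next
      case 3
      have "(\<Sum>j<r+4. N i j * v j) = (\<Sum>j\<in>{1, 2, 3}. N i j * v j)"
        using 3 by (intro sum_row) (auto simp: N_def a_def)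
      with 3 show ?thesis by (simp add: N_def a_def D_def)
    next
      case 4
      have "(\<Sum>j<r+4. N i j * v j) = (\<Sum>j\<in>{0, r + 2, r + 3}. N i j * v j)"
        using 4 by (intro sum_row) (auto simp: N_def a_def)
      with 4 show ?thesis by (cases "r = 0") (auto simp: N_def a_def numeral_2_eq_2 numeral_3_eq_3)
    next
      case 5
      have "(\<Sum>j<r+4. N i j * v j) = (\<Sum>j\<in>{i - 1, i, i + 1}. N i j * v j)"
        using 5 by (intro sum_row) (auto simp: N_def a_def)
      with 5 show ?thesis by (cases i; cases "i = 3") (auto simp: N_def a_def)
    qed
  qed
  \<comment> \<open>From vertex 3 on, each row determines the next value from the two before it.
    Since \<open>v 3 = 0\<close>, the mass no longer matters, and the argument serves both
    kernels.\<close>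
  have tail: "v i = 0" if "\<And>i. i < r + 4 \<Longrightarrow> i \<ge> 3 \<Longrightarrow> (\<Sum>j<r+4. N i j * v j) = J i * v i"
    "v 0 = 0" "v 1 = 0" "v 2 = 0" "v 3 = 0" "i < r + 4" for v i
    using \<open>i < r + 4\<close>
  proof (induction i rule: less_induct)
    case (less i)
    show ?case
    proof (cases "i < 4")
      case True
      then have "i = 0 \<or> i = 1 \<or> i = 2 \<or> i = 3" by linarith
      then show ?thesis using that by auto
    next
      case False
      then obtain k where k: "i = Suc k" "3 \<le> k" by (cases i) auto
      then have "v k = 0" "v (k - 1) = 0" using less by auto
      then show ?thesis using that(1)[of k] row[of k v] k less(2) that(4) by (auto split: if_splits)
    qed
  qed
  have z: "pivoted_kernel (r + 4) N z (\<lambda>k. if k = 0 then 0 else 2)"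
    unfolding pivoted_kernel_def
  proof (intro conjI allI impI)
    fix k i :: nat assume "k < 2" and i: "i < r + 4"
    then consider "k = 0" | "k = 1" by linarith
    then show "(\<Sum>j<r+4. N i j * z k j) = 0"
    proof cases
      case 1 with i show ?thesis unfolding row[OF i] by (auto simp: z_def D_def of_nat_diff)
    next
      case 2 with i show ?thesis unfolding row[OF i] by (auto simp: z_def D_def of_nat_diff)
    qed
  next
    fix v i assume v: "\<forall>i<r+4. (\<Sum>j<r+4. N i j * v j) = 0"
      "v (if (0::nat) = 0 then 0 else 2) = 0" "v (if (1::nat) = 0 then 0 else 2) = 0" and i: "i < r + 4"
    have 0: "v 0 = 0" "v 2 = 0" using v by auto
    then have 1: "v 1 = 0" using v(1) row[of 1 v] by auto
    then have 3: "v 3 = 0" using v(1) row[of 2 v] 0 by auto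
    have "(\<Sum>j<r+4. N i j * v j) = J i * v i" if "i < r + 4" "i \<ge> 3" for i
      using v(1) that 3 by (cases "i = 3") (auto simp: J_def)
    then show "v i = 0" using tail[of v i] 0 1 3 i by blast
  qed (auto simp: z_def dest!: less_2_cases)
  have y: "pivoted_kernel (r + 4) (\<lambda>i j. N i j - (if i = j then J i else 0)) y (\<lambda>k. if k = 0 then 1 else 3)"
    unfolding pivoted_kernel_def
  proof (intro conjI allI impI)
    fix k i :: nat assume "k < 2" and i: "i < r + 4"
    then consider "k = 0" | "k = 1" by linarith
    then show "(\<Sum>j<r+4. (N i j - (if i = j then J i else 0)) * y k j) = 0"
    proof cases
      case 1 with i show ?thesis unfolding sum_pencil_row[OF i] row[OF i] by (auto simp: y_def D_def J_def of_nat_diff)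
    next
      case 2 with i show ?thesis unfolding sum_pencil_row[OF i] row[OF i] by (auto simp: y_def D_def J_def of_nat_diff)
    qed
  next
    fix v i assume v: "\<forall>i<r+4. (\<Sum>j<r+4. (N i j - (if i = j then J i else 0)) * v j) = 0"
      "v (if (0::nat) = 0 then 1 else 3) = 0" "v (if (1::nat) = 0 then 1 else 3) = 0" and i: "i < r + 4"
    have v': "(\<Sum>j<r+4. N i j * v j) = J i * v i" if "i < r + 4" for i
      using v(1) sum_pencil_row[OF that, of N J v] that by auto
    have 0: "v 1 = 0" "v 3 = 0" using v by auto
    then have 2: "v 2 = 0" using v'[of 2] row[of 2 v] by (auto simp: J_def)
    then have 1: "v 0 = 0" using v'[of 1] row[of 1 v] 0 by (auto simp: J_def)
    show "v i = 0" using tail[of v i] v' 0 1 2 i by blast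
  qed (auto simp: y_def dest!: less_2_cases)
  show ?thesis
  proof (rule low_of_subgraph_pencil[OF G f _ _ _ z y])
    show "N i j = N j i" for i j by (simp add: N_def)
    show "E (f i) (f j)" if "i < r + 4" "j < r + 4" "i < j" "N i j \<noteq> 0" for i j
      using that E(1)[of i] E(2) by (auto simp: N_def a_def split: if_splits)
    show "J i \<ge> 0" for i by (simp add: J_def)
    fix s t :: "real \<times> real \<times> real"
    assume *: "\<And>i j. i < r + 4 \<Longrightarrow> j < r + 4 \<Longrightarrow> i = j \<or> N i j \<noteq> 0 \<Longrightarrow>
         quad_form z s i j + quad_form y t i j = 0"
    \<comment> \<open>On the vertices 0 to 3 neither kernel depends on \<open>r\<close>, so seven
      entries there settle transversality for all cycles at once.\<close>
    have "N 0 1 \<noteq> 0" "N 1 2 \<noteq> 0" "N 2 3 \<noteq> 0" by (simp_all add: N_def a_def)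
    then show "s = 0 \<and> t = 0"
      using *[of 0 0] *[of 1 1] *[of 2 2] *[of 3 3] *[of 0 1] *[of 1 2] *[of 2 3]
      by (cases s; cases t) (simp add: quad_form_def z_def y_def zero_prod_def)
  qed
qed

lemma low_of_double_broom:
  assumes G: "simple_graph n E" and d: "d > 0"
    and w: "inj_on w {..d}" "w ` {..d} \<subseteq> {..<n}" "\<And>i. i < d \<Longrightarrow> E (w i) (w (Suc i))"
    and leaves: "distinct [a, b, c, e]" "set [a, b, c, e] \<subseteq> {..<n}" "set [a, b, c, e] \<inter> w ` {..d} = {}"
    and E: "E a (w 0)" "E b (w 0)" "E c (w d)" "E e (w d)"
  shows "low n E"
proof -
  define f where "f i = (if i = 0 then a else if i = 1 then b else if i = 2 then c else if i = 3 then e else w (i - 4))" for i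
  \<comment> \<open>The diagonal is 0 at the leaves 0, 1 for \<open>N\<close> and at 2, 3 for
    \<open>N - J\<close>, which forces null vectors to vanish at the respective end of the path. One
    null vector is then the difference of two leaves, the other is linear along the path. The
    entries at 4 and \<open>d + 4\<close> solve the row of 4 for \<open>y 1\<close> and the row of
    \<open>d + 4\<close> for \<open>z 1\<close>.\<close>
  define D where "D i = (if i < 2 then 0 else if i < 4 then 1 else if i = 4 then 1 / real d - 3
     else if i = d + 4 then 1 + 1 / real d else -2)" for i
  define h where "h i j = (if i < 2 then (if j = 4 then 1 else 0) else if i < 4 then (if j = d + 4 then 1 else 0)
     else if j = Suc i then 1 else 0 :: real)" for i j
  define N where "N i j = (if i = j then D i else if i < j then h i j else h j i)" for i j
  define J where "J i = (if i < 4 then 1 else 0 :: real)" for i :: nat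
  define z where "z k i = (if k = 0 then (if i = 0 then -1 else if i = 1 then 1 else 0)
     else (if i = 0 then -1 else if i = 1 then 0 else if i < 4 then - real d else real i - 4))" for k i :: nat
  define y where "y k i = (if k = 0 then (if i = 2 then -1 else if i = 3 then 1 else 0)
     else (if i < 2 then real d else if i = 2 then -1 else if i = 3 then 0 else real d + 4 - real i))" for k i :: nat
  have row: "(\<Sum>j<d+5. N i j * v j) = D i * v i + (
     if i < 2 then v 4 else if i < 4 then v (d + 4)
     else (if i = 4 then v 0 + v 1 else v (i - 1)) + (if i = d + 4 then v 2 + v 3 else v (i + 1)))"
    if i: "i < d + 5" for i v
  proof -
    consider "i < 2" | "2 \<le> i" "i < 4" | "i = 4" | "i = d + 4" | "i > 4" "i < d + 4" using i by linarith
    then show ?thesis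
    proof cases
      case 1
      have "(\<Sum>j<d+5. N i j * v j) = (\<Sum>j\<in>{i, 4}. N i j * v j)"
        using 1 by (intro sum_row) (auto simp: N_def h_def)
      with 1 show ?thesis by (simp add: N_def h_def)
    next
      case 2
      have "(\<Sum>j<d+5. N i j * v j) = (\<Sum>j\<in>{i, d + 4}. N i j * v j)"
        using 2 d by (intro sum_row) (auto simp: N_def h_def)
      with 2 show ?thesis by (simp add: N_def h_def)
    next
      case 3
      have "(\<Sum>j<d+5. N i j * v j) = (\<Sum>j\<in>{0, 1, 4, 5}. N i j * v j)"
        using 3 d by (intro sum_row) (auto simp: N_def h_def)
      with 3 d show ?thesis by (simp add: N_def h_def)
    next
      case 4
      have "(\<Sum>j<d+5. N i j * v j) = (\<Sum>j\<in>{2, 3, d + 3, d + 4}. N i j * v j)"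
        using 4 d by (intro sum_row) (auto simp: N_def h_def)
      with 4 d show ?thesis by (simp add: N_def h_def add.commute)
    next
      case 5
      have "(\<Sum>j<d+5. N i j * v j) = (\<Sum>j\<in>{i - 1, i, i + 1}. N i j * v j)"
        using 5 by (intro sum_row) (auto simp: N_def h_def)
      with 5 show ?thesis by (cases i) (auto simp: N_def h_def)
    qed
  qed
  have inner: "v (i - 1) - 2 * v i + v (i + 1) = 0"
    if "(\<Sum>j<d+5. N i j * v j) = J i * v i" "4 < i" "i < d + 4" for v i
    using that row[of i v] by (simp add: D_def J_def)
  have z: "pivoted_kernel (d + 5) N z (\<lambda>k. if k = 0 then 1 else 5)"
    unfolding pivoted_kernel_def
  proof (intro conjI allI impI)
    fix k i :: nat assume "k < 2" and i: "i < d + 5"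
    then consider "k = 0" | "k = 1" by linarith
    then show "(\<Sum>j<d+5. N i j * z k j) = 0"
    proof cases
      case 1 with i d show ?thesis unfolding row[OF i] by (auto simp: z_def D_def of_nat_diff)
    next
      case 2 with i d show ?thesis unfolding row[OF i] by (auto simp: z_def D_def of_nat_diff field_simps)
    qed
  next
    fix v i assume v: "\<forall>i<d+5. (\<Sum>j<d+5. N i j * v j) = 0"
      "v (if (0::nat) = 0 then 1 else 5) = 0" "v (if (1::nat) = 0 then 1 else 5) = 0" and i: "i < d + 5"
    have 1: "v 1 = 0" "v 5 = 0" using v by auto
    have 4: "v 4 = 0" using v(1) row[of 0 v] by (auto simp: D_def)
    have 0: "v 0 = 0" using v(1) row[of 4 v] 4 1 d by auto
    have w: "v (k + 4) = 0 \<and> v (k + 5) = 0" if "k < d" for k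
      using that
    proof (induction k)
      case (Suc k)
      have "v (k + 5 - 1) - 2 * v (k + 5) + v (k + 5 + 1) = 0"
        by (rule inner) (use v(1) Suc(2) in \<open>auto simp: J_def\<close>)
      moreover have "k + 5 - 1 = k + 4" "k + 5 + 1 = k + 6" "Suc k + 4 = k + 5" "Suc k + 5 = k + 6" by auto
      moreover have "v (k + 4) = 0 \<and> v (k + 5) = 0" using Suc by auto
      ultimately show ?case by (metis add.left_neutral diff_0_right diff_self mult_zero_right)
    qed (use 4 1 in auto)
    have "v (d + 4) = 0" using w[of "d - 1"] d by (simp add: numeral_eq_Suc)
    then have 23: "v 2 = 0" "v 3 = 0" using v(1) row[of 2 v] row[of 3 v] by (auto simp: D_def)
    show "v i = 0"
    proof (cases "i < 5")
      case True
      then have "i = 0 \<or> i = 1 \<or> i = 2 \<or> i = 3 \<or> i = 4" by linarith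
      then show ?thesis using 0 1 4 23 by auto
    next
      case False
      then show ?thesis using w[of "i - 5"] i by auto
    qed
  qed (use d in \<open>auto simp: z_def dest!: less_2_cases\<close>)
  have y: "pivoted_kernel (d + 5) (\<lambda>i j. N i j - (if i = j then J i else 0)) y (\<lambda>k. if k = 0 then 3 else d + 3)"
    unfolding pivoted_kernel_def
  proof (intro conjI allI impI)
    fix k i :: nat assume "k < 2" and i: "i < d + 5"
    then consider "k = 0" | "k = 1" by linarith
    then show "(\<Sum>j<d+5. (N i j - (if i = j then J i else 0)) * y k j) = 0"
    proof cases
      case 1 with i d show ?thesis
        unfolding sum_pencil_row[OF i] row[OF i] by (auto simp: y_def D_def J_def of_nat_diff)
    next
      case 2 with i d show ?thesis
        unfolding sum_pencil_row[OF i] row[OF i] by (auto simp: y_def D_def J_def of_nat_diff field_simps)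
    qed
  next
    fix v i assume v: "\<forall>i<d+5. (\<Sum>j<d+5. (N i j - (if i = j then J i else 0)) * v j) = 0"
      "v (if (0::nat) = 0 then 3 else d + 3) = 0" "v (if (1::nat) = 0 then 3 else d + 3) = 0" and i: "i < d + 5"
    have v': "(\<Sum>j<d+5. N i j * v j) = J i * v i" if "i < d + 5" for i
      using v(1) sum_pencil_row[OF that, of N J v] that by auto
    have 1: "v 3 = 0" "v (d + 3) = 0" using v by auto
    have 4: "v (d + 4) = 0" using v'[of 2] row[of 2 v] by (auto simp: D_def J_def)
    have "v (3 + d) = v (d + 3)" by (rule arg_cong[of _ _ v]) simp
    then have 0: "v 2 = 0" using v'[of "d + 4"] row[of "d + 4" v] 4 1 d by (auto simp: J_def)
    have w: "v (d + 4 - k) = 0 \<and> v (d + 3 - k) = 0" if "k < d" for k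
      using that
    proof (induction k)
      case (Suc k)
      have "d + 3 - k - 1 = d + 3 - Suc k" "d + 3 - k + 1 = d + 4 - k" "d + 4 - Suc k = d + 3 - k"
        using Suc(2) by auto
      then show ?case
        using inner[of "d + 3 - k" v] v'[of "d + 3 - k"] Suc by auto
    qed (use 4 1 in auto)
    have w0: "v 4 = 0" using w[of "d - 1"] d by simp
    then have wa: "v 0 = 0" "v 1 = 0" using v'[of 0] row[of 0 v] v'[of 1] row[of 1 v] by (auto simp: D_def J_def)
    show "v i = 0"
    proof (cases "i < 5")
      case True
      then have "i = 0 \<or> i = 1 \<or> i = 2 \<or> i = 3 \<or> i = 4" by linarith
      then show ?thesis using 0 1 w0 wa by auto
    next
      case False
      then have "d + 4 - i < d" "d + 4 - (d + 4 - i) = i" using i d by auto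
      then show ?thesis using w[of "d + 4 - i"] by auto
    qed
  qed (use d in \<open>auto simp: y_def dest!: less_2_cases\<close>)
  have small: "i = 0 \<or> i = 1 \<or> i = 2 \<or> i = 3 \<or> 4 \<le> i" for i :: nat by linarith
  have inj: "inj_on f {..<d+5}"
  proof (rule inj_onI)
    fix i j assume ij: "i \<in> {..<d+5}" "j \<in> {..<d+5}" "f i = f j"
    have wf: "f k = w (k - 4)" "f k \<in> w ` {..d}" if "4 \<le> k" "k \<in> {..<d+5}" for k
      using that by (auto simp: f_def)
    show "i = j"
    proof (cases "4 \<le> i \<and> 4 \<le> j")
      case True
      then have "i - 4 = j - 4" using w(1) wf ij by (auto dest!: inj_onD)
      with True show ?thesis by linarith
    next
      case False
      with ij small[of i] small[of j] leaves(1,3) wf[of i] wf[of j] show ?thesis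
        by (elim disjE) (simp_all add: f_def)
    qed
  qed
  have ran: "f ` {..<d+5} \<subseteq> {..<n}"
  proof
    have wn: "w k < n" if "k \<le> d" for k using w(2) that by auto
    fix x assume "x \<in> f ` {..<d+5}"
    then obtain i where "i < d + 5" "x = f i" by auto
    then show "x \<in> {..<n}"
      using leaves(2) wn[of "i - 4"] small[of i] by (cases "4 \<le> i") (auto simp: f_def)
  qed
  show ?thesis
  proof (rule low_of_subgraph_pencil[OF G inj ran _ _ _ z y])
    show "N i j = N j i" for i j by (simp add: N_def)
    show "E (f i) (f j)" if "i < d + 5" "j < d + 5" "i < j" "N i j \<noteq> 0" for i j
    proof -
      have "w (Suc (i - 4)) = w (i - 3)" if "4 \<le> i"
        using that by (intro arg_cong[of _ _ w]) linarith
      then show ?thesis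
        using that w(3)[of "i - 4"] E small[of i]
        by (auto simp: N_def h_def f_def split: if_splits)
    qed
    show "J i \<ge> 0" for i by (simp add: J_def)
    fix s t :: "real \<times> real \<times> real"
    assume *: "\<And>i j. i < d + 5 \<Longrightarrow> j < d + 5 \<Longrightarrow> i = j \<or> N i j \<noteq> 0 \<Longrightarrow>
         quad_form z s i j + quad_form y t i j = 0"
    \<comment> \<open>At vertex 4 only \<open>y 1\<close> is nonzero, at \<open>d + 4\<close> only
      \<open>z 1\<close>. With these two coefficients gone, the diagonal entries at the leaves give
      the rest.\<close>
    have "snd (snd t) = 0" using *[of 4 4] d by (simp add: quad_form_def z_def y_def)
    moreover have "snd (snd s) = 0" using *[of "d+4" "d+4"] d by (simp add: quad_form_def z_def y_def)
    ultimately show "s = 0 \<and> t = 0"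
      using *[of 0 0] *[of 1 1] *[of 2 2] *[of 3 3]
      by (cases s; cases t) (simp add: quad_form_def z_def y_def zero_prod_def)
  qed
qed

text \<open>The pencil is symmetric in the three legs. The block of a leg is [[1,1],[1,1]] with null
  vector (1,-1); subtracting the mass 2 gives [[-1,1],[1,-1]] with null vector (1,1). The kernels
  are these vectors times leg coefficients of sum zero, which satisfy the row of the centre.\<close>

lemma low_of_spider:
  assumes G: "simple_graph n E"
    and vs: "distinct [v, a, b, c, a', b', c']" "set [v, a, b, c, a', b', c'] \<subseteq> {..<n}"
    and E: "E v a" "E v b" "E v c" "E a a'" "E b b'" "E c c'"
  shows "low n E"
proof -
  define R :: "real list list" where "R = [[0, 1, 1, 1, 0, 0, 0],
      [1, 1, 0, 0, 1, 0, 0],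
      [1, 0, 1, 0, 0, 1, 0],
      [1, 0, 0, 1, 0, 0, 1],
      [0, 1, 0, 0, 1, 0, 0],
      [0, 0, 1, 0, 0, 1, 0],
      [0, 0, 0, 1, 0, 0, 1]]"
  define J :: "real list" where "J = [0, 2, 2, 2, 2, 2, 2]"
  define Z :: "real list list" where "Z = [[0, -1, 1, 0, 1, -1, 0], [0, -1, 0, 1, 1, 0, -1]]"
  define Y :: "real list list" where "Y = [[0, -1, 1, 0, -1, 1, 0], [0, -1, 0, 1, -1, 0, 1]]"
  note expand = numeral_eq_Suc All_less_Suc lessThan_Suc
  have z: "pivoted_kernel 7 (\<lambda>i j. R ! i ! j) (\<lambda>k i. Z ! k ! i) (\<lambda>k. [2, 3] ! k)"
    unfolding pivoted_kernel_def
  proof (intro conjI)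
    show "\<forall>v. (\<forall>i<7. (\<Sum>j<7. R ! i ! j * v j) = 0) \<longrightarrow> v ([2, 3] ! 0) = 0 \<longrightarrow> v ([2, 3] ! 1) = 0 \<longrightarrow> (\<forall>i<7. v i = 0)"
      unfolding R_def by (simp add: expand)
  qed (simp_all add: R_def Z_def expand)
  have y: "pivoted_kernel 7 (\<lambda>i j. R ! i ! j - (if i = j then J ! i else 0)) (\<lambda>k i. Y ! k ! i) (\<lambda>k. [2, 3] ! k)"
    unfolding pivoted_kernel_def
  proof (intro conjI)
    show "\<forall>v. (\<forall>i<7. (\<Sum>j<7. (R ! i ! j - (if i = j then J ! i else 0)) * v j) = 0) \<longrightarrow>
      v ([2, 3] ! 0) = 0 \<longrightarrow> v ([2, 3] ! 1) = 0 \<longrightarrow> (\<forall>i<7. v i = 0)"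
      unfolding R_def J_def by (simp add: expand)
  qed (simp_all add: R_def J_def Y_def expand)
  show ?thesis
  proof (rule low_of_subgraph_pencil[OF G _ _ _ _ _ z y])
    show "inj_on (\<lambda>i. [v, a, b, c, a', b', c'] ! i) {..<7}" using vs(1) by (intro inj_on_nth) auto
    show "(\<lambda>i. [v, a, b, c, a', b', c'] ! i) ` {..<7} \<subseteq> {..<n}"
      using vs(2) by (auto simp: expand)
    show "R ! i ! j = R ! j ! i" if "i < 7" "j < 7" for i j
    proof -
      have "\<forall>i<7. \<forall>j<7. R ! i ! j = R ! j ! i" by (simp add: R_def expand)
      with that show ?thesis by blast
    qed
    show "E ([v, a, b, c, a', b', c'] ! i) ([v, a, b, c, a', b', c'] ! j)" if "i < 7" "j < 7" "i < j" "R ! i ! j \<noteq> 0" for i j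
    proof -
      have "\<forall>i<7. \<forall>j<7. i < j \<and> R ! i ! j \<noteq> 0 \<longrightarrow> E ([v, a, b, c, a', b', c'] ! i) ([v, a, b, c, a', b', c'] ! j)"
        using E by (simp add: R_def expand)
      with that show ?thesis by blast
    qed
    show "0 \<le> J ! i" if "i < 7" for i
    proof -
      have "\<forall>i<7. 0 \<le> J ! i" by (simp add: J_def expand)
      with that show ?thesis by blast
    qed
    fix s t :: "real \<times> real \<times> real"
    assume *: "\<And>i j. i < 7 \<Longrightarrow> j < 7 \<Longrightarrow> i = j \<or> R ! i ! j \<noteq> 0 \<Longrightarrow>
         quad_form (\<lambda>k i. Z ! k ! i) s i j + quad_form (\<lambda>k i. Y ! k ! i) t i j = 0"
    \<comment> \<open>Diagonal entries contain the sum of the two quadratic forms, leg edges their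
      difference. So each form vanishes on the three coefficient vectors of the legs, and three
      values determine it.\<close>
    show "s = 0 \<and> t = 0"
      using *[of 0 0] *[of 1 1] *[of 2 2] *[of 3 3] *[of 4 4] *[of 5 5] *[of 6 6] *[of 0 1] *[of 0 2] *[of 0 3] *[of 1 4] *[of 2 5] *[of 3 6]
      by (cases s; cases t) (simp add: R_def Z_def Y_def quad_form_def zero_prod_def eval_nat_numeral)
  qed
qed

text \<open>On coefficients of sum zero the triangle block, identity plus all-ones, acts as the
  identity. Each leg therefore sees the same blocks as in the spider.\<close>

lemma low_of_net:
  assumes G: "simple_graph n E"
    and vs: "distinct [a, b, c, a', b', c']" "set [a, b, c, a', b', c'] \<subseteq> {..<n}"
    and E: "E a b" "E a c" "E b c" "E a a'" "E b b'" "E c c'"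
  shows "low n E"
proof -
  define R :: "real list list" where "R = [[2, 1, 1, 1, 0, 0],
      [1, 2, 1, 0, 1, 0],
      [1, 1, 2, 0, 0, 1],
      [1, 0, 0, 1, 0, 0],
      [0, 1, 0, 0, 1, 0],
      [0, 0, 1, 0, 0, 1]]"
  define J :: "real list" where "J = [2, 2, 2, 2, 2, 2]"
  define Z :: "real list list" where "Z = [[-1, 1, 0, 1, -1, 0], [-1, 0, 1, 1, 0, -1]]"
  define Y :: "real list list" where "Y = [[-1, 1, 0, -1, 1, 0], [-1, 0, 1, -1, 0, 1]]"
  note expand = numeral_eq_Suc All_less_Suc lessThan_Suc
  have z: "pivoted_kernel 6 (\<lambda>i j. R ! i ! j) (\<lambda>k i. Z ! k ! i) (\<lambda>k. [1, 2] ! k)"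
    unfolding pivoted_kernel_def
  proof (intro conjI)
    show "\<forall>v. (\<forall>i<6. (\<Sum>j<6. R ! i ! j * v j) = 0) \<longrightarrow> v ([1, 2] ! 0) = 0 \<longrightarrow> v ([1, 2] ! 1) = 0 \<longrightarrow> (\<forall>i<6. v i = 0)"
      unfolding R_def by (simp add: expand)
  qed (simp_all add: R_def Z_def expand)
  have y: "pivoted_kernel 6 (\<lambda>i j. R ! i ! j - (if i = j then J ! i else 0)) (\<lambda>k i. Y ! k ! i) (\<lambda>k. [1, 2] ! k)"
    unfolding pivoted_kernel_def
  proof (intro conjI)
    show "\<forall>v. (\<forall>i<6. (\<Sum>j<6. (R ! i ! j - (if i = j then J ! i else 0)) * v j) = 0) \<longrightarrow>
      v ([1, 2] ! 0) = 0 \<longrightarrow> v ([1, 2] ! 1) = 0 \<longrightarrow> (\<forall>i<6. v i = 0)"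
      unfolding R_def J_def by (simp add: expand)
  qed (simp_all add: R_def J_def Y_def expand)
  show ?thesis
  proof (rule low_of_subgraph_pencil[OF G _ _ _ _ _ z y])
    show "inj_on (\<lambda>i. [a, b, c, a', b', c'] ! i) {..<6}" using vs(1) by (intro inj_on_nth) auto
    show "(\<lambda>i. [a, b, c, a', b', c'] ! i) ` {..<6} \<subseteq> {..<n}"
      using vs(2) by (auto simp: expand)
    show "R ! i ! j = R ! j ! i" if "i < 6" "j < 6" for i j
    proof -
      have "\<forall>i<6. \<forall>j<6. R ! i ! j = R ! j ! i" by (simp add: R_def expand)
      with that show ?thesis by blast
    qed
    show "E ([a, b, c, a', b', c'] ! i) ([a, b, c, a', b', c'] ! j)" if "i < 6" "j < 6" "i < j" "R ! i ! j \<noteq> 0" for i j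
    proof -
      have "\<forall>i<6. \<forall>j<6. i < j \<and> R ! i ! j \<noteq> 0 \<longrightarrow> E ([a, b, c, a', b', c'] ! i) ([a, b, c, a', b', c'] ! j)"
        using E by (simp add: R_def expand)
      with that show ?thesis by blast
    qed
    show "0 \<le> J ! i" if "i < 6" for i
    proof -
      have "\<forall>i<6. 0 \<le> J ! i" by (simp add: J_def expand)
      with that show ?thesis by blast
    qed
    fix s t :: "real \<times> real \<times> real"
    assume *: "\<And>i j. i < 6 \<Longrightarrow> j < 6 \<Longrightarrow> i = j \<or> R ! i ! j \<noteq> 0 \<Longrightarrow>
         quad_form (\<lambda>k i. Z ! k ! i) s i j + quad_form (\<lambda>k i. Y ! k ! i) t i j = 0"
    show "s = 0 \<and> t = 0"
      using *[of 0 0] *[of 1 1] *[of 2 2] *[of 3 3] *[of 4 4] *[of 5 5] *[of 0 1] *[of 0 2] *[of 1 2] *[of 0 3] *[of 1 4] *[of 2 5]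
      by (cases s; cases t) (simp add: R_def Z_def Y_def quad_form_def zero_prod_def eval_nat_numeral)
  qed
qed

text \<open>For \<open>N\<close>, the zero diagonal at \<open>c\<close>, \<open>d\<close> forces the
  value 0 at \<open>v\<close>, the values at \<open>a\<close>, \<open>b\<close> agree, and only the
  row of \<open>v\<close> is left. For \<open>N - J\<close>, the values at \<open>a\<close>,
  \<open>b\<close> add up to that at \<open>v\<close>, and those at \<open>c\<close>,
  \<open>d\<close> are half of it; the entry -2 makes the row of \<open>v\<close> redundant.\<close>

lemma low_of_campstool:
  assumes G: "simple_graph n E"
    and vs: "distinct [v, a, b, c, d]" "set [v, a, b, c, d] \<subseteq> {..<n}"
    and E: "E v a" "E v b" "E v c" "E v d" "E a b"
  shows "low n E"
proof -
  define R :: "real list list" where "R = [[-2, 1, 1, 1, 1],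
      [1, 1, -1, 0, 0],
      [1, -1, 1, 0, 0],
      [1, 0, 0, 0, 0],
      [1, 0, 0, 0, 0]]"
  define J :: "real list" where "J = [0, 2, 2, 2, 2]"
  define Z :: "real list list" where "Z = [[0, 1, 1, -2, 0], [0, 0, 0, -1, 1]]"
  define Y :: "real list list" where "Y = [[0, 1, -1, 0, 0], [2, 0, 2, 1, 1]]"
  note expand = numeral_eq_Suc All_less_Suc lessThan_Suc
  have z: "pivoted_kernel 5 (\<lambda>i j. R ! i ! j) (\<lambda>k i. Z ! k ! i) (\<lambda>k. [1, 4] ! k)"
    unfolding pivoted_kernel_def
  proof (intro conjI)
    show "\<forall>v. (\<forall>i<5. (\<Sum>j<5. R ! i ! j * v j) = 0) \<longrightarrow> v ([1, 4] ! 0) = 0 \<longrightarrow> v ([1, 4] ! 1) = 0 \<longrightarrow> (\<forall>i<5. v i = 0)"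
      unfolding R_def by (simp add: expand)
  qed (simp_all add: R_def Z_def expand)
  have y: "pivoted_kernel 5 (\<lambda>i j. R ! i ! j - (if i = j then J ! i else 0)) (\<lambda>k i. Y ! k ! i) (\<lambda>k. [1, 3] ! k)"
    unfolding pivoted_kernel_def
  proof (intro conjI)
    show "\<forall>v. (\<forall>i<5. (\<Sum>j<5. (R ! i ! j - (if i = j then J ! i else 0)) * v j) = 0) \<longrightarrow>
      v ([1, 3] ! 0) = 0 \<longrightarrow> v ([1, 3] ! 1) = 0 \<longrightarrow> (\<forall>i<5. v i = 0)"
      unfolding R_def J_def by (simp add: expand)
  qed (simp_all add: R_def J_def Y_def expand)
  show ?thesis
  proof (rule low_of_subgraph_pencil[OF G _ _ _ _ _ z y])
    show "inj_on (\<lambda>i. [v, a, b, c, d] ! i) {..<5}" using vs(1) by (intro inj_on_nth) auto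
    show "(\<lambda>i. [v, a, b, c, d] ! i) ` {..<5} \<subseteq> {..<n}"
      using vs(2) by (auto simp: expand)
    show "R ! i ! j = R ! j ! i" if "i < 5" "j < 5" for i j
    proof -
      have "\<forall>i<5. \<forall>j<5. R ! i ! j = R ! j ! i" by (simp add: R_def expand)
      with that show ?thesis by blast
    qed
    show "E ([v, a, b, c, d] ! i) ([v, a, b, c, d] ! j)" if "i < 5" "j < 5" "i < j" "R ! i ! j \<noteq> 0" for i j
    proof -
      have "\<forall>i<5. \<forall>j<5. i < j \<and> R ! i ! j \<noteq> 0 \<longrightarrow> E ([v, a, b, c, d] ! i) ([v, a, b, c, d] ! j)"
        using E by (simp add: R_def expand)
      with that show ?thesis by blast
    qed
    show "0 \<le> J ! i" if "i < 5" for i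
    proof -
      have "\<forall>i<5. 0 \<le> J ! i" by (simp add: J_def expand)
      with that show ?thesis by blast
    qed
    fix s t :: "real \<times> real \<times> real"
    assume *: "\<And>i j. i < 5 \<Longrightarrow> j < 5 \<Longrightarrow> i = j \<or> R ! i ! j \<noteq> 0 \<Longrightarrow>
         quad_form (\<lambda>k i. Z ! k ! i) s i j + quad_form (\<lambda>k i. Y ! k ! i) t i j = 0"
    show "s = 0 \<and> t = 0"
      using *[of 0 0] *[of 1 1] *[of 2 2] *[of 3 3] *[of 4 4] *[of 0 1] *[of 0 2] *[of 0 3] *[of 0 4] *[of 1 2]
      by (cases s; cases t) (simp add: R_def Z_def Y_def quad_form_def zero_prod_def eval_nat_numeral)
  qed
qed

section \<open>The strong spectral property of a path with a chord or a leaf\<close>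

text \<open>Matrices are indexed by the integers and vanish outside the window 0, ..., n - 1, so that no
  boundary cases arise.  Consecutive vertices are adjacent, except possibly c + 1 and c + 2; the
  only further edge joins c and c + 2.  Without the edge from c + 1 to c + 2, the vertex c + 1 is a
  leaf attached to a path; for large c the graph is a path.\<close>

locale path_with_chord =
  fixes A X :: "int \<Rightarrow> int \<Rightarrow> real" and n c :: int
  assumes c0: "0 \<le> c"
    and A_sym: "A i j = A j i" and X_sym: "X i j = X j i"
    and X_out: "\<not> (0 \<le> i \<and> i < n) \<Longrightarrow> X i j = 0"
    and A_zero: "i < j \<Longrightarrow> j \<noteq> i + 1 \<Longrightarrow> \<not> (i = c \<and> j = c + 2) \<Longrightarrow> A i j = 0"
    and A_path: "0 \<le> i \<Longrightarrow> i + 1 < n \<Longrightarrow> i \<noteq> c + 1 \<Longrightarrow> A i (i + 1) \<noteq> 0"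
    and A_chord: "c + 2 < n \<Longrightarrow> A c (c + 2) \<noteq> 0"
    and AX: "A i j * X i j = 0" and X_diag: "X i i = 0"
    and commute: "(\<Sum>k\<in>{0..<n}. A i k * X k j) = (\<Sum>k\<in>{0..<n}. X i k * A k j)"
begin

lemma row: "(\<Sum>k\<in>{0..<n}. A i k * X k j) = A (i - 1) i * X (i - 1) j + A i i * X i j
  + A i (i + 1) * X (i + 1) j + (if i = c then A c (c + 2) * X (c + 2) j else 0)
  + (if i = c + 2 then A c (c + 2) * X c j else 0)"
proof -
  have single: "(\<Sum>k\<in>{0..<n}. if k = a then \<alpha> * X k j else 0) = \<alpha> * X a j" for a \<alpha>
    using X_out[of a j] by auto
  have "(\<Sum>k\<in>{0..<n}. A i k * X k j) = (\<Sum>k\<in>{0..<n}. (if k = i - 1 then A (i - 1) i * X k j else 0)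
    + (if k = i then A i i * X k j else 0) + (if k = i + 1 then A i (i + 1) * X k j else 0)
    + (if k = c + 2 then (if i = c then A c (c + 2) else 0) * X k j else 0)
    + (if k = c then (if i = c + 2 then A c (c + 2) else 0) * X k j else 0))"
  proof (intro sum.cong refl)
    fix k
    consider "k = i - 1" | "k = i" | "k = i + 1" | "i = c" "k = c + 2" | "i = c + 2" "k = c"
      | "k \<noteq> i - 1" "k \<noteq> i" "k \<noteq> i + 1" "\<not> (i = c \<and> k = c + 2)" "\<not> (i = c + 2 \<and> k = c)" by blast
    then show "A i k * X k j = (if k = i - 1 then A (i - 1) i * X k j else 0)
    + (if k = i then A i i * X k j else 0) + (if k = i + 1 then A i (i + 1) * X k j else 0)
    + (if k = c + 2 then (if i = c then A c (c + 2) else 0) * X k j else 0)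
    + (if k = c then (if i = c + 2 then A c (c + 2) else 0) * X k j else 0)"
    proof cases
      case 6
      then have "A i k = 0" using A_zero[of i k] A_zero[of k i] A_sym[of i k] by (cases "i < k") auto
      with 6 show ?thesis by auto
    qed (auto simp: A_sym[of i "i - 1"] A_sym[of "c + 2" c])
  qed
  then show ?thesis unfolding sum.distrib single by simp
qed

text \<open>The commutation relation at \<open>(i, j)\<close> compares entries of \<open>X\<close>
  at neighbours of \<open>i\<close> with those at neighbours of \<open>j\<close>. If all terms but
  one are known to vanish and that one carries an edge, its entry of \<open>X\<close> vanishes; this
  is the main mechanism below.\<close>

lemma entry: "A (i - 1) i * X (i - 1) j + A i i * X i j
  + A i (i + 1) * X (i + 1) j + (if i = c then A c (c + 2) * X (c + 2) j else 0)
  + (if i = c + 2 then A c (c + 2) * X c j else 0) =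
  A (j - 1) j * X i (j - 1) + A j j * X i j
  + A j (j + 1) * X i (j + 1) + (if j = c then A c (c + 2) * X i (c + 2) else 0)
  + (if j = c + 2 then A c (c + 2) * X i c else 0)"
proof -
  have "X i k * A k j = A j k * X k i" for k using A_sym[of k j] X_sym[of i k] by simp
  then have "(\<Sum>k\<in>{0..<n}. A i k * X k j) = (\<Sum>k\<in>{0..<n}. A j k * X k i)"
    using commute[of i j] by simp
  then show ?thesis
    unfolding row[of i j] row[of j i] X_sym[of "j - 1" i] X_sym[of j i] X_sym[of "j + 1" i] X_sym[of "c + 2" i] X_sym[of c i] .
qed

text \<open>Neighbouring indices enter through equations, so that instances show \<open>i\<close>
  rather than \<open>i + 1 - 1\<close>.\<close>

lemma entry_at:
  assumes "i1 = i - 1" "i2 = i + 1" "j1 = j - 1" "j2 = j + 1"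
  shows "A i1 i * X i1 j + A i i * X i j
    + A i i2 * X i2 j + (if i = c then A c (c + 2) * X (c + 2) j else 0)
    + (if i = c + 2 then A c (c + 2) * X c j else 0) =
    A j1 j * X i j1 + A j j * X i j
    + A j j2 * X i j2 + (if j = c then A c (c + 2) * X i (c + 2) else 0)
    + (if j = c + 2 then A c (c + 2) * X i c else 0)"
  using entry[of i j] unfolding assms .

lemma X_out2: "\<not> (0 \<le> j \<and> j < n) \<Longrightarrow> X i j = 0"
  using X_out[of j i] X_sym by auto

lemma X_step: "X i (i + 1) = 0" if "i \<noteq> c + 1"
  using that AX[of i "i + 1"] A_path[of i] X_out[of i "i + 1"] X_out2[of "i + 1" i] by fastforce

lemma X_chord: "X c (c + 2) = 0"
  using AX[of c "c + 2"] A_chord X_out2[of "c + 2" c] by fastforce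

text \<open>The relation at \<open>(k, k + 1)\<close> links \<open>X (k - 1) (k + 1)\<close> to
  \<open>X k (k + 2)\<close>. The chain begins outside the window, where \<open>X\<close> is zero,
  and stops before the chord interferes.\<close>

lemma X_two_left: "X i (i + 2) = 0" if "i + 2 \<le> c"
proof -
  have "X (int k - 1) (int k + 1) = 0" if "int k + 1 \<le> c" for k
    using that
  proof (induction k)
    case (Suc k)
    have "A (int k + 1) (int k + 2) * X (int k) (int k + 2) = 0"
      using entry_at[of "int k - 1" "int k" "int k + 1" "int k" "int k + 1" "int k + 2"] Suc X_step[of "int k"] X_diag
      by auto
    moreover have "A (int k + 1) (int k + 2) \<noteq> 0" if "int k + 2 < n"
      using A_path[of "int k + 1"] Suc(2) that by (simp add: add.assoc)
    ultimately have "X (int k) (int k + 2) = 0"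
      using X_out2[of "int k + 2" "int k"] by auto
    moreover have "int (Suc k) - 1 = int k" "int (Suc k) + 1 = int k + 2" by auto
    ultimately show ?case by metis
  qed (use X_out in auto)
  note * = this[of "nat (i + 1)"]
  show ?thesis
  proof (cases "i < 0")
    case False
    then have eq: "int (nat (i + 1)) - 1 = i" "int (nat (i + 1)) + 1 = i + 2" by auto
    show ?thesis using *[unfolded eq] that by blast
  qed (use X_out in auto)
qed

lemma X_two_right_step:
  assumes a2: "c + 2 \<le> a" and ih: "X (a + 1) (a + 3) = 0" and x: "X (a + 1) (a + 2) = 0"
  shows "A a (a + 1) * X a (a + 2) = 0"
proof -
  have ne: "a + 1 \<noteq> c" "a + 1 \<noteq> c + 2" "a + 2 \<noteq> c" "a + 2 \<noteq> c + 2" using a2 by auto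
  have eq: "a = a + 1 - 1" "a + 2 = a + 1 + 1" "a + 1 = a + 2 - 1" "a + 3 = a + 2 + 1" by auto
  show ?thesis
    using entry_at[OF eq]
    unfolding ih x X_diag if_not_P[OF ne(1)] if_not_P[OF ne(2)] if_not_P[OF ne(3)] if_not_P[OF ne(4)]
      mult_zero_right add_0_left add_0_right .
qed

text \<open>The mirror image: the chain begins beyond the right end and descends to
  \<open>c + 2\<close>.\<close>

lemma X_two_right: "X i (i + 2) = 0" if "c + 2 \<le> i"
proof (cases "i + 2 < n")
  case True
  have "X (n - int k) (n - int k + 2) = 0" if "c + 2 \<le> n - int k" for k
    using that
  proof (induction k)
    case (Suc k)
    define a where "a = n - int (Suc k)"
    have a: "n - int k = a + 1" "n - int k + 2 = a + 3" by (auto simp: a_def)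
    have "c + 2 \<le> n - int k" using Suc(2) by simp
    then have "X (a + 1) (a + 1 + 2) = 0" using Suc(1) unfolding a(1) by blast
    moreover have e: "a + 3 = a + 1 + 2" by simp
    ultimately have ih: "X (a + 1) (a + 3) = 0" unfolding e by blast
    have a2: "c + 2 \<le> a" using Suc(2) by (simp add: a_def)
    have e: "a + 2 = a + 1 + 1" by simp
    have "X (a + 1) (a + 2) = 0" unfolding e by (rule X_step) (use a2 in simp)
    then have "A a (a + 1) * X a (a + 2) = 0" using X_two_right_step[OF a2 ih] by blast
    moreover have "A a (a + 1) \<noteq> 0" if "a + 2 < n" using A_path[of a] that a2 c0 by simp
    ultimately have "X a (a + 2) = 0" using X_out2[of "a + 2" a] by auto
    then show ?case unfolding a_def .
  qed (use X_out in auto)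
  note * = this[of "nat (n - i)"]
  have eq: "n - int (nat (n - i)) = i" using True by simp
  show ?thesis using *[unfolded eq] that by blast
qed (use X_out2 in auto)

text \<open>The entry matters when \<open>c + 1\<close> is a leaf. Then \<open>c + 1\<close> and
  \<open>c + 2\<close> are non-adjacent neighbours of \<open>c\<close>, and no chain along the path
  determines the entry. The relations between \<open>c\<close> and \<open>c - 1\<close>,
  \<open>c + 1\<close>, \<open>c + 2\<close> give three equations for the entries among these
  neighbours.\<close>

lemma X_twins: "X (c + 1) (c + 2) = 0"
proof (cases "A (c + 1) (c + 2) = 0 \<and> c + 2 < n")
  case False
  then show ?thesis using AX[of "c + 1" "c + 2"] X_out2[of "c + 2" "c + 1"] by auto
next
  case True
  define p q r where "p = A (c - 1) c" and "q = A c (c + 1)" and "r = A c (c + 2)"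
  define x y w where "x = X (c - 1) (c + 1)" and "y = X (c - 1) (c + 2)" and "w = X (c + 1) (c + 2)"
  have q: "q \<noteq> 0" and r: "r \<noteq> 0" using True A_path[of c] A_chord c0 by (auto simp: q_def r_def)
  have s: "X (c + 2) (c + 1) = w" "X (c + 1) (c - 1) = x" "X (c + 2) (c - 1) = y"
    unfolding x_def y_def w_def by (rule X_sym)+
  have 1: "p * x + r * w = 0"
    using entry_at[of "c - 1" c "c + 1" c "c + 1" "c + 2"] True X_step[of c] X_diag by (auto simp: p_def x_def r_def s[symmetric])
  have "X (c - 2) c = 0" using X_two_left[of "c - 2"] by simp
  then have "X c (c - 2) = 0" using X_sym by metis
  moreover have "X c (c - 1) = 0" using X_step[of "c - 1"] X_sym[of c] by simp
  ultimately have 2: "q * x + r * y = 0"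
    using entry_at[of "c - 1" c "c + 1" "c - 2" "c - 1" c] X_diag by (auto simp: q_def r_def s)
  have e: "c + 4 = c + 2 + 2" "c + 3 = c + 2 + 1" by simp_all
  have "X (c + 2) (c + 4) = 0" unfolding e by (rule X_two_right) simp
  moreover have "X (c + 2) (c + 3) = 0" unfolding e by (rule X_step) simp
  ultimately have zero: "X (c + 2) (c + 4) = 0" "X (c + 2) (c + 3) = 0" .
  have eq: "c + 1 = c + 2 - 1" "c + 3 = c + 2 + 1" "c + 2 = c + 3 - 1" "c + 4 = c + 3 + 1" by auto
  have cond: "(c + 2 = c) = False" "(c + 3 = c) = False" "(c + 3 = c + 2) = False" by auto
  have "r * X c (c + 3) = 0"
    using entry_at[OF eq] unfolding zero X_diag cond True[THEN conjunct1] simp_thms if_True if_False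
      mult_zero_left mult_zero_right add_0_left add_0_right r_def .
  then have "X c (c + 3) = 0" using r by simp
  then have 3: "p * y + q * w = 0"
    using entry_at[of "c - 1" c "c + 1" "c + 1" "c + 2" "c + 3"] True X_chord X_diag by (auto simp: p_def q_def y_def w_def)
  \<comment> \<open>Each of \<open>x\<close>, \<open>y\<close>, \<open>w\<close> occurs in exactly
    two of the three equations; this combination cancels \<open>x\<close> and \<open>y\<close> and
    doubles \<open>w\<close>.\<close>
  have "2 * q * r * w = q * (p * x + r * w) + r * (p * y + q * w) - p * (q * x + r * y)"
    by (simp add: algebra_simps)
  then have "w = 0" using 1 2 3 q r by simp
  then show ?thesis by (simp add: w_def)
qed

text \<open>One step of the induction on distance. A pair with \<open>a \<le> c\<close> and
  \<open>c + 2 \<le> b\<close> is shortened by the edge from \<open>c\<close> to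
  \<open>c + 2\<close>, so its index difference may be larger by one at the same level. Within a
  level, an inner induction runs over the left end: in general the relation at
  \<open>(i, b - 1)\<close> reduces \<open>X i b\<close> to lower levels and to a pair of the same
  level with smaller left end.\<close>

lemma X_level:
  assumes s: "s \<ge> 1"
    and Z: "\<And>a b. a \<le> b \<Longrightarrow> b - a \<le> (if a \<le> c \<and> c + 2 \<le> b then s + 1 else s) \<Longrightarrow> X a b = 0"
  shows "\<forall>b. b - (int k - 1) = (if int k - 1 \<le> c \<and> c + 2 \<le> b then s + 2 else s + 1) \<longrightarrow> X (int k - 1) b = 0"
proof (induction k rule: less_induct)
  case (less k)
  define i where "i = int k - 1"
  have prev: "X a b = 0" if "a < i" "b - a = (if a \<le> c \<and> c + 2 \<le> b then s + 2 else s + 1)" for a b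
  proof (cases "a < 0")
    case False
    then have "nat (a + 1) < k" "int (nat (a + 1)) - 1 = a" using that(1) by (auto simp: i_def)
    then show ?thesis using less[of "nat (a + 1)"] that(2) by auto
  qed (use X_out in auto)
  have Z': "X b a = 0" if "a \<le> b" "b - a \<le> (if a \<le> c \<and> c + 2 \<le> b then s + 1 else s)" for a b
    using Z[OF that] X_sym by simp
  \<comment> \<open>The relation at \<open>(i, c)\<close> contains both \<open>X i (c + 1)\<close>
    and \<open>X i (c + 2)\<close>, which lie on the same level. The first is found separately from
    the relation at \<open>(i + 1, c + 1)\<close>, where \<open>(i + 1, c + 2)\<close> is already
    known because it profits from the shortcut.\<close>
  have leaf: "X i (c + 1) = 0" if lv: "c + 1 - i = s + 1"
  proof -
    have "A i (i + 1) * X i (c + 1) = 0"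
      using entry_at[of i "i + 1" "i + 2" c "c + 1" "c + 2"] lv s Z[of "i + 1" "c + 1"] Z[of "i + 2" "c + 1"] Z'[of "c + 1" "c + 2"]
        Z[of "i + 1" c] Z[of "i + 1" "c + 2"] by (auto split: if_splits)
    then show ?thesis using A_path[of i] X_out2[of "c + 1" i] X_out[of i] lv s by (cases "c + 1 < n") auto
  qed
  show ?case
    unfolding i_def[symmetric]
  proof (intro allI impI)
    fix b
    assume b: "b - i = (if i \<le> c \<and> c + 2 \<le> b then s + 2 else s + 1)"
    define j where "j = b - 1"
    have j: "b = j + 1" by (simp add: j_def)
    have "X i b = 0" if bn: "b < n" and i: "0 \<le> i"
    proof -
      consider "b = c + 1" "i \<le> c" | "b = c + 2" "i \<le> c" | "b \<le> c" | "c + 3 \<le> b" "i \<le> c" | "c + 1 \<le> i"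
        by linarith
      then show ?thesis
      proof cases
        case 1
        then show ?thesis using leaf b by simp
      next
        case 2
        then have lv: "c - i = s" using b by simp
        \<comment> \<open>\<open>c + 2\<close> is reached through \<open>c\<close>, as its edge to
          \<open>c + 1\<close> may be absent.\<close>
        have "A c (c + 2) * X i (c + 2) = 0"
          using entry_at[of "i - 1" i "i + 1" "c - 1" c "c + 1"] lv s prev[of "i - 1" c] Z[of i c] Z[of "i + 1" c] Z[of i "c - 1"] leaf by auto
        then show ?thesis using A_chord 2 bn by auto
      next
        case 3
        then have lv: "j - i = s" "j < c" using b j by auto
        have "A j (j + 1) * X i (j + 1) = 0"
          using entry_at[of "i - 1" i "i + 1" "j - 1" j "j + 1"] lv s prev[of "i - 1" j] Z[of i j] Z[of "i + 1" j] Z[of i "j - 1"] by auto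
        then show ?thesis using A_path[of j] lv j i s bn by auto
      next
        case 4
        then have lv: "j - i = s + 1" "c + 2 \<le> j" using b j by auto
        have "X (i - 1) j = 0" "X i j = 0" "X (i + 1) j = 0" "X i (j - 1) = 0"
          using lv s 4 prev[of "i - 1" j] Z[of i j] Z[of "i + 1" j] Z[of i "j - 1"] by auto
        moreover have "X (c + 2) j = 0" if "i = c" using lv s that Z[of "c + 2" j] by auto
        moreover have "X i c = 0" if "j = c + 2" using lv s 4 that Z[of i c] by auto
        ultimately have "A j (j + 1) * X i (j + 1) = 0"
          using entry_at[of "i - 1" i "i + 1" "j - 1" j "j + 1"] 4 lv(2) by (auto split: if_splits)
        then show ?thesis using A_path[of j] lv j i s bn by auto
      next
        case 5
        then have lv: "j - i = s" using b j by auto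
        have "X (i - 1) j = 0"
          using lv s 5 prev[of "i - 1" j] Z[of c j] by (cases "i = c + 1") auto
        moreover have "X i j = 0" "X (i + 1) j = 0" "X i (j - 1) = 0"
          using lv s 5 Z[of i j] Z[of "i + 1" j] Z[of i "j - 1"] by auto
        \<comment> \<open>The vertex \<open>c + 2\<close> also has the neighbour \<open>c\<close>.
          The pair \<open>(c, j)\<close> lies on the current level, with smaller left end.\<close>
        moreover have "X c j = 0" if "i = c + 2"
          using lv s that prev[of c j] by auto
        moreover have "X i c = 0" if "j = c + 2"
          using lv s 5 that Z'[of c i] by auto
        ultimately have "A j (j + 1) * X i (j + 1) = 0"
          using entry_at[of "i - 1" i "i + 1" "j - 1" j "j + 1"] 5 lv s by (auto split: if_splits)
        then show ?thesis using A_path[of j] lv j i s bn 5 by auto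
      qed
    qed
    then show "X i b = 0" using X_out2[of b] X_out[of i] by auto
  qed
qed

lemma X_zero: "X i j = 0"
proof -
  have Z: "\<forall>a b. a \<le> b \<longrightarrow> b - a \<le> (if a \<le> c \<and> c + 2 \<le> b then int s + 2 else int s + 1) \<longrightarrow> X a b = 0" for s
  proof (induction s)
    case 0
    show ?case
    proof (intro allI impI)
      fix a b assume ab: "a \<le> b" "b - a \<le> (if a \<le> c \<and> c + 2 \<le> b then int 0 + 2 else int 0 + 1)"
      then have "a = b \<or> b = a + 1 \<or> a = c \<and> b = c + 2" by presburger
      then consider "a = b" | "b = a + 1" | "a = c" "b = c + 2" by blast
      then show "X a b = 0"
        using X_diag X_step X_twins X_chord by cases (auto, metis add.assoc one_add_one)
    qed
  next
    case (Suc s)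
    show ?case
    proof (intro allI impI)
      fix a b assume ab: "a \<le> b" "b - a \<le> (if a \<le> c \<and> c + 2 \<le> b then int (Suc s) + 2 else int (Suc s) + 1)"
      show "X a b = 0"
      proof (cases "b - a \<le> (if a \<le> c \<and> c + 2 \<le> b then int s + 2 else int s + 1)")
        case True
        then show ?thesis using Suc ab by blast
      next
        case False
        show ?thesis
        proof (cases "a < 0")
          case True then show ?thesis using X_out by auto
        next
          case a: False
          have "\<forall>b. b - (int k - 1) = (if int k - 1 \<le> c \<and> c + 2 \<le> b then (int s + 1) + 2 else (int s + 1) + 1)
             \<longrightarrow> X (int k - 1) b = 0" for k
          proof (rule X_level)
            fix a b assume "a \<le> b" "b - a \<le> (if a \<le> c \<and> c + 2 \<le> b then (int s + 1) + 1 else int s + 1)"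
            then show "X a b = 0" using Suc[rule_format, of a b] by (auto split: if_splits)
          qed simp
          from this[of "nat (a + 1)"] show ?thesis using a ab False by (auto split: if_splits)
        qed
      qed
    qed
  qed
  have "X a b = 0" if "a \<le> b" for a b using Z[of "nat (b - a)", rule_format, of a b] that by auto
  then show ?thesis using X_sym[of i j] by (cases "i \<le> j") auto
qed

end

text \<open>Relabelling by \<open>f\<close> and extension by zero lead to the integer setting. For
  \<open>c = n\<close> the exceptions for the chord are out of range and the graph is a path. The
  edge between positions \<open>c + 1\<close> and \<open>c + 2\<close> may be present or absent, so
  a chord and an extra leaf are handled together.\<close>

lemma SSP_path_with_chord:
  assumes G: "simple_graph n E"
    and f: "bij_betw f {..<n} {..<n}"
    and edges: "\<And>i j. i < j \<Longrightarrow> j < n \<Longrightarrow> E (f i) (f j) \<Longrightarrow> j = i + 1 \<or> i = c \<and> j = c + 2"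
    and path: "\<And>i. i + 1 < n \<Longrightarrow> i \<noteq> c + 1 \<Longrightarrow> E (f i) (f (i + 1))"
    and chord: "c + 2 < n \<Longrightarrow> E (f c) (f (c + 2))"
  shows "G_SSP n E"
  unfolding G_SSP_def
proof
  fix A assume "A \<in> S_graph n E"
  then have A: "A \<in> carrier_mat n n" and At: "transpose_mat A = A"
    and AE: "\<And>i j. i < n \<Longrightarrow> j < n \<Longrightarrow> i \<noteq> j \<Longrightarrow> A $$ (i,j) \<noteq> 0 \<longleftrightarrow> E i j"
    by (auto simp: S_graph_def)
  have fn: "f i < n" if "i < n" for i using f that by (auto simp: bij_betw_def)
  have finj: "f i = f j \<longleftrightarrow> i = j" if "i < n" "j < n" for i j
    using f that by (auto simp: bij_betw_def inj_on_def)
  have sym: "B $$ (i,j) = B $$ (j,i)" if "transpose_mat B = B" "B \<in> carrier_mat n n" "i < n" "j < n" for B :: "real mat" and i j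
  proof -
    have "B $$ (i,j) = transpose_mat B $$ (i,j)" by (simp add: that)
    then show ?thesis using that(2-) by simp
  qed
  define w where "w B i j = (if 0 \<le> i \<and> i < int n \<and> 0 \<le> j \<and> j < int n then B $$ (f (nat i), f (nat j)) else 0)"
    for B :: "real mat" and i j
  have AwE: "w A (int i) (int j) \<noteq> 0 \<longleftrightarrow> E (f i) (f j)" if "i < n" "j < n" "i \<noteq> j" for i j
    using AE[of "f i" "f j"] that fn finj by (simp add: w_def)
  have w_sym: "w B i j = w B j i" if "transpose_mat B = B" "B \<in> carrier_mat n n" for B i j
    using sym[OF that] fn by (auto simp: w_def)
  have mult: "(\<Sum>k\<in>{0..<int n}. w B i k * w C k j) = w (B * C) i j"
    if BC: "B \<in> carrier_mat n n" "C \<in> carrier_mat n n" for B C i j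
  proof (cases "0 \<le> i \<and> i < int n \<and> 0 \<le> j \<and> j < int n")
    case True
    have "bij_betw (\<lambda>k. f (nat k)) {0..<int n} {..<n}"
    proof -
      have "bij_betw nat {0..<int n} {..<n}"
        by (rule bij_betwI[where g = int]) auto
      then show ?thesis using bij_betw_trans[OF _ f] by (simp add: comp_def)
    qed
    then have "(\<Sum>k\<in>{0..<int n}. B $$ (f (nat i), f (nat k)) * C $$ (f (nat k), f (nat j)))
      = (\<Sum>k<n. B $$ (f (nat i), k) * C $$ (k, f (nat j)))"
      by (rule sum.reindex_bij_betw)
    also have "\<dots> = (B * C) $$ (f (nat i), f (nat j))"
      using BC fn[of "nat i"] fn[of "nat j"] True
      by (auto simp: scalar_prod_def lessThan_atLeast0 intro!: sum.cong)
    finally show ?thesis using True by (simp add: w_def)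
  qed (auto simp: w_def)
  show "SSP A"
    unfolding SSP_def
  proof (intro ballI impI)
    fix X assume "X \<in> carrier_mat (dim_row A) (dim_row A)"
      and Xt: "transpose_mat X = X"
      and AX: "\<forall>i<dim_row A. \<forall>j<dim_row A. A $$ (i, j) * X $$ (i, j) = 0"
      and Xd: "\<forall>i<dim_row A. X $$ (i, i) = 0"
      and com: "A * X - X * A = 0\<^sub>m (dim_row A) (dim_row A)"
    then have X: "X \<in> carrier_mat n n" and dimA: "dim_row A = n" using A by auto
    have comm: "A * X = X * A"
    proof (rule eq_matI)
      fix i j assume ij: "i < dim_row (X * A)" "j < dim_col (X * A)"
      then have "(A * X - X * A) $$ (i,j) = 0" using com A X by simp
      then show "(A * X) $$ (i,j) = (X * A) $$ (i,j)" using ij A X by simp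
    qed (use A X in auto)
    interpret path_with_chord "w A" "w X" "int n" "int c"
    proof
      fix i j :: int
      show "w A i j = w A j i" "w X i j = w X j i" using w_sym A At X Xt by auto
      show "\<not> (0 \<le> i \<and> i < int n) \<Longrightarrow> w X i j = 0" by (auto simp: w_def)
      show "w A i j * w X i j = 0" using AX[rule_format, of "f (nat i)" "f (nat j)"] fn[of "nat i"] fn[of "nat j"]
        by (auto simp: w_def dimA)
      show "w X i i = 0" using Xd fn[of "nat i"] by (auto simp: w_def dimA)
      show "(\<Sum>k = 0..<int n. w A i k * w X k j) = (\<Sum>k = 0..<int n. w X i k * w A k j)"
        using comm by (simp add: mult A X)
      show "w A i j = 0" if "i < j" "j \<noteq> i + 1" "\<not> (i = int c \<and> j = int c + 2)"
      proof (cases "0 \<le> i \<and> j < int n")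
        case True
        define a b where "a = nat i" and "b = nat j"
        have ab: "i = int a" "j = int b" "a < b" "b < n" using True \<open>i < j\<close> by (auto simp: a_def b_def)
        then have "\<not> E (f a) (f b)" using edges[of a b] that by auto
        then show ?thesis using AwE[of a b] ab by auto
      qed (use \<open>i < j\<close> in \<open>auto simp: w_def\<close>)
      show "w A i (i + 1) \<noteq> 0" if "0 \<le> i" "i + 1 < int n" "i \<noteq> int c + 1"
      proof -
        define a where "a = nat i"
        have a: "i = int a" "a + 1 < n" "a \<noteq> c + 1" using that by (auto simp: a_def)
        then have "w A (int a) (int (a + 1)) \<noteq> 0" using path[of a] AwE[of a "a + 1"] by auto
        moreover have "int a = i" "int (a + 1) = i + 1" using a by auto
        ultimately show ?thesis by metis
      qed
    next
      assume "int c + 2 < int n"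
      then have "w A (int c) (int (c + 2)) \<noteq> 0" using AwE[of c "c + 2"] chord by auto
      then show "w A (int c) (int c + 2) \<noteq> 0" by (simp only: of_nat_add of_nat_numeral not_False_eq_True)
    next
      show "0 \<le> int c" by simp
    qed
    show "X = 0\<^sub>m (dim_row A) (dim_row A)"
    proof (rule eq_matI)
      fix i j assume "i < dim_row (0\<^sub>m (dim_row A) (dim_row A) :: real mat)"
        "j < dim_col (0\<^sub>m (dim_row A) (dim_row A) :: real mat)"
      then have ij: "i < n" "j < n" using dimA by auto
      then obtain a b where "a < n" "f a = i" "b < n" "f b = j"
        using f unfolding bij_betw_def by (metis imageE lessThan_iff)
      then have "X $$ (i,j) = w X (int a) (int b)" by (simp add: w_def)
      then show "X $$ (i,j) = 0\<^sub>m (dim_row A) (dim_row A) $$ (i,j)" using X_zero ij dimA by simp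
    qed (use X dimA in auto)
  qed
qed

section \<open>A triple eigenvalue from four separated branches\<close>

lemma sum_group_const:
  fixes F :: "nat \<Rightarrow> real" and grp :: "nat \<Rightarrow> nat" and n :: nat
  assumes "\<And>i. i < n \<Longrightarrow> P i \<Longrightarrow> grp i < (m::nat)"
  shows "(\<Sum>i<n. if P i then F (grp i) else 0) = (\<Sum>g<m. real (card {i. i < n \<and> P i \<and> grp i = g}) * F g)"
proof -
  have "(\<Sum>i<n. if P i then F (grp i) else 0) = (\<Sum>i<n. \<Sum>g<m. if P i \<and> grp i = g then F g else 0)"
  proof (intro sum.cong refl)
    fix i assume "i \<in> {..<n}"
    then show "(if P i then F (grp i) else 0) = (\<Sum>g<m. if P i \<and> grp i = g then F g else 0)"
      using assms[of i] by auto
  qed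
  also have "\<dots> = (\<Sum>g<m. \<Sum>i<n. if P i \<and> grp i = g then F g else 0)" by (rule sum.swap)
  also have "\<dots> = (\<Sum>g<m. real (card {i. i < n \<and> P i \<and> grp i = g}) * F g)"
  proof (intro sum.cong refl)
    fix g
    have "(\<Sum>i<n. if P i \<and> grp i = g then F g else 0) = (\<Sum>i\<in>{i\<in>{..<n}. P i \<and> grp i = g}. F g)"
      using sum.inter_filter[of "{..<n}", OF finite_lessThan, where g = "\<lambda>_. F g" and P = "\<lambda>i. P i \<and> grp i = g"]
      by simp
    then show "(\<Sum>i<n. if P i \<and> grp i = g then F g else 0) = real (card {i. i < n \<and> P i \<and> grp i = g}) * F g"
      by simp
  qed
  finally show ?thesis .
qed

text \<open>If removing v splits its neighbours into four separated groups, take the Laplacian of the rest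
  of the graph: vectors that vanish at v and are constant on the groups form a null space of
  dimension at least three.\<close>

lemma low_of_four_branches:
  assumes G: "simple_graph n E" and v: "v < n"
    and grp: "\<And>i. i < n \<Longrightarrow> i \<noteq> v \<Longrightarrow> grp i < (4::nat)"
      "\<And>i j. i < n \<Longrightarrow> j < n \<Longrightarrow> i \<noteq> v \<Longrightarrow> j \<noteq> v \<Longrightarrow> E i j \<Longrightarrow> grp i = grp j"
    and nbr: "\<And>g. g < 4 \<Longrightarrow> \<exists>u<n. u \<noteq> v \<and> grp u = g \<and> E v u"
  shows "low n E"
proof -
  have E_sym: "E i j \<longleftrightarrow> E j i" if "i < n" "j < n" for i j using G that by (auto simp: simple_graph_def)
  have E_irr: "\<not> E i i" if "i < n" for i using G that by (auto simp: simple_graph_def)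
  define deg where "deg i = (\<Sum>j<n. if j \<noteq> v \<and> E i j then 1 else 0 :: real)" for i
  define a where "a i j = (if i = j then (if i = v then 0 else - deg i) else if E i j then 1 else 0)" for i j
  define lift where "lift c i = (if i \<noteq> v then c (grp i) else 0 :: real)" for c :: "nat \<Rightarrow> real" and i
  define N where "N g = real (card {i. i < n \<and> (i \<noteq> v \<and> E v i) \<and> grp i = g})" for g
  define S where "S g = real (card {i. i < n \<and> i \<noteq> v \<and> grp i = g})" for g
  have N_pos: "N g > 0" if "g < 4" for g
  proof -
    have "{i. i < n \<and> (i \<noteq> v \<and> E v i) \<and> grp i = g} \<noteq> {}" using nbr[OF that] by auto
    then show ?thesis by (simp add: N_def card_gt_0_iff)
  qed
  have S_pos: "S g > 0" if "g < 4" for g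
  proof -
    have "{i. i < n \<and> i \<noteq> v \<and> grp i = g} \<noteq> {}" using nbr[OF that] by auto
    then show ?thesis by (simp add: S_def card_gt_0_iff)
  qed
  \<comment> \<open>Off \<open>v\<close> no edge leaves a group, so the Laplacian rows annihilate
    functions constant on groups. The row of \<open>v\<close> is the single condition on
    \<open>c\<close>.\<close>
  have ker: "(\<Sum>j<n. a i j * lift c j) = 0" if c: "(\<Sum>g<4. N g * c g) = 0" and i: "i < n" for c i
  proof (cases "i = v")
    case True
    have "(\<Sum>j<n. a i j * lift c j) = (\<Sum>j<n. if j \<noteq> v \<and> E v j then c (grp j) else 0)"
      using True by (intro sum.cong) (auto simp: a_def lift_def)
    also have "\<dots> = (\<Sum>g<4. N g * c g)"
      unfolding N_def by (rule sum_group_const) (use grp(1) in auto)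
    finally show ?thesis using c by simp
  next
    case False
    have "(\<Sum>j<n. a i j * lift c j) = (\<Sum>j<n. c (grp i) * (if j \<noteq> v \<and> E i j then 1 else 0) + (if j = i then - deg i * c (grp i) else 0))"
      using False i E_irr[OF i] grp(2)[OF i] by (intro sum.cong) (auto simp: a_def lift_def)
    also have "\<dots> = 0"
      using i by (simp add: sum.distrib sum_distrib_left[symmetric] deg_def[symmetric])
    finally show ?thesis .
  qed
  have dot: "(\<Sum>i<n. lift c i * lift c' i) = (\<Sum>g<4. S g * (c g * c' g))" for c c'
  proof -
    have "(\<Sum>i<n. lift c i * lift c' i) = (\<Sum>i<n. if i \<noteq> v then c (grp i) * c' (grp i) else 0)"
      by (intro sum.cong) (auto simp: lift_def)
    also have "\<dots> = (\<Sum>g<4. S g * (c g * c' g))"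
      unfolding S_def by (rule sum_group_const[of n "\<lambda>i. i \<noteq> v" grp 4 "\<lambda>g. c g * c' g"]) (use grp(1) in auto)
    finally show ?thesis .
  qed
  \<comment> \<open>Wanted are three vectors on the groups, orthogonal for the weights
    \<open>S\<close> and satisfying the condition with \<open>N\<close>. The first two live on {0,1}
    and {2,3}. On each pair, N/S is orthogonal to them for the weights \<open>S\<close>; the factors
    \<open>Q\<close> and \<open>- P\<close> balance the two halves in the row of
    \<open>v\<close>.\<close>
  define P Q where "P = N 0 * N 0 / S 0 + N 1 * N 1 / S 1" and "Q = N 2 * N 2 / S 2 + N 3 * N 3 / S 3"
  define c where "c k = (\<lambda>g. if k = 0 then [1 / N 0, - 1 / N 1, 0, 0] ! g
    else if k = 1 then [0, 0, 1 / N 2, - 1 / N 3] ! g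
    else [Q * N 0 / S 0, Q * N 1 / S 1, - P * N 2 / S 2, - P * N 3 / S 3] ! g)" for k :: nat
  note pos = N_pos[of 0] N_pos[of 1] N_pos[of 2] N_pos[of 3] S_pos[of 0] S_pos[of 1] S_pos[of 2] S_pos[of 3]
  have sum4: "(\<Sum>g<4. h g) = h 0 + h 1 + h 2 + h 3" for h :: "nat \<Rightarrow> real"
    by (simp add: eval_nat_numeral)
  have PQ: "P > 0" "Q > 0" using pos by (simp_all add: P_def Q_def add_pos_pos)
  have k3: "k = 0 \<or> k = 1 \<or> k = 2" if "k < 3" for k :: nat using that by linarith
  have "q_mat (Matrix.mat n n (\<lambda>(i,j). a i j)) + 2 \<le> n"
  proof (rule q_mat_le_of_triple)
    show "a i j = a j i" if "i < n" "j < n" for i j using E_sym[OF that] by (simp add: a_def)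
    show "(\<Sum>j<n. a i j * lift (c k) j) = 0 * lift (c k) i" if "k < 3" "i < n" for k i
    proof -
      have "Q * P = Q * (N 0 * N 0 / S 0) + Q * (N 1 * N 1 / S 1)"
        "P * Q = P * (N 2 * N 2 / S 2) + P * (N 3 * N 3 / S 3)"
        by (simp_all only: P_def Q_def distrib_left)
      then have "(\<Sum>g<4. N g * c k g) = 0"
        using k3[OF that(1)] pos by (auto simp: sum4 c_def mult_ac)
      then show ?thesis using ker that by simp
    qed
    show "\<exists>i<n. lift (c k) i \<noteq> 0" if k: "k < 3" for k
    proof -
      define g where "g = (if k = 1 then 2 else 0 :: nat)"
      have "g < 4" by (simp add: g_def)
      then obtain u where "u < n" "u \<noteq> v" "grp u = g" using nbr by blast
      moreover have "c k g \<noteq> 0" using k3[OF k] pos PQ by (auto simp: c_def g_def)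
      ultimately show ?thesis by (auto simp: lift_def)
    qed
    show "(\<Sum>i<n. lift (c k) i * lift (c l) i) = 0" if "k < l" "l < 3" for k l
    proof -
      have "k = 0 \<and> l = 1 \<or> k = 0 \<and> l = 2 \<or> k = 1 \<and> l = 2" using that by linarith
      then show ?thesis using pos by (auto simp: dot sum4 c_def)
    qed
  qed
  moreover have "Matrix.mat n n (\<lambda>(i,j). a i j) \<in> S_graph n E"
    by (rule mat_in_S_graph) (auto simp: a_def E_sym)
  ultimately show ?thesis unfolding low_def by blast
qed

section \<open>Paths and excluded configurations\<close>

definition is_path :: "nat \<Rightarrow> (nat \<Rightarrow> nat \<Rightarrow> bool) \<Rightarrow> (nat \<Rightarrow> nat) \<Rightarrow> nat \<Rightarrow> bool" where
  "is_path n E f L \<longleftrightarrow> inj_on f {..<L} \<and> f ` {..<L} \<subseteq> {..<n} \<and> (\<forall>i. Suc i < L \<longrightarrow> E (f i) (f (Suc i)))"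

text \<open>A walk avoiding \<open>v\<close> becomes a path by cutting back to the earlier visit
  whenever a vertex recurs.\<close>

lemma is_path_of_reachable:
  assumes "(\<lambda>x y. x < n \<and> y < n \<and> x \<noteq> v \<and> y \<noteq> v \<and> E x y)\<^sup>*\<^sup>* a b" "a < n" "a \<noteq> v"
  shows "\<exists>q m. is_path n E q (Suc m) \<and> q 0 = a \<and> q m = b \<and> v \<notin> q ` {..m}"
  using assms(1)
proof (induction rule: rtranclp_induct)
  case base
  show ?case using assms(2,3) by (intro exI[of _ "\<lambda>_. a"] exI[of _ 0]) (auto simp: is_path_def inj_on_def)
next
  case (step y z)
  then obtain q m where q: "is_path n E q (Suc m)" "q 0 = a" "q m = y" "v \<notin> q ` {..m}" by blast
  show ?case
  proof (cases "z \<in> q ` {..m}")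
    case True
    then obtain k where k: "k \<le> m" "q k = z" by auto
    have "is_path n E q (Suc k)" using q(1) k(1) by (auto simp: is_path_def inj_on_def image_subset_iff)
    then show ?thesis using q k by (intro exI[of _ q] exI[of _ k]) auto
  next
    case False
    have "is_path n E (q(Suc m := z)) (Suc (Suc m))"
      unfolding is_path_def
    proof (intro conjI allI impI)
      have "{..<Suc (Suc m)} = insert (Suc m) {..m}" by auto
      then show "inj_on (q(Suc m := z)) {..<Suc (Suc m)}"
        using q(1) False by (auto simp: is_path_def lessThan_Suc_atMost inj_on_def)
      show "(q(Suc m := z)) ` {..<Suc (Suc m)} \<subseteq> {..<n}"
        using q(1) step(2) by (auto simp: is_path_def less_Suc_eq image_subset_iff)
      show "E ((q(Suc m := z)) i) ((q(Suc m := z)) (Suc i))" if "Suc i < Suc (Suc m)" for i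
        using that q(1,3) step(2) by (auto simp: is_path_def less_Suc_eq)
    qed
    moreover have "v \<notin> (q(Suc m := z)) ` {..Suc m}" using q(4) step(2) by (auto simp: atMost_Suc)
    moreover have "(q(Suc m := z)) 0 = a" "(q(Suc m := z)) (Suc m) = z" using q(2) by auto
    ultimately show ?thesis by blast
  qed
qed

lemma crossing_edge:
  assumes "connected_graph n E" "s < n" "t < n" "s \<in> S" "t \<notin> S"
  obtains x y where "x < n" "y < n" "x \<in> S" "y \<notin> S" "E x y"
proof -
  have "(\<lambda>x y. x < n \<and> y < n \<and> E x y)\<^sup>*\<^sup>* s t"
    using assms by (auto simp: connected_graph_def)
  then have "t \<notin> S \<longrightarrow> (\<exists>x y. x < n \<and> y < n \<and> x \<in> S \<and> y \<notin> S \<and> E x y)"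
    by (induction rule: rtranclp_induct) (use assms(4) in auto)
  then show ?thesis using assms(5) that by blast
qed

text \<open>Covers a new start (\<open>k = 0\<close>), a new end (\<open>k = L\<close>) and
  insertion between consecutive vertices; the guards drop the edge on a side that does not
  exist.\<close>

lemma is_path_insert:
  assumes f: "is_path n E f L" and v: "v < n" "v \<notin> f ` {..<L}" and k: "k \<le> L"
    and e: "k > 0 \<Longrightarrow> E (f (k - 1)) v" "k < L \<Longrightarrow> E v (f k)"
  shows "is_path n E (\<lambda>i. if i < k then f i else if i = k then v else f (i - 1)) (Suc L)"
  unfolding is_path_def
proof (intro conjI allI impI)
  let ?g = "\<lambda>i. if i < k then f i else if i = k then v else f (i - 1)"
  have inj: "f i = f j \<longleftrightarrow> i = j" if "i < L" "j < L" for i j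
    using f that by (auto simp: is_path_def inj_on_def)
  have vf: "f i \<noteq> v" if "i < L" for i using v that by auto
  show "inj_on ?g {..<Suc L}"
  proof (rule linorder_inj_onI)
    fix i j assume "i < j" "i \<in> {..<Suc L}" "j \<in> {..<Suc L}"
    moreover from this have "j - 1 < L" by auto
    ultimately show "?g i \<noteq> ?g j"
      using k inj[of i j] inj[of i "j - 1"] inj[of "i - 1" "j - 1"] vf[of i] vf[of "j - 1"] by auto
  qed auto
  have "f i < n" if "i < L" for i using f that by (auto simp: is_path_def)
  then show "?g ` {..<Suc L} \<subseteq> {..<n}" using v k by auto
  show "E (?g i) (?g (Suc i))" if "Suc i < Suc L" for i
  proof -
    consider "Suc i < k" | "Suc i = k" | "i = k" | "i > k" by linarith
    then show ?thesis
    proof cases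
      case 1 then show ?thesis using f k by (auto simp: is_path_def)
    next
      case 2 then show ?thesis using e(1) by auto
    next
      case 3 then show ?thesis using e(2) that by auto
    next
      case 4
      then have "E (f (i - 1)) (f (Suc (i - 1)))" using f that by (cases i) (auto simp: is_path_def)
      with 4 show ?thesis by simp
    qed
  qed
qed

locale critical_graph =
  fixes n :: nat and E :: "nat \<Rightarrow> nat \<Rightarrow> bool"
  assumes G: "simple_graph n E" and not_low: "\<not> low n E"
begin

abbreviation "gpath \<equiv> is_path n E"

lemma E_sym: "i < n \<Longrightarrow> j < n \<Longrightarrow> E i j \<longleftrightarrow> E j i"
  using G by (auto simp: simple_graph_def)

lemma path_less: "gpath f L \<Longrightarrow> i < L \<Longrightarrow> f i < n"
  by (auto simp: is_path_def)

lemma path_eq: "gpath f L \<Longrightarrow> i < L \<Longrightarrow> j < L \<Longrightarrow> f i = f j \<longleftrightarrow> i = j"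
  by (auto simp: is_path_def inj_on_def)

lemma path_edge: "gpath f L \<Longrightarrow> Suc i < L \<Longrightarrow> E (f i) (f (Suc i))"
  by (auto simp: is_path_def)

lemma path_edge': "gpath f L \<Longrightarrow> Suc i < L \<Longrightarrow> E (f (Suc i)) (f i)"
  using path_edge[of f L i] E_sym[of "f i" "f (Suc i)"] path_less[of f L] by auto

text \<open>The chord would close a cycle with at least four vertices. Chords between vertices at
  distance two close only triangles and are not excluded here.\<close>

lemma no_long_chord:
  assumes f: "gpath f L" and ij: "i + 3 \<le> j" "j < L"
  shows "\<not> E (f i) (f j)"
proof
  assume e: "E (f i) (f j)"
  define r where "r = j - i - 3"
  have r: "i + r + 3 = j" using ij by (simp add: r_def)
  have "low n E"
  proof (rule low_of_cycle[OF G, where r = r and f = "\<lambda>k. f (i + k)"])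
    show "inj_on (\<lambda>k. f (i + k)) {..<r + 4}"
      using f r ij by (auto simp: inj_on_def path_eq)
    show "(\<lambda>k. f (i + k)) ` {..<r + 4} \<subseteq> {..<n}"
      using r ij by (auto intro!: path_less[OF f])
    show "E (f (i + k)) (f (i + Suc k))" if "k < r + 3" for k
      using path_edge[OF f, of "i + k"] that r ij by simp
    show "E (f (i + 0)) (f (i + (r + 3)))" using e r by (simp add: add.assoc)
  qed
  then show False using not_low by simp
qed

lemma no_ear:
  assumes f: "gpath f L" and ij: "i + 2 \<le> j" "j < L" and v: "v < n" "v \<notin> f ` {..<L}"
  shows "\<not> (E v (f i) \<and> E v (f j))"
proof
  assume e: "E v (f i) \<and> E v (f j)"
  define r where "r = j - i - 2"
  have r: "i + r + 2 = j" using ij by (simp add: r_def)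
  define g where "g k = (if k = 0 then v else f (i + k - 1))" for k
  have vf: "f i \<noteq> v" if "i < L" for i using v that by auto
  have "low n E"
  proof (rule low_of_cycle[OF G, where r = r and f = g])
    show "inj_on g {..<r + 4}"
    proof (rule linorder_inj_onI)
      fix x y assume xy: "x < y" "x \<in> {..<r + 4}" "y \<in> {..<r + 4}"
      then have "i + x - 1 < L" "i + y - 1 < L" "0 < x \<Longrightarrow> i + x - 1 \<noteq> i + y - 1" using r ij by auto
      then show "g x \<noteq> g y"
        using xy path_eq[OF f, of "i + x - 1" "i + y - 1"] vf[of "i + y - 1"] by (auto simp: g_def)
    qed auto
    show "g ` {..<r + 4} \<subseteq> {..<n}"
      using f r ij v(1) by (auto simp: g_def intro!: path_less[OF f])
    show "E (g k) (g (Suc k))" if "k < r + 3" for k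
    proof (cases k)
      case 0 then show ?thesis using e by (simp add: g_def)
    next
      case (Suc l)
      then show ?thesis using path_edge[OF f, of "i + l"] that r ij by (simp add: g_def)
    qed
    have "i + (r + 3) - 1 = j" using r by simp
    then show "E (g 0) (g (r + 3))" using e by (simp add: g_def)
  qed
  then show False using not_low by simp
qed

text \<open>Leaves have to avoid only the segment from \<open>i\<close> to \<open>j\<close>, so
  other vertices of the same path can serve as leaves.\<close>

lemma no_double_broom:
  assumes f: "gpath f L" and ij: "i < j" "j < L"
    and less: "a < n" "b < n" "c < n" "e < n"
    and leaves: "distinct [a, b, c, e]" "set [a, b, c, e] \<inter> f ` {i..j} = {}"
    and edges: "E (f i) a" "E (f i) b" "E (f j) c" "E (f j) e"
  shows False
proof -
  have "low n E"
  proof (rule low_of_double_broom[OF G, where d = "j - i" and w = "\<lambda>k. f (i + k)" and a = a and b = b and c = c and e = e])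
    have img: "(\<lambda>k. f (i + k)) ` {..j - i} \<subseteq> f ` {i..j}" using ij by auto
    show "inj_on (\<lambda>k. f (i + k)) {..j - i}"
      using f ij by (auto simp: inj_on_def path_eq)
    show "(\<lambda>k. f (i + k)) ` {..j - i} \<subseteq> {..<n}"
      using f ij by (auto intro!: path_less[OF f])
    show "E (f (i + k)) (f (i + Suc k))" if "k < j - i" for k
      using path_edge[OF f, of "i + k"] that ij by simp
    show "set [a, b, c, e] \<inter> (\<lambda>k. f (i + k)) ` {..j - i} = {}" using img leaves(2) by blast
    show "E a (f (i + 0))" "E b (f (i + 0))" "E c (f (i + (j - i)))" "E e (f (i + (j - i)))"
      using edges less ij E_sym path_less[OF f] by auto
  qed (use ij leaves less in auto)
  then show False using not_low by simp
qed

text \<open>Two of the neighbours in one component of G - v would be adjacent, giving a campstool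
  with the other two, or joined by a longer path, giving a cycle of length at least four through
  \<open>v\<close>. So the four lie in four components.\<close>

lemma no_four_neighbours:
  assumes v: "v < n" and less: "a < n" "b < n" "c < n" "d < n" and dist: "distinct [a, b, c, d]"
    and nbr: "E v a" "E v b" "E v c" "E v d"
  shows False
proof -
  define R where "R = (\<lambda>x y. x < n \<and> y < n \<and> x \<noteq> v \<and> y \<noteq> v \<and> E x y)"
  have ne: "x \<noteq> v" if "E v x" for x using G v that by (auto simp: simple_graph_def)
  have R_sym: "R\<^sup>*\<^sup>* y x" if "R\<^sup>*\<^sup>* x y" for x y
  proof -
    have "symp R" using E_sym by (auto simp: R_def symp_def)
    then have "symp R\<^sup>*\<^sup>*" by (rule symp_rtranclp)
    then show ?thesis using that by (rule sympD)
  qed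
  have sep: "\<not> R\<^sup>*\<^sup>* x y" if xy: "x < n" "y < n" "E v x" "E v y" "z < n" "w < n" "E v z" "E v w" "distinct [x, y, z, w]" for x y z w
  proof
    assume "R\<^sup>*\<^sup>* x y"
    then obtain q m where q: "gpath q (Suc m)" "q 0 = x" "q m = y" "v \<notin> q ` {..m}"
      using is_path_of_reachable[of n v E x y] xy(1) ne[OF xy(3)] unfolding R_def by blast
    show False
    proof (cases "m \<ge> 2")
      case True
      then show ?thesis using no_ear[OF q(1), of 0 m v] q v xy by (auto simp: lessThan_Suc_atMost)
    next
      case False
      then have "m = 1" using q(2,3) xy(9) by (cases m) auto
      then have "E x y" using path_edge[OF q(1), of 0] q(2,3) by simp
      then have "low n E"
        by (intro low_of_campstool[OF G, of v x y z w]) (use xy v ne in auto)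
      then show False using not_low by simp
    qed
  qed
  \<comment> \<open>The last group takes the component of \<open>d\<close> together with all
    components containing none of the four.\<close>
  define grp where "grp i = (if R\<^sup>*\<^sup>* a i then 0 else if R\<^sup>*\<^sup>* b i then 1 else if R\<^sup>*\<^sup>* c i then 2 else 3 :: nat)" for i
  have "low n E"
  proof (rule low_of_four_branches[OF G v, where grp = grp])
    show "grp i < 4" for i by (simp add: grp_def)
    show "grp i = grp j" if "i < n" "j < n" "i \<noteq> v" "j \<noteq> v" "E i j" for i j
    proof -
      have "R i j" "R j i" using that E_sym by (auto simp: R_def)
      then have "R\<^sup>*\<^sup>* x i \<longleftrightarrow> R\<^sup>*\<^sup>* x j" for x by (meson rtranclp.rtrancl_into_rtrancl)
      then show ?thesis by (simp add: grp_def)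
    qed
    have "grp a = 0" "grp b = 1" "grp c = 2" "grp d = 3"
      using sep[of a b c d] sep[of a c b d] sep[of a d b c] sep[of b c a d] sep[of b d a c] sep[of c d a b]
        dist less nbr by (auto simp: grp_def)
    then show "\<exists>u<n. u \<noteq> v \<and> grp u = g \<and> E v u" if "g < 4" for g
    proof -
      have "g = 0 \<or> g = 1 \<or> g = 2 \<or> g = 3" using that by linarith
      then show ?thesis
        using \<open>grp a = 0\<close> \<open>grp b = 1\<close> \<open>grp c = 2\<close> \<open>grp d = 3\<close> less nbr ne by metis
    qed
  qed
  then show False using not_low by simp
qed

text \<open>Two triangles sharing an edge contain a 4-cycle; sharing a vertex, they give it four
  neighbours; disjoint ones form a double broom whose leaves are their outer vertices.\<close>

lemma chord_unique:
  assumes f: "gpath f L" and ij: "i < j" "j + 2 < L" and e: "E (f i) (f (i + 2))" "E (f j) (f (j + 2))"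
  shows False
proof -
  have less: "f k < n" if "k \<le> j + 2" for k using path_less[OF f] that ij by simp
  have eq: "f k = f l \<longleftrightarrow> k = l" if "k \<le> j + 2" "l \<le> j + 2" for k l using path_eq[OF f] that ij by simp
  consider "j = i + 1" | "j = i + 2" | "j \<ge> i + 3" using ij by linarith
  then show False
  proof cases
    case 1
    have "E (f (i + 3)) (f (i + 2))" "E (f (i + 2)) (f i)" "E (f i) (f (i + 1))" "E (f (i + 1)) (f (i + 3))"
      using path_edge'[OF f, of "i + 2"] path_edge[OF f, of i] e E_sym[of "f i" "f (i + 2)"] less 1 ij
      by (auto simp: numeral_eq_Suc)
    note * = this
    define g where "g k = f (if k = 0 then i else if k = 1 then i + 1 else if k = 2 then i + 3 else i + 2)" for k :: nat
    have k4: "k = 0 \<or> k = 1 \<or> k = 2 \<or> k = 3" if "k < 4" for k :: nat using that by linarith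
    have "low n E"
    proof (rule low_of_cycle[OF G, where r = 0 and f = g])
      show "inj_on g {..<0 + 4}"
      proof (rule inj_onI)
        fix x y assume "x \<in> {..<0 + 4}" "y \<in> {..<0 + 4}" "g x = g y"
        then show "x = y" using k4[of x] k4[of y] 1 by (auto simp: g_def eq)
      qed
      show "g ` {..<0 + 4} \<subseteq> {..<n}" using less 1 by (auto simp: g_def)
      show "E (g k) (g (Suc k))" if "k < 0 + 3" for k
      proof -
        have "k = 0 \<or> k = 1 \<or> k = 2" using that by linarith
        then show ?thesis using * by (auto simp: g_def)
      qed
      show "E (g 0) (g (0 + 3))" using e by (simp add: g_def)
    qed
    then show False using not_low by simp
  next
    case 2
    then show False
      using no_four_neighbours[of "f (i + 2)" "f i" "f (i + 1)" "f (i + 3)" "f (i + 4)"]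
        path_edge'[OF f, of "i + 1"] path_edge[OF f, of "i + 2"] e E_sym[of "f i" "f (i + 2)"] less ij
      by (auto simp: eq numeral_eq_Suc)
  next
    case 3
    have j: "j + 1 < L" using ij by simp
    show False
      by (rule no_double_broom[OF f, of "i + 2" j "f i" "f (i + 1)" "f (j + 1)" "f (j + 2)"])
        (use 3 ij less e E_sym[of "f i" "f (i + 2)"] path_edge'[OF f, of "i + 1"] path_edge[OF f, of j] in
          \<open>auto simp: eq numeral_eq_Suc\<close>)
  qed
qed

lemma path_rev: "gpath f L \<Longrightarrow> gpath (\<lambda>i. f (L - Suc i)) L"
  unfolding is_path_def
proof (intro conjI allI impI)
  assume *: "inj_on f {..<L} \<and> f ` {..<L} \<subseteq> {..<n} \<and> (\<forall>i. Suc i < L \<longrightarrow> E (f i) (f (Suc i)))"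
  then have f: "gpath f L" by (simp add: is_path_def)
  show "inj_on (\<lambda>i. f (L - Suc i)) {..<L}" using path_eq[OF f] by (auto simp: inj_on_def)
  show "(\<lambda>i. f (L - Suc i)) ` {..<L} \<subseteq> {..<n}" using path_less[OF f] by auto
  fix i assume i: "Suc i < L"
  then have "L - Suc i = Suc (L - Suc (Suc i))" by simp
  then show "E (f (L - Suc i)) (f (L - Suc (Suc i)))" using path_edge'[OF f, of "L - Suc (Suc i)"] i by simp
qed

end

section \<open>Longest paths and their branches\<close>

context critical_graph
begin

text \<open>Excluding \<open>Suc L\<close> vertices is enough for maximality, since a longer path
  has an initial segment with exactly \<open>Suc L\<close>.\<close>

definition longest :: "(nat \<Rightarrow> nat) \<Rightarrow> nat \<Rightarrow> bool" where
  "longest f L \<longleftrightarrow> gpath f L \<and> (\<forall>g. \<not> gpath g (Suc L))"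

lemma longestD: "longest f L \<Longrightarrow> gpath f L"
  by (simp add: longest_def)

lemma longest_rev: "longest f L \<Longrightarrow> longest (\<lambda>i. f (L - Suc i)) L"
  using path_rev by (simp add: longest_def)

lemma rev_image: "(\<lambda>i. f (L - Suc i)) ` {..<L} = f ` {..<L}" for f :: "nat \<Rightarrow> nat"
proof -
  have "(\<lambda>i. L - Suc i) ` {..<L} = {..<L}"
  proof (intro Set.set_eqI iffI)
    fix x assume "x \<in> {..<L}"
    then have "x = L - Suc (L - Suc x)" "L - Suc x \<in> {..<L}" by auto
    then show "x \<in> (\<lambda>i. L - Suc i) ` {..<L}" by (rule image_eqI)
  qed auto
  then show ?thesis by (metis image_image)
qed

lemma longest_insert:
  assumes "longest f L" "v < n" "v \<notin> f ` {..<L}" "k \<le> L"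
    "k > 0 \<Longrightarrow> E (f (k - 1)) v" "k < L \<Longrightarrow> E v (f k)"
  shows False
  using is_path_insert[of n E f L v k] assms unfolding longest_def by blast

lemma longest_start:
  assumes f: "longest f L" and v: "v < n" "v \<notin> f ` {..<L}" "0 < L"
  shows "\<not> E v (f 0)"
  using longest_insert[OF f v(1,2), of 0] v(3) by auto

lemma longest_end:
  assumes f: "longest f L" and v: "v < n" "v \<notin> f ` {..<L}" "0 < L"
  shows "\<not> E v (f (L - 1))"
  using longest_start[OF longest_rev[OF f], of v] v by (simp add: rev_image)

text \<open>Putting \<open>v\<close> in place of \<open>f 0\<close> gives another longest path,
  which \<open>u\<close> would extend.\<close>

lemma longest_no_two_tail:
  assumes f: "longest f L" and uv: "u < n" "v < n" "u \<notin> f ` {..<L}" "v \<notin> f ` {..<L}" "E u v" "u \<noteq> v"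
    and "1 < L"
  shows "\<not> E v (f 1)"
proof
  assume e: "E v (f 1)"
  have p: "gpath f L" using f by (rule longestD)
  have "gpath (f(0 := v)) L"
    unfolding is_path_def
  proof (intro conjI allI impI)
    show "inj_on (f(0 := v)) {..<L}"
      using path_eq[OF p] uv(4) by (auto simp: inj_on_def image_iff)
    show "(f(0 := v)) ` {..<L} \<subseteq> {..<n}" using path_less[OF p] uv(2) by auto
    show "E ((f(0 := v)) i) ((f(0 := v)) (Suc i))" if "Suc i < L" for i
      using path_edge[OF p that] e by auto
  qed
  then have "longest (f(0 := v)) L" using f by (simp add: longest_def)
  moreover have "u \<notin> (f(0 := v)) ` {..<L}" using uv by auto
  ultimately show False using longest_start[of "f(0 := v)" L u] uv \<open>1 < L\<close> by auto
qed

text \<open>Swapping \<open>f 0\<close> and \<open>f 1\<close> along the triangle gives a longest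
  path starting at \<open>f 1\<close>, which \<open>v\<close> would extend.\<close>

lemma longest_no_end_triangle:
  assumes f: "longest f L" and v: "v < n" "v \<notin> f ` {..<L}" and L: "2 < L" and e: "E v (f 1)"
  shows "\<not> E (f 0) (f 2)"
proof
  assume c: "E (f 0) (f 2)"
  have p: "gpath f L" using f by (rule longestD)
  define g where "g = f(0 := f 1, 1 := f 0)"
  have g: "g k = f (if k = 0 then 1 else if k = 1 then 0 else k)" for k by (simp add: g_def)
  have "gpath g L"
    unfolding is_path_def
  proof (intro conjI allI impI)
    show "inj_on g {..<L}"
      using path_eq[OF p] L by (auto simp: inj_on_def g split: if_splits)
    show "g ` {..<L} \<subseteq> {..<n}" using path_less[OF p] L by (auto simp: g)
    show "E (g i) (g (Suc i))" if "Suc i < L" for i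
    proof -
      consider "i = 0" | "i = 1" | "i > 1" by linarith
      then show ?thesis
        using path_edge[OF p that] path_edge'[OF p, of 0] c L by cases (auto simp: g numeral_2_eq_2)
    qed
  qed
  then have "longest g L" using f by (simp add: longest_def)
  moreover have "v \<notin> g ` {..<L}" using v L by (auto simp: g image_iff)
  ultimately show False using longest_start[of g L v] v L e by (auto simp: g)
qed

lemma branch_inner:
  assumes f: "longest f L" and v: "v < n" "v \<notin> f ` {..<L}" and i: "i < L" "E v (f i)"
  shows "0 < i" "Suc i < L"
  using longest_start[OF f v] longest_end[OF f v] i
  by (cases "i = 0"; cases "Suc i = L"; auto)+

text \<open>Between consecutive neighbours \<open>v\<close> could be inserted into the path;
  neighbours further apart close a cycle of length at least four.\<close>

lemma branch_unique:
  assumes f: "longest f L" and v: "v < n" "v \<notin> f ` {..<L}" and ij: "i < j" "j < L" "E v (f i)"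
  shows "\<not> E v (f j)"
proof
  assume e: "E v (f j)"
  have p: "gpath f L" using f by (rule longestD)
  show False
  proof (cases "j = Suc i")
    case True
    have "E (f i) v" using E_sym[of v "f i"] v path_less[OF p] ij by auto
    then show False using longest_insert[OF f v, of j] True ij e by auto
  next
    case False
    then show False using no_ear[OF p, of i j v] v ij e by auto
  qed
qed

text \<open>A common attachment point would have four neighbours, two of them on the path; two
  different ones would be the hubs of a double broom.\<close>

lemma branch_single:
  assumes f: "longest f L" and v: "v < n" "v \<notin> f ` {..<L}" and u: "u < n" "u \<notin> f ` {..<L}" "u \<noteq> v"
    and ij: "i \<le> j" "j < L" "E v (f i)"
  shows "\<not> E u (f j)"
proof
  assume e: "E u (f j)"
  have p: "gpath f L" using f by (rule longestD)
  have less: "f k < n" if "k < L" for k using path_less[OF p that] .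
  have eq: "f k = f l \<longleftrightarrow> k = l" if "k < L" "l < L" for k l using path_eq[OF p that] .
  have out: "f k \<noteq> v" "f k \<noteq> u" if "k < L" for k using that u v by auto
  have i: "0 < i" "Suc i < L" using branch_inner[OF f v, of i] ij by auto
  have j: "0 < j" "Suc j < L" using branch_inner[OF f u(1,2), of j] ij e by auto
  have sym: "E (f i) v" "E (f j) u" using E_sym less ij v u e by auto
  have ei: "E (f i) (f (i - 1))" using path_edge'[OF p, of "i - 1"] i by simp
  have ej: "E (f j) (f (Suc j))" using path_edge[OF p] j by simp
  show False
  proof (cases "i = j")
    case True
    show False
      by (rule no_four_neighbours[of "f i" "f (i - 1)" "f (Suc i)" u v])
        (use True i j less u v sym ei ej eq out in auto)
  next
    case False
    show False
      by (rule no_double_broom[OF p, of i j "f (i - 1)" v "f (Suc j)" u])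
        (use False ij i j less u v sym ei ej eq out in auto)
  qed
qed

text \<open>Maximality leaves at least two path vertices on each side of \<open>f i\<close>, because
  the branch through \<open>v\<close> to \<open>u\<close> has two vertices. Together they would form
  a spider.\<close>

lemma branch_leaf:
  assumes f: "longest f L" and v: "v < n" "v \<notin> f ` {..<L}" and u: "u < n" "u \<notin> f ` {..<L}" "u \<noteq> v"
    and i: "i < L" "E v (f i)"
  shows "\<not> E u v"
proof
  assume e: "E u v"
  have p: "gpath f L" using f by (rule longestD)
  have less: "f k < n" if "k < L" for k using path_less[OF p that] .
  have eq: "f k = f l \<longleftrightarrow> k = l" if "k < L" "l < L" for k l using path_eq[OF p that] .
  have out: "f k \<noteq> v" "f k \<noteq> u" if "k < L" for k using that u v by auto
  have i1: "0 < i" "Suc i < L" using branch_inner[OF f v i] by auto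
  have "i \<noteq> 1" using longest_no_two_tail[OF f u(1) v(1) u(2) v(2) e u(3)] i1 i by auto
  moreover have "L - Suc i \<noteq> 1"
  proof
    assume *: "L - Suc i = 1"
    then have "L - Suc 1 = i" by simp
    then show False
      using longest_no_two_tail[OF longest_rev[OF f] u(1) v(1) _ _ e u(3)] u(2) v(2) i1 i
      by (simp add: rev_image)
  qed
  ultimately have i2: "2 \<le> i" "i + 2 < L" using i1 by auto
  obtain k where k: "i = k + 2" using i2(1) by (metis add.commute le_iff_add)
  have "low n E"
  proof (rule low_of_spider[OF G, of "f i" "f (k + 1)" "f (k + 3)" v "f k" "f (k + 4)" u])
    show "E (f i) (f (k + 1))" "E (f i) (f (k + 3))" "E (f (k + 1)) (f k)" "E (f (k + 3)) (f (k + 4))"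
      using path_edge'[OF p, of "k + 1"] path_edge'[OF p, of k] path_edge[OF p, of "k + 2"]
        path_edge[OF p, of "k + 3"] k i2 by (simp_all add: numeral_eq_Suc)
    show "E (f i) v" "E v u" using E_sym less i u v e by auto
  qed (use k i2 less u v eq out in auto)
  then show False using not_low by simp
qed

text \<open>A branch at \<open>c\<close> or \<open>c + 2\<close> gives four neighbours, a branch
  away from the triangle a double broom, and a branch at \<open>c + 1\<close> a net. For the net the
  path must continue on both sides of the triangle, which holds since a triangle at an end would
  allow a longer path.\<close>

lemma branch_no_chord:
  assumes f: "longest f L" and v: "v < n" "v \<notin> f ` {..<L}" and i: "i < L" "E v (f i)" and c: "c + 2 < L"
  shows "\<not> E (f c) (f (c + 2))"
proof
  assume e: "E (f c) (f (c + 2))"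
  have p: "gpath f L" using f by (rule longestD)
  have less: "f k < n" if "k < L" for k using path_less[OF p that] .
  have eq: "f k = f l \<longleftrightarrow> k = l" if "k < L" "l < L" for k l using path_eq[OF p that] .
  have out: "f k \<noteq> v" if "k < L" for k using that v by auto
  have i1: "0 < i" "Suc i < L" using branch_inner[OF f v i] by auto
  have sym: "E (f i) v" "E (f (c + 2)) (f c)" using E_sym less i v e c by auto
  have prev: "E (f i) (f (i - 1))" using path_edge'[OF p, of "i - 1"] i1 by simp
  have succ: "E (f i) (f (Suc i))" using path_edge[OF p] i1 by simp
  have tri: "E (f c) (f (c + 1))" "E (f (c + 2)) (f (c + 1))" "E (f (c + 1)) (f (c + 2))"
    using path_edge[OF p, of c] path_edge'[OF p, of "c + 1"] path_edge[OF p, of "c + 1"] c by simp_all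
  consider "i = c" | "i = c + 1" | "i = c + 2" | "i < c" | "c + 2 < i" by linarith
  then show False
  proof cases
    case 1
    show False
      by (rule no_four_neighbours[of "f i" "f (i - 1)" "f (i + 1)" "f (i + 2)" v])
        (use 1 i1 c less v sym prev succ e eq out in auto)
  next
    case 3
    show False
      by (rule no_four_neighbours[of "f i" "f c" "f (c + 1)" "f (Suc i)" v])
        (use 3 i1 c less v sym tri succ eq out in auto)
  next
    case 2
    have "c \<noteq> 0"
    proof
      assume "c = 0"
      then show False using longest_no_end_triangle[OF f v] 2 i e c by (simp add: numeral_2_eq_2)
    qed
    moreover have "c + 3 \<noteq> L"
    proof
      assume *: "c + 3 = L"
      then have idx: "L - Suc 0 = c + 2" "L - Suc 1 = i" "L - Suc 2 = c" using 2 by auto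
      show False
        using longest_no_end_triangle[OF longest_rev[OF f] v(1)] v(2) i(2) sym(2) c
        unfolding rev_image idx by auto
    qed
    ultimately have c1: "0 < c" "c + 3 < L" using c by auto
    have "low n E"
    proof (rule low_of_net[OF G, of "f c" "f (c + 1)" "f (c + 2)" "f (c - 1)" v "f (c + 3)"])
      show "E (f c) (f (c - 1))" "E (f (c + 2)) (f (c + 3))"
        using path_edge'[OF p, of "c - 1"] path_edge[OF p, of "c + 2"] c1 by (simp_all add: numeral_eq_Suc)
      show "E (f (c + 1)) v" using sym 2 by simp
    qed (use c1 less v eq out tri e in auto)
    then show False using not_low by simp
  next
    case 4
    show False
      by (rule no_double_broom[OF p, of i c "f (i - 1)" v "f (c + 1)" "f (c + 2)"])
        (use 4 i1 c less v sym prev tri e eq out in auto)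
  next
    case 5
    show False
      by (rule no_double_broom[OF p, of "c + 2" i "f c" "f (c + 1)" "f (Suc i)" v])
        (use 5 i1 c less v sym succ tri e eq out in auto)
  qed
qed

lemma longest_exists:
  assumes "0 < n"
  obtains f L where "longest f L" "0 < L"
proof -
  define P where "P L \<longleftrightarrow> (\<exists>f. gpath f L)" for L
  have "P 1" using assms by (auto simp: P_def is_path_def inj_on_def intro!: exI[of _ "\<lambda>_. 0"])
  moreover have "\<forall>L. P L \<longrightarrow> L \<le> n"
  proof (intro allI impI)
    fix L assume "P L"
    then obtain f where "inj_on f {..<L}" "f ` {..<L} \<subseteq> {..<n}" by (auto simp: P_def is_path_def)
    then show "L \<le> n" using card_inj_on_le[of f "{..<L}" "{..<n}"] by simp
  qed
  ultimately have "\<exists>L. P L \<and> (\<forall>L'. P L' \<longrightarrow> L' \<le> L)"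
    using Greatest_le_nat[of P _ n] GreatestI_nat[of P 1 n] by (intro exI[of _ "Greatest P"]) blast
  then obtain L where L: "P L" "\<And>L'. P L' \<Longrightarrow> L' \<le> L" by blast
  obtain f where "gpath f L" using L(1) by (auto simp: P_def)
  moreover have "\<not> gpath g (Suc L)" for g using L(2)[of "Suc L"] by (auto simp: P_def)
  ultimately have "longest f L" by (simp add: longest_def)
  moreover have "0 < L" using L(2)[OF \<open>P 1\<close>] by simp
  ultimately show ?thesis by (rule that)
qed

end

section \<open>The shape of critical graphs\<close>

lemma (in critical_graph) longest_path_form:
  assumes con: "connected_graph n E" and f: "longest f L" "0 < L"
  shows "G_SSP n E"
proof -
  have p: "gpath f L" using f(1) by (rule longestD)
  have less: "f k < n" if "k < L" for k using path_less[OF p that] .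
  have eq: "f k = f l \<longleftrightarrow> k = l" if "k < L" "l < L" for k l using path_eq[OF p that] .
  have inj: "inj_on f {..<L}" and ran: "f ` {..<L} \<subseteq> {..<n}" using p by (auto simp: is_path_def)
  have step: "j = i + 1 \<or> j = i + 2" if "i < j" "j < L" "E (f i) (f j)" for i j
  proof (rule ccontr)
    assume "\<not> ?thesis"
    then have "i + 3 \<le> j" using \<open>i < j\<close> by linarith
    then show False using no_long_chord[OF p _ \<open>j < L\<close>] that by blast
  qed
  show ?thesis
  proof (cases "f ` {..<L} = {..<n}")
    case True
    then have "L = n" using card_image[OF inj] by simp
    have bij: "bij_betw f {..<n} {..<n}" using inj True \<open>L = n\<close> by (simp add: bij_betw_def)
    show ?thesis
    proof (cases "\<exists>c. c + 2 < n \<and> E (f c) (f (c + 2))")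
      case True
      then obtain c where c: "c + 2 < n" "E (f c) (f (c + 2))" by blast
      show ?thesis
      proof (rule SSP_path_with_chord[OF G bij])
        show "j = i + 1 \<or> i = c \<and> j = c + 2" if "i < j" "j < n" "E (f i) (f j)" for i j
        proof (rule ccontr)
          assume *: "\<not> ?thesis"
          then have "j = i + 2" "i \<noteq> c" using step[of i j] that \<open>L = n\<close> by auto
          then show False
            using chord_unique[OF p, of i c] chord_unique[OF p, of c i] c that \<open>L = n\<close>
            by (cases "i < c") auto
        qed
        show "E (f i) (f (i + 1))" if "i + 1 < n" for i using path_edge[OF p] that \<open>L = n\<close> by simp
        show "E (f c) (f (c + 2))" by (rule c)
      qed
    next
      case False
      show ?thesis
      \<comment> \<open>The value \<open>n\<close> puts the chord out of range.\<close>
      proof (rule SSP_path_with_chord[OF G bij, where c = n])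
        show "j = i + 1 \<or> i = n \<and> j = n + 2" if "i < j" "j < n" "E (f i) (f j)" for i j
          using step[of i j] that False \<open>L = n\<close> by auto
        show "E (f i) (f (i + 1))" if "i + 1 < n" for i using path_edge[OF p] that \<open>L = n\<close> by simp
      qed simp
    qed
  next
    case False
    then obtain t where t: "t < n" "t \<notin> f ` {..<L}" using ran by auto
    have "f 0 \<in> f ` {..<L}" using f(2) by simp
    then obtain x v where "x < n" "v < n" "x \<in> f ` {..<L}" "v \<notin> f ` {..<L}" "E x v"
      by (rule crossing_edge[OF con less[OF f(2)] t(1) _ t(2)])
    then have xv: "x \<in> f ` {..<L}" "v < n" "v \<notin> f ` {..<L}" "E x v" by blast+
    then obtain i where "i < L" "x = f i" by auto
    then have i: "i < L" "E v (f i)" using xv(2,4) E_sym[of "f i" v] less[of i] by auto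
    have iL: "0 < i" "Suc i < L" using branch_inner[OF f(1) xv(2,3) i] by auto
    \<comment> \<open>An edge leaving the path together with \<open>v\<close> would start at
      \<open>v\<close>, contradicting \<open>branch_leaf\<close>, or on the path, contradicting
      \<open>branch_single\<close> for whichever of the two branches attaches first.\<close>
    have all: "u \<in> insert v (f ` {..<L})" if un: "u < n" for u
    proof (rule ccontr)
      assume u: "u \<notin> insert v (f ` {..<L})"
      obtain y w where yw: "y < n" "w < n" "y \<in> insert v (f ` {..<L})" "w \<notin> insert v (f ` {..<L})" "E y w"
        by (rule crossing_edge[OF con xv(2) un insertI1 u])
      have "E w y" using yw(1,2,5) E_sym[of y w] by simp
      show False
      proof (cases "y = v")
        case True
        then show False using branch_leaf[OF f(1) xv(2,3) yw(2) _ _ i] yw(4) \<open>E w y\<close> by auto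
      next
        case False
        then obtain j where j: "j < L" "y = f j" using yw(3) by auto
        show False
        proof (cases "i \<le> j")
          case True
          then show False
            using branch_single[OF f(1) xv(2,3) yw(2) _ _ True j(1) i(2)] yw(4) \<open>E w y\<close> j by auto
        next
          case F: False
          then show False
            using branch_single[OF f(1) yw(2) _ xv(2,3) _ _ i(1), of j] yw(4) \<open>E w y\<close> j i(2) by auto
        qed
      qed
    qed
    have "{..<n} = insert v (f ` {..<L})" using all ran xv(2) by auto
    then have "card {..<n} = Suc (card (f ` {..<L}))" using xv(3) by (metis card_insert_disjoint finite_imageI finite_lessThan)
    then have nL: "n = Suc L" using card_image[OF inj] by simp
    \<comment> \<open>\<open>v\<close> is listed directly after its neighbour \<open>f i\<close>.
      The path edge from \<open>f i\<close> to \<open>f (i + 1)\<close> thereby becomes the chord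
      from \<open>i\<close> to \<open>i + 2\<close>, and the edge between positions
      \<open>i + 1\<close> and \<open>i + 2\<close> is the absent one.\<close>
    define g where "g k = (if k < i + 1 then f k else if k = i + 1 then v else f (k - 1))" for k
    have v_nbr: "k = i" if "k < L" "E v (f k)" for k
      using branch_unique[OF f(1) xv(2,3), of i k] branch_unique[OF f(1) xv(2,3), of k i] that i
      by (cases i k rule: linorder_cases) auto
    have out: "f k \<noteq> v" if "k < L" for k using xv(3) that by auto
    have g_inj: "inj_on g {..<n}"
    proof (rule linorder_inj_onI)
      fix a b assume ab: "a < b" "a \<in> {..<n}" "b \<in> {..<n}"
      then have "b - 1 < L" using nL by auto
      then show "g a \<noteq> g b"
        using ab iL nL eq[of a b] eq[of a "b - 1"] eq[of "a - 1" "b - 1"] out[of a] out[of "b - 1"]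
        by (auto simp: g_def)
    qed auto
    moreover have "g ` {..<n} \<subseteq> {..<n}" using less xv(2) iL nL by (auto simp: g_def)
    ultimately have bij: "bij_betw g {..<n} {..<n}"
      using endo_inj_surj[of "{..<n}" g] by (simp add: bij_betw_def)
    show ?thesis
    proof (rule SSP_path_with_chord[OF G bij, where c = i])
      fix a b assume ab: "a < b" "b < n" "E (g a) (g b)"
      have chord: "l = k + 1" if "k < l" "l < L" "E (f k) (f l)" for k l
        using step[OF that] branch_no_chord[OF f(1) xv(2,3) i, of k] that by auto
      consider "b \<le> i" | "b = i + 1" | "a = i + 1" | "a \<le> i" "i + 2 \<le> b" | "i + 2 \<le> a"
        using ab(1) by linarith
      then show "b = a + 1 \<or> a = i \<and> b = i + 2"
      proof cases
        case 1
        then show ?thesis using chord[of a b] ab nL iL by (auto simp: g_def)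
      next
        case 2
        then have "E v (f a)" using ab E_sym[of v "f a"] less[of a] xv(2) iL nL by (auto simp: g_def)
        then show ?thesis using v_nbr[of a] 2 ab iL by auto
      next
        case 3
        then have "E v (f (b - 1))" "b - 1 < L" "b - 1 \<noteq> i" using ab nL by (auto simp: g_def)
        then show ?thesis using v_nbr[of "b - 1"] by auto
      next
        case 4
        then have "b - 1 = a + 1" using chord[of a "b - 1"] ab nL by (auto simp: g_def)
        with 4 show ?thesis by linarith
      next
        case 5
        then have "b - 1 = a - 1 + 1" using chord[of "a - 1" "b - 1"] ab nL by (auto simp: g_def)
        with 5 show ?thesis by linarith
      qed
    next
      fix k assume k: "k + 1 < n" "k \<noteq> i + 1"
      consider "k < i" | "k = i" | "i + 2 \<le> k" using k(2) by linarith
      then show "E (g k) (g (k + 1))"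
      proof cases
        case 1
        then show ?thesis using path_edge[OF p, of k] iL by (simp add: g_def)
      next
        case 2
        then show ?thesis using i E_sym[of v "f i"] less xv(2) by (simp add: g_def)
      next
        case 3
        then have "Suc (k - 1) = k" by linarith
        with 3 show ?thesis using path_edge[OF p, of "k - 1"] k(1) nL by (simp add: g_def)
      qed
    next
      show "E (g i) (g (i + 2))" if "i + 2 < n" using path_edge[OF p, of i] iL by (simp add: g_def)
    qed
  qed
qed

theorem theorem5p6:
  fixes n :: nat and E :: "nat \<Rightarrow> nat \<Rightarrow> bool"
  assumes "simple_graph n E"
    and "connected_graph n E"
    and "int (q_graph n E) \<ge> int n - 1"
  shows "G_SSP n E"
proof (cases "n = 0")
  case True
  then show ?thesis
    by (auto simp: G_SSP_def SSP_def S_graph_def intro!: eq_matI)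
next
  case False
  interpret critical_graph n E
    using assms(1) not_low[OF assms(3)] by unfold_locales
  obtain f L where "longest f L" "0 < L" using longest_exists False by blast
  then show ?thesis by (rule longest_path_form[OF assms(2)])
qed

end
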